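(* Let $(\mathfrak{A}_n,\mathscr{H}_n,D_n)_{n\in\mathbb{N}}$ be a sequence of metric spectral triples converging to a metric spectral triple $(\mathfrak{A}_\infty,\mathscr{H}_\infty,D_\infty)$ for the spectral propinquity, i.e. $\lim_{n\to\infty}\Lambda^{\mathrm{spec}}((\mathfrak{A}_n,\mathscr{H}_n,D_n),(\mathfrak{A}_\infty,\mathscr{H}_\infty,D_\infty))=0$. Then for any $\Lambda\in(0,\infty)\setminus\mathrm{Sp}(D_\infty)$, there exists $N\in\mathbb{N}$ such that, if $n\geq N$, then $$\sum_{\substack{\lambda\in\mathrm{Sp}(D_n)\\ -\Lambda\leq\lambda\leq\Lambda}}\mathrm{multiplicity}(\lambda|D_n)=\sum_{\substack{\lambda\in\mathrm{Sp}(D_\infty)\\ -\Lambda\leq\lambda\leq\Lambda}}\mathrm{multiplicity}(\lambda|D_\infty)<\infty,$$ and moreover $$\lim_{n\to\infty}\mathrm{Haus}_{\mathbb{C}}\big(\mathrm{Sp}(D_n)\cap[-\Lambda,\Lambda],\ \mathrm{Sp}(D_\infty)\cap[-\Lambda,\Lambda]\big)=0.$$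
   Context: **Spectra.** $\mathrm{Sp}(D)$ is the spectrum of a self-adjoint operator $D$; for an eigenvalue $\lambda$ of $D$, $\mathrm{multiplicity}(\lambda|D)$ is the dimension of its eigenspace. $\mathrm{Haus}_{\mathbb{C}}$ is the Hausdorff distance for the usual metric of $\mathbb{C}$. **Quantum compact metric spaces.** For a unital C*-algebra $\mathfrak{A}$, let $\mathscr{S}(\mathfrak{A})$ be its state space, $\mathfrak{sa}(\mathfrak{A})$ its set of self-adjoint elements, $\Re a=\frac{a+a^*}{2}$, $\Im a=\frac{a-a^*}{2i}$. A quantum compact metric space $(\mathfrak{A},\mathsf{L})$ is a unital separable C*-algebra $\mathfrak{A}$ with a seminorm $\mathsf{L}$ defined on a dense Jordan-Lie subalgebra $\mathrm{dom}(\mathsf{L})$ of $\mathfrak{sa}(\mathfrak{A})$ (a subspace closed under $(a,b)\mapsto\Re(ab)$ and $(a,b)\mapsto\Im(ab)$), with $\mathsf{L}(1)=0$, such that: (1) $\mathsf{mk}_{\mathsf{L}}(\varphi,\psi)=\sup\{|\varphi(a)-\psi(a)|:a\in\mathrm{dom}(\mathsf{L}),\mathsf{L}(a)\leq1\}$ induces the weak* topology on $\mathscr{S}(\mathfrak{A})$; (2) $\max\{\mathsf{L}(\Re(ab)),\mathsf{L}(\Im(ab))\}\leq\|a\|\mathsf{L}(b)+\mathsf{L}(a)\|b\|$ for $a,b\in\mathrm{dom}(\mathsf{L})$; (3) $\{a\in\mathrm{dom}(\mathsf{L}):\mathsf{L}(a)\leq1\}$ is closed in $\mathfrak{A}$.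 A quantum isometry $\pi:(\mathfrak{A},\mathsf{L}_{\mathfrak{A}})\to(\mathfrak{B},\mathsf{L}_{\mathfrak{B}})$ is a surjective *-morphism $\pi:\mathfrak{A}\to\mathfrak{B}$ with $\pi(\mathrm{dom}(\mathsf{L}_{\mathfrak{A}}))=\mathrm{dom}(\mathsf{L}_{\mathfrak{B}})$ and $\mathsf{L}_{\mathfrak{B}}(b)=\inf\{\mathsf{L}_{\mathfrak{A}}(a):a\in\mathrm{dom}(\mathsf{L}_{\mathfrak{A}}),\pi(a)=b\}$ for all $b\in\mathrm{dom}(\mathsf{L}_{\mathfrak{B}})$. A tunnel from $(\mathfrak{A},\mathsf{L}_{\mathfrak{A}})$ to $(\mathfrak{B},\mathsf{L}_{\mathfrak{B}})$ is $(\mathfrak{D},\mathsf{L},\pi,\rho)$ with $(\mathfrak{D},\mathsf{L})$ a quantum compact metric space and $\pi:(\mathfrak{D},\mathsf{L})\to(\mathfrak{A},\mathsf{L}_{\mathfrak{A}})$, $\rho:(\mathfrak{D},\mathsf{L})\to(\mathfrak{B},\mathsf{L}_{\mathfrak{B}})$ quantum isometries; its extent is the maximum of the Hausdorff distances, for $\mathsf{mk}_{\mathsf{L}}$, from $\mathscr{S}(\mathfrak{D})$ to $\{\varphi\circ\pi:\varphi\in\mathscr{S}(\mathfrak{A})\}$ and from $\mathscr{S}(\mathfrak{D})$ to $\{\varphi\circ\rho:\varphi\in\mathscr{S}(\mathfrak{B})\}$. **Metrical C*-correspondences.** A C*-correspondence $(\mathscr{M},\mathfrak{A},\mathfrak{B})$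 is a (right) Hilbert $\mathfrak{B}$-module $\mathscr{M}$ with a *-morphism from $\mathfrak{A}$ to the adjointable operators on $\mathscr{M}$. A morphism $(\Pi,\pi,\rho):(\mathscr{M},\mathfrak{A},\mathfrak{B})\to(\mathscr{N},\mathfrak{D},\mathfrak{E})$ consists of unital *-morphisms $\pi:\mathfrak{A}\to\mathfrak{D}$, $\rho:\mathfrak{B}\to\mathfrak{E}$ and a linear map $\Pi:\mathscr{M}\to\mathscr{N}$ with $\Pi(a\omega b)=\pi(a)\Pi(\omega)\rho(b)$ and $\langle\Pi(\omega),\Pi(\eta)\rangle_{\mathscr{N}}=\rho(\langle\omega,\eta\rangle_{\mathscr{M}})$. A metrical C*-correspondence $(\mathscr{M},\mathsf{DN},\mathfrak{A},\mathsf{L}_{\mathfrak{A}},\mathfrak{B},\mathsf{L}_{\mathfrak{B}})$ is a C*-correspondence $(\mathscr{M},\mathfrak{A},\mathfrak{B})$ with $(\mathfrak{A},\mathsf{L}_{\mathfrak{A}})$, $(\mathfrak{B},\mathsf{L}_{\mathfrak{B}})$ quantum compact metric spaces and $\mathsf{DN}$ a norm on a dense $\mathbb{C}$-subspace $\mathrm{dom}(\mathsf{DN})$ of $\mathscr{M}$ such that: (1) $\{\omega:\mathsf{DN}(\omega)\leq1\}$ is compact in $\mathscr{M}$; (2) $\mathsf{DN}\geq\|\cdot\|_{\mathscr{M}}$; (3) $\max\{\mathsf{L}_{\mathfrak{B}}(\Re\langle\omega,\omega'\rangle),\mathsf{L}_{\mathfrak{B}}(\Im\langle\omega,\omega'\rangle)\}\leq2\mathsf{DN}(\omega)\mathsf{DN}(\omega')$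 for $\omega,\omega'\in\mathrm{dom}(\mathsf{DN})$; (4) $\mathsf{DN}(a\omega)\leq(\mathsf{L}_{\mathfrak{A}}(a)+\|a\|)\mathsf{DN}(\omega)$ for $a\in\mathrm{dom}(\mathsf{L}_{\mathfrak{A}})$, $\omega\in\mathrm{dom}(\mathsf{DN})$. A quantum isometry of metrical C*-correspondences is a morphism $(\Pi,\pi,\rho)$ with $\pi,\rho$ quantum isometries, $\Pi$ surjective, $\Pi(\mathrm{dom}(\mathsf{DN}_{\mathscr{M}}))=\mathrm{dom}(\mathsf{DN}_{\mathscr{N}})$, and $\mathsf{DN}_{\mathscr{N}}(\omega)=\inf\{\mathsf{DN}_{\mathscr{M}}(\eta):\eta\in\mathrm{dom}(\mathsf{DN}_{\mathscr{M}}),\Pi(\eta)=\omega\}$ for $\omega\in\mathrm{dom}(\mathsf{DN}_{\mathscr{N}})$. A metrical tunnel from $\mathbb{A}$ to $\mathbb{B}$ (metrical C*-correspondences) is a metrical C*-correspondence $\mathbb{P}=(\mathscr{M},\mathsf{DN},\mathfrak{D},\mathsf{L}_{\mathfrak{D}},\mathfrak{E},\mathsf{L}_{\mathfrak{E}})$ with quantum isometries $(\Pi,\pi,\varpi):\mathbb{P}\to\mathbb{A}$ and $(R,\rho,\varrho):\mathbb{P}\to\mathbb{B}$; its extent is the maximum of the extents of the tunnels $(\mathfrak{D},\mathsf{L}_{\mathfrak{D}},\pi,\rho)$ and $(\mathfrak{E},\mathsf{L}_{\mathfrak{E}},\varpi,\varrho)$. **Metric spectral triples.** A spectral triple $(\mathfrak{A},\mathscr{H},D)$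 is a unital C*-algebra $\mathfrak{A}$ acting on a Hilbert space $\mathscr{H}$ and a self-adjoint operator $D$ with dense domain $\mathrm{dom}(D)\subseteq\mathscr{H}$ and compact resolvent such that $\mathfrak{A}_D=\{a\in\mathfrak{A}:a\,\mathrm{dom}(D)\subseteq\mathrm{dom}(D)\text{ and }[D,a]\text{ is bounded on }\mathrm{dom}(D)\}$ is dense in $\mathfrak{A}$. Put $\mathsf{L}_D(a)=\|[D,a]\|$ (operator norm) for $a\in\mathfrak{A}_D$. The triple is metric when $(\mathfrak{A},\mathsf{L}_D)$ (with $\mathsf{L}_D$ restricted to $\mathfrak{sa}(\mathfrak{A})\cap\mathfrak{A}_D$) is a quantum compact metric space. It then defines the metrical C*-correspondence $\mathrm{metCor}(\mathfrak{A},\mathscr{H},D)=(\mathscr{H},\mathsf{DN}_D,\mathfrak{A},\mathsf{L}_D,\mathbb{C},0)$ where $\mathsf{DN}_D(\xi)=\|\xi\|+\|D\xi\|$ on $\mathrm{dom}(D)$. **Spectral propinquity.** Let $(\mathfrak{A},\mathscr{H}_{\mathfrak{A}},D_{\mathfrak{A}})$ and $(\mathfrak{B},\mathscr{H}_{\mathfrak{B}},D_{\mathfrak{B}})$ be metric spectral triples. A tunnel between them is a metrical tunnel $\tau$ between their $\mathrm{metCor}$'s; write $\mathsf{DN}$ for its norm, $\mathscr{B}=\{\omega:\mathsf{DN}(\omega)\leq1\}$, and $\Pi_{\mathfrak{A}},\Pi_{\mathfrak{B}}$ for its module maps onto $\mathscr{H}_{\mathfrak{A}},\mathscr{H}_{\mathfrak{B}}$.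 For $\varepsilon>0$ and $\omega,\omega'\in\mathscr{B}$ let $$k_{\tau,\varepsilon}(\omega,\omega')=\sup_{t\in[0,\varepsilon^{-1}]}\sup_{\zeta\in\mathscr{B}}\left|\langle e^{itD_{\mathfrak{A}}}\Pi_{\mathfrak{A}}\omega,\Pi_{\mathfrak{A}}\zeta\rangle_{\mathscr{H}_{\mathfrak{A}}}-\langle e^{itD_{\mathfrak{B}}}\Pi_{\mathfrak{B}}\omega',\Pi_{\mathfrak{B}}\zeta\rangle_{\mathscr{H}_{\mathfrak{B}}}\right|$$ and $\mathrm{sep}_\varepsilon(\tau)=\max\{\sup_{\omega\in\mathscr{B}}\inf_{\omega'\in\mathscr{B}}k_{\tau,\varepsilon}(\omega,\omega'),\ \sup_{\omega'\in\mathscr{B}}\inf_{\omega\in\mathscr{B}}k_{\tau,\varepsilon}(\omega,\omega')\}$. The spectral propinquity $\Lambda^{\mathrm{spec}}((\mathfrak{A},\mathscr{H}_{\mathfrak{A}},D_{\mathfrak{A}}),(\mathfrak{B},\mathscr{H}_{\mathfrak{B}},D_{\mathfrak{B}}))$ is the infimum of all $\varepsilon>0$ for which there is a tunnel $\tau$ between the two triples with $\max\{\text{extent of }\tau,\ \mathrm{sep}_\varepsilon(\tau)\}<\varepsilon$.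
   Formalization: It is also assumed that −Λ is not in Sp(D_∞): without this the claim fails (D_n = −1−1/n, D_∞ = −1 on ℂ, Λ = 1). Tunnels range over spaces carried by sets of at most continuum size, which covers all tunnels up to isomorphism. *)

theory Defs
  imports "HOL-Analysis.Analysis" "Jordan_Normal_Form.Missing_VectorSpace"
begin

hide_const (open) Modules.module

section \<open>C*-algebras and their states\<close>

text \<open>
  All structures are carrier-based, since the spaces of a sequence of spectral triples vary with
  the index and tunnels are quantified existentially. Complex vector spaces are modules, in the
  sense of HOL-Algebra, over the field \<open>\<complex>\<close>, which is itself represented by the
  C*-algebra \<open>complex_cstar\<close>. As in HOL-Algebra, the fields \<open>mult\<close> and
  \<open>one\<close> of a record that is only used as a vector space are meaningless.
\<close>

record 'a cstar = "(complex, 'a) module" +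
  star :: "'a \<Rightarrow> 'a"
  cnorm :: "'a \<Rightarrow> real"

definition complex_cstar :: "complex cstar" where
  "complex_cstar = \<lparr>carrier = UNIV, mult = (*), one = 1, zero = 0, add = (+),
     smult = (*), star = cnj, cnorm = cmod\<rparr>"

text \<open>
  The metric of a norm. It is set to zero off the carrier because the locale
  \<open>Metric_space\<close> asks for nonnegativity and symmetry on the whole type.
\<close>
definition ndist :: "('a, 'x) ring_scheme \<Rightarrow> ('a \<Rightarrow> real) \<Rightarrow> 'a \<Rightarrow> 'a \<Rightarrow> real" where
  "ndist V nrm x y =
     (if x \<in> carrier V \<and> y \<in> carrier V then nrm (x \<ominus>\<^bsub>V\<^esub> y) else 0)"

definition ctop :: "'a cstar \<Rightarrow> 'a topology" where
  "ctop A = Metric_space.mtopology (carrier A) (ndist A (cnorm A))"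

text \<open>Unital C*-algebras.\<close>
locale cstar_algebra = ring A + scalar: module complex_cstar A
  for A :: "'a cstar" (structure) +
  assumes smult_mult_left: "\<lbrakk>x \<in> carrier A; y \<in> carrier A\<rbrakk> \<Longrightarrow>
      (z \<odot>\<^bsub>A\<^esub> x) \<otimes>\<^bsub>A\<^esub> y = z \<odot>\<^bsub>A\<^esub> (x \<otimes>\<^bsub>A\<^esub> y)"
    and smult_mult_right: "\<lbrakk>x \<in> carrier A; y \<in> carrier A\<rbrakk> \<Longrightarrow>
      x \<otimes>\<^bsub>A\<^esub> (z \<odot>\<^bsub>A\<^esub> y) = z \<odot>\<^bsub>A\<^esub> (x \<otimes>\<^bsub>A\<^esub> y)"
    and star_closed: "x \<in> carrier A \<Longrightarrow> star A x \<in> carrier A"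
    and star_star: "x \<in> carrier A \<Longrightarrow> star A (star A x) = x"
    and star_add: "\<lbrakk>x \<in> carrier A; y \<in> carrier A\<rbrakk> \<Longrightarrow>
      star A (x \<oplus>\<^bsub>A\<^esub> y) = star A x \<oplus>\<^bsub>A\<^esub> star A y"
    and star_smult: "x \<in> carrier A \<Longrightarrow> star A (z \<odot>\<^bsub>A\<^esub> x) = cnj z \<odot>\<^bsub>A\<^esub> star A x"
    and star_mult: "\<lbrakk>x \<in> carrier A; y \<in> carrier A\<rbrakk> \<Longrightarrow>
      star A (x \<otimes>\<^bsub>A\<^esub> y) = star A y \<otimes>\<^bsub>A\<^esub> star A x"
    and cnorm_nonneg: "x \<in> carrier A \<Longrightarrow> 0 \<le> cnorm A x"
    and cnorm_eq_0: "x \<in> carrier A \<Longrightarrow> cnorm A x = 0 \<longleftrightarrow> x = \<zero>\<^bsub>A\<^esub>"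
    and cnorm_triangle: "\<lbrakk>x \<in> carrier A; y \<in> carrier A\<rbrakk> \<Longrightarrow>
      cnorm A (x \<oplus>\<^bsub>A\<^esub> y) \<le> cnorm A x + cnorm A y"
    and cnorm_smult: "x \<in> carrier A \<Longrightarrow> cnorm A (z \<odot>\<^bsub>A\<^esub> x) = cmod z * cnorm A x"
    and cnorm_mult: "\<lbrakk>x \<in> carrier A; y \<in> carrier A\<rbrakk> \<Longrightarrow>
      cnorm A (x \<otimes>\<^bsub>A\<^esub> y) \<le> cnorm A x * cnorm A y"
    and cstar_identity: "x \<in> carrier A \<Longrightarrow> cnorm A (star A x \<otimes>\<^bsub>A\<^esub> x) = (cnorm A x)\<^sup>2"
    and complete: "Metric_space.mcomplete (carrier A) (ndist A (cnorm A))"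

definition sa :: "'a cstar \<Rightarrow> 'a set" where
  "sa A = {a \<in> carrier A. star A a = a}"

definition Re_part :: "'a cstar \<Rightarrow> 'a \<Rightarrow> 'a" where
  "Re_part A a = (1/2) \<odot>\<^bsub>A\<^esub> (a \<oplus>\<^bsub>A\<^esub> star A a)"

definition Im_part :: "'a cstar \<Rightarrow> 'a \<Rightarrow> 'a" where
  "Im_part A a = (1/(2*\<i>)) \<odot>\<^bsub>A\<^esub> (a \<ominus>\<^bsub>A\<^esub> star A a)"

definition positive_elements :: "'a cstar \<Rightarrow> 'a set" where
  "positive_elements A = (\<lambda>b. star A b \<otimes>\<^bsub>A\<^esub> b) ` carrier A"

text \<open>States are extensional functions, so that two states agreeing on the algebra are equal.\<close>
definition states :: "'a cstar \<Rightarrow> ('a \<Rightarrow> complex) set" where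
  "states A = {\<phi> \<in> extensional (carrier A).
     (\<forall>x\<in>carrier A. \<forall>y\<in>carrier A. \<phi> (x \<oplus>\<^bsub>A\<^esub> y) = \<phi> x + \<phi> y) \<and>
     (\<forall>z. \<forall>x\<in>carrier A. \<phi> (z \<odot>\<^bsub>A\<^esub> x) = z * \<phi> x) \<and>
     (\<forall>x\<in>positive_elements A. \<phi> x \<in> \<real>\<^sub>\<ge>\<^sub>0) \<and>
     \<phi> \<one>\<^bsub>A\<^esub> = 1}"

definition weak_star :: "'a cstar \<Rightarrow> ('a \<Rightarrow> complex) topology" where
  "weak_star A = subtopology (product_topology (\<lambda>_. euclidean) (carrier A)) (states A)"

definition star_hom :: "'a cstar \<Rightarrow> 'b cstar \<Rightarrow> ('a \<Rightarrow> 'b) \<Rightarrow> bool" where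
  "star_hom A B \<pi> \<longleftrightarrow> \<pi> \<in> carrier A \<rightarrow> carrier B \<and>
     (\<forall>x\<in>carrier A. \<forall>y\<in>carrier A. \<pi> (x \<oplus>\<^bsub>A\<^esub> y) = \<pi> x \<oplus>\<^bsub>B\<^esub> \<pi> y) \<and>
     (\<forall>z. \<forall>x\<in>carrier A. \<pi> (z \<odot>\<^bsub>A\<^esub> x) = z \<odot>\<^bsub>B\<^esub> \<pi> x) \<and>
     (\<forall>x\<in>carrier A. \<forall>y\<in>carrier A. \<pi> (x \<otimes>\<^bsub>A\<^esub> y) = \<pi> x \<otimes>\<^bsub>B\<^esub> \<pi> y) \<and>
     (\<forall>x\<in>carrier A. \<pi> (star A x) = star B (\<pi> x))"

definition unital_star_hom :: "'a cstar \<Rightarrow> 'b cstar \<Rightarrow> ('a \<Rightarrow> 'b) \<Rightarrow> bool" where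
  "unital_star_hom A B \<pi> \<longleftrightarrow> star_hom A B \<pi> \<and> \<pi> \<one>\<^bsub>A\<^esub> = \<one>\<^bsub>B\<^esub>"

section \<open>Quantum compact metric spaces\<close>

text \<open>
  Values in \<open>ennreal\<close> give the usual conventions for the empty set: distance zero to itself
  and infinite distance to any nonempty set.
\<close>
definition hausdorff :: "('p \<Rightarrow> 'p \<Rightarrow> ennreal) \<Rightarrow> 'p set \<Rightarrow> 'p set \<Rightarrow> ennreal" where
  "hausdorff d X Y = max (SUP x\<in>X. INF y\<in>Y. d x y) (SUP y\<in>Y. INF x\<in>X. d x y)"

record 'a qcms =
  alg :: "'a cstar"
  ldom :: "'a set"
  lip :: "'a \<Rightarrow> real"

definition mk :: "'a qcms \<Rightarrow> ('a \<Rightarrow> complex) \<Rightarrow> ('a \<Rightarrow> complex) \<Rightarrow> ennreal" where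
  "mk Q \<phi> \<psi> = (SUP a \<in> {a \<in> ldom Q. lip Q a \<le> 1}. ennreal (cmod (\<phi> a - \<psi> a)))"

definition quantum_compact_metric_space :: "'a qcms \<Rightarrow> bool" where
  "quantum_compact_metric_space Q \<longleftrightarrow> (let A = alg Q; dom = ldom Q; L = lip Q in
     cstar_algebra A \<and> separable_space (ctop A) \<and>
     \<comment> \<open>the domain is a dense Jordan-Lie subalgebra of the self-adjoint part\<close>
     dom \<subseteq> sa A \<and> sa A \<subseteq> ctop A closure_of dom \<and>
     \<zero>\<^bsub>A\<^esub> \<in> dom \<and>
     (\<forall>a\<in>dom. \<forall>b\<in>dom. a \<oplus>\<^bsub>A\<^esub> b \<in> dom) \<and>
     (\<forall>r::real. \<forall>a\<in>dom. complex_of_real r \<odot>\<^bsub>A\<^esub> a \<in> dom) \<and>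
     (\<forall>a\<in>dom. \<forall>b\<in>dom. Re_part A (a \<otimes>\<^bsub>A\<^esub> b) \<in> dom \<and> Im_part A (a \<otimes>\<^bsub>A\<^esub> b) \<in> dom) \<and>
     \<comment> \<open>seminorm\<close>
     (\<forall>a\<in>dom. 0 \<le> L a) \<and>
     (\<forall>a\<in>dom. \<forall>b\<in>dom. L (a \<oplus>\<^bsub>A\<^esub> b) \<le> L a + L b) \<and>
     (\<forall>r::real. \<forall>a\<in>dom. L (complex_of_real r \<odot>\<^bsub>A\<^esub> a) = \<bar>r\<bar> * L a) \<and>
     \<one>\<^bsub>A\<^esub> \<in> dom \<and> L \<one>\<^bsub>A\<^esub> = 0 \<and>
     \<comment> \<open>the weak* topology is the topology of \<open>mk\<close>\<close>
     (\<forall>U. openin (weak_star A) U \<longleftrightarrow> U \<subseteq> states A \<and>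
        (\<forall>\<phi>\<in>U. \<exists>e>0. \<forall>\<psi>\<in>states A. mk Q \<phi> \<psi> < e \<longrightarrow> \<psi> \<in> U)) \<and>
     \<comment> \<open>Leibniz inequality\<close>
     (\<forall>a\<in>dom. \<forall>b\<in>dom. max (L (Re_part A (a \<otimes>\<^bsub>A\<^esub> b))) (L (Im_part A (a \<otimes>\<^bsub>A\<^esub> b)))
        \<le> cnorm A a * L b + L a * cnorm A b) \<and>
     closedin (ctop A) {a \<in> dom. L a \<le> 1})"

definition quantum_isometry :: "'a qcms \<Rightarrow> 'b qcms \<Rightarrow> ('a \<Rightarrow> 'b) \<Rightarrow> bool" where
  "quantum_isometry Q R \<pi> \<longleftrightarrow>
     star_hom (alg Q) (alg R) \<pi> \<and> \<pi> ` carrier (alg Q) = carrier (alg R) \<and>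
     \<pi> ` ldom Q = ldom R \<and>
     (\<forall>b\<in>ldom R. lip R b = Inf (lip Q ` {a \<in> ldom Q. \<pi> a = b}))"

definition tunnel ::
  "'d qcms \<Rightarrow> 'a qcms \<Rightarrow> 'b qcms \<Rightarrow> ('d \<Rightarrow> 'a) \<Rightarrow> ('d \<Rightarrow> 'b) \<Rightarrow> bool" where
  "tunnel D A B \<pi> \<rho> \<longleftrightarrow>
     quantum_compact_metric_space D \<and> quantum_isometry D A \<pi> \<and> quantum_isometry D B \<rho>"

definition pullback_states :: "'d qcms \<Rightarrow> 'a qcms \<Rightarrow> ('d \<Rightarrow> 'a) \<Rightarrow> ('d \<Rightarrow> complex) set" where
  "pullback_states D A \<pi> = (\<lambda>\<phi>. compose (carrier (alg D)) \<phi> \<pi>) ` states (alg A)"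

definition tunnel_extent ::
  "'d qcms \<Rightarrow> 'a qcms \<Rightarrow> 'b qcms \<Rightarrow> ('d \<Rightarrow> 'a) \<Rightarrow> ('d \<Rightarrow> 'b) \<Rightarrow> ennreal" where
  "tunnel_extent D A B \<pi> \<rho> =
     max (hausdorff (mk D) (states (alg D)) (pullback_states D A \<pi>))
         (hausdorff (mk D) (states (alg D)) (pullback_states D B \<rho>))"

section \<open>Hilbert modules and metrical C*-correspondences\<close>

record ('b, 'm) hmodule = "(complex, 'm) module" +
  ract :: "'m \<Rightarrow> 'b \<Rightarrow> 'm"
  ip :: "'m \<Rightarrow> 'm \<Rightarrow> 'b"

definition hnorm :: "'b cstar \<Rightarrow> ('b, 'm) hmodule \<Rightarrow> 'm \<Rightarrow> real" where
  "hnorm B M \<omega> = sqrt (cnorm B (ip M \<omega> \<omega>))"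

definition htop :: "'b cstar \<Rightarrow> ('b, 'm) hmodule \<Rightarrow> 'm topology" where
  "htop B M = Metric_space.mtopology (carrier M) (ndist M (hnorm B M))"

text \<open>Right Hilbert modules; the inner product is linear in its second argument.\<close>
locale hilbert_module = B: cstar_algebra B + M: module complex_cstar M
  for B :: "'b cstar" and M :: "('b, 'm) hmodule" +
  assumes ract_closed: "\<lbrakk>\<omega> \<in> carrier M; b \<in> carrier B\<rbrakk> \<Longrightarrow> ract M \<omega> b \<in> carrier M"
    and ract_add_left: "\<lbrakk>\<omega> \<in> carrier M; \<eta> \<in> carrier M; b \<in> carrier B\<rbrakk> \<Longrightarrow>
      ract M (\<omega> \<oplus>\<^bsub>M\<^esub> \<eta>) b = ract M \<omega> b \<oplus>\<^bsub>M\<^esub> ract M \<eta> b"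
    and ract_add_right: "\<lbrakk>\<omega> \<in> carrier M; b \<in> carrier B; c \<in> carrier B\<rbrakk> \<Longrightarrow>
      ract M \<omega> (b \<oplus>\<^bsub>B\<^esub> c) = ract M \<omega> b \<oplus>\<^bsub>M\<^esub> ract M \<omega> c"
    and ract_mult: "\<lbrakk>\<omega> \<in> carrier M; b \<in> carrier B; c \<in> carrier B\<rbrakk> \<Longrightarrow>
      ract M \<omega> (b \<otimes>\<^bsub>B\<^esub> c) = ract M (ract M \<omega> b) c"
    and ract_one: "\<omega> \<in> carrier M \<Longrightarrow> ract M \<omega> \<one>\<^bsub>B\<^esub> = \<omega>"
    and ract_smult_left: "\<lbrakk>\<omega> \<in> carrier M; b \<in> carrier B\<rbrakk> \<Longrightarrow>
      ract M (z \<odot>\<^bsub>M\<^esub> \<omega>) b = z \<odot>\<^bsub>M\<^esub> ract M \<omega> b"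
    and ract_smult_right: "\<lbrakk>\<omega> \<in> carrier M; b \<in> carrier B\<rbrakk> \<Longrightarrow>
      ract M \<omega> (z \<odot>\<^bsub>B\<^esub> b) = z \<odot>\<^bsub>M\<^esub> ract M \<omega> b"
    and ip_closed: "\<lbrakk>\<omega> \<in> carrier M; \<eta> \<in> carrier M\<rbrakk> \<Longrightarrow> ip M \<omega> \<eta> \<in> carrier B"
    and ip_add: "\<lbrakk>\<omega> \<in> carrier M; \<eta> \<in> carrier M; \<zeta> \<in> carrier M\<rbrakk> \<Longrightarrow>
      ip M \<omega> (\<eta> \<oplus>\<^bsub>M\<^esub> \<zeta>) = ip M \<omega> \<eta> \<oplus>\<^bsub>B\<^esub> ip M \<omega> \<zeta>"
    and ip_smult: "\<lbrakk>\<omega> \<in> carrier M; \<eta> \<in> carrier M\<rbrakk> \<Longrightarrow>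
      ip M \<omega> (z \<odot>\<^bsub>M\<^esub> \<eta>) = z \<odot>\<^bsub>B\<^esub> ip M \<omega> \<eta>"
    and ip_ract: "\<lbrakk>\<omega> \<in> carrier M; \<eta> \<in> carrier M; b \<in> carrier B\<rbrakk> \<Longrightarrow>
      ip M \<omega> (ract M \<eta> b) = ip M \<omega> \<eta> \<otimes>\<^bsub>B\<^esub> b"
    and ip_star: "\<lbrakk>\<omega> \<in> carrier M; \<eta> \<in> carrier M\<rbrakk> \<Longrightarrow> star B (ip M \<omega> \<eta>) = ip M \<eta> \<omega>"
    and ip_pos: "\<omega> \<in> carrier M \<Longrightarrow> ip M \<omega> \<omega> \<in> positive_elements B"
    and ip_definite: "\<lbrakk>\<omega> \<in> carrier M; ip M \<omega> \<omega> = \<zero>\<^bsub>B\<^esub>\<rbrakk> \<Longrightarrow> \<omega> = \<zero>\<^bsub>M\<^esub>"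
    and complete: "Metric_space.mcomplete (carrier M) (ndist M (hnorm B M))"

definition is_adjoint :: "('b, 'm) hmodule \<Rightarrow> ('m \<Rightarrow> 'm) \<Rightarrow> ('m \<Rightarrow> 'm) \<Rightarrow> bool" where
  "is_adjoint M S S' \<longleftrightarrow> S \<in> carrier M \<rightarrow> carrier M \<and> S' \<in> carrier M \<rightarrow> carrier M \<and>
     (\<forall>\<omega>\<in>carrier M. \<forall>\<eta>\<in>carrier M. ip M (S \<omega>) \<eta> = ip M \<omega> (S' \<eta>))"

text \<open>
  *-morphisms into the adjointable operators. Having an adjoint already forces each operator to be
  a bounded module map.
\<close>
definition star_action :: "'a cstar \<Rightarrow> ('b, 'm) hmodule \<Rightarrow> ('a \<Rightarrow> 'm \<Rightarrow> 'm) \<Rightarrow> bool" where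
  "star_action A M act \<longleftrightarrow>
     (\<forall>a\<in>carrier A. is_adjoint M (act a) (act (star A a))) \<and>
     (\<forall>a\<in>carrier A. \<forall>b\<in>carrier A. \<forall>\<omega>\<in>carrier M.
        act (a \<oplus>\<^bsub>A\<^esub> b) \<omega> = act a \<omega> \<oplus>\<^bsub>M\<^esub> act b \<omega> \<and>
        act (a \<otimes>\<^bsub>A\<^esub> b) \<omega> = act a (act b \<omega>)) \<and>
     (\<forall>z. \<forall>a\<in>carrier A. \<forall>\<omega>\<in>carrier M. act (z \<odot>\<^bsub>A\<^esub> a) \<omega> = z \<odot>\<^bsub>M\<^esub> act a \<omega>)"

definition cstar_correspondence ::
  "('b, 'm) hmodule \<Rightarrow> 'a cstar \<Rightarrow> 'b cstar \<Rightarrow> ('a \<Rightarrow> 'm \<Rightarrow> 'm) \<Rightarrow> bool" where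
  "cstar_correspondence M A B act \<longleftrightarrow>
     cstar_algebra A \<and> hilbert_module B M \<and> star_action A M act"

record ('a, 'b, 'm) metcor =
  hmod :: "('b, 'm) hmodule"
  dndom :: "'m set"
  dn :: "'m \<Rightarrow> real"
  lq :: "'a qcms"
  rq :: "'b qcms"
  lact :: "'a \<Rightarrow> 'm \<Rightarrow> 'm"

definition dn_ball :: "('a, 'b, 'm) metcor \<Rightarrow> 'm set" where
  "dn_ball P = {\<omega> \<in> dndom P. dn P \<omega> \<le> 1}"

definition metrical_cstar_correspondence :: "('a, 'b, 'm) metcor \<Rightarrow> bool" where
  "metrical_cstar_correspondence P \<longleftrightarrow>
    (let M = hmod P; A = alg (lq P); B = alg (rq P); dom = dndom P; DN = dn P in
     cstar_correspondence M A B (lact P) \<and>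
     quantum_compact_metric_space (lq P) \<and> quantum_compact_metric_space (rq P) \<and>
     submodule complex_cstar dom M \<and> htop B M closure_of dom = carrier M \<and>
     \<comment> \<open>norm\<close>
     (\<forall>\<omega>\<in>dom. 0 \<le> DN \<omega> \<and> (DN \<omega> = 0 \<longleftrightarrow> \<omega> = \<zero>\<^bsub>M\<^esub>)) \<and>
     (\<forall>\<omega>\<in>dom. \<forall>\<eta>\<in>dom. DN (\<omega> \<oplus>\<^bsub>M\<^esub> \<eta>) \<le> DN \<omega> + DN \<eta>) \<and>
     (\<forall>z. \<forall>\<omega>\<in>dom. DN (z \<odot>\<^bsub>M\<^esub> \<omega>) = cmod z * DN \<omega>) \<and>
     compactin (htop B M) (dn_ball P) \<and>
     (\<forall>\<omega>\<in>dom. hnorm B M \<omega> \<le> DN \<omega>) \<and>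
     \<comment> \<open>inner Leibniz inequality\<close>
     (\<forall>\<omega>\<in>dom. \<forall>\<eta>\<in>dom.
        Re_part B (ip M \<omega> \<eta>) \<in> ldom (rq P) \<and> Im_part B (ip M \<omega> \<eta>) \<in> ldom (rq P) \<and>
        max (lip (rq P) (Re_part B (ip M \<omega> \<eta>))) (lip (rq P) (Im_part B (ip M \<omega> \<eta>)))
          \<le> 2 * DN \<omega> * DN \<eta>) \<and>
     \<comment> \<open>modular Leibniz inequality\<close>
     (\<forall>a\<in>ldom (lq P). \<forall>\<omega>\<in>dom. lact P a \<omega> \<in> dom \<and>
        DN (lact P a \<omega>) \<le> (lip (lq P) a + cnorm A a) * DN \<omega>))"

definition correspondence_morphism ::
  "('a, 'b, 'm) metcor \<Rightarrow> ('c, 'd, 'n) metcor \<Rightarrow>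
   ('m \<Rightarrow> 'n) \<Rightarrow> ('a \<Rightarrow> 'c) \<Rightarrow> ('b \<Rightarrow> 'd) \<Rightarrow> bool" where
  "correspondence_morphism P Q \<Phi> \<pi> \<rho> \<longleftrightarrow>
    (let M = hmod P; N = hmod Q in
     unital_star_hom (alg (lq P)) (alg (lq Q)) \<pi> \<and>
     unital_star_hom (alg (rq P)) (alg (rq Q)) \<rho> \<and>
     \<Phi> \<in> carrier M \<rightarrow> carrier N \<and>
     (\<forall>\<omega>\<in>carrier M. \<forall>\<eta>\<in>carrier M. \<Phi> (\<omega> \<oplus>\<^bsub>M\<^esub> \<eta>) = \<Phi> \<omega> \<oplus>\<^bsub>N\<^esub> \<Phi> \<eta>) \<and>
     (\<forall>z. \<forall>\<omega>\<in>carrier M. \<Phi> (z \<odot>\<^bsub>M\<^esub> \<omega>) = z \<odot>\<^bsub>N\<^esub> \<Phi> \<omega>) \<and>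
     (\<forall>a\<in>carrier (alg (lq P)). \<forall>b\<in>carrier (alg (rq P)). \<forall>\<omega>\<in>carrier M.
        \<Phi> (ract M (lact P a \<omega>) b) = ract N (lact Q (\<pi> a) (\<Phi> \<omega>)) (\<rho> b)) \<and>
     (\<forall>\<omega>\<in>carrier M. \<forall>\<eta>\<in>carrier M. ip N (\<Phi> \<omega>) (\<Phi> \<eta>) = \<rho> (ip M \<omega> \<eta>)))"

definition metrical_quantum_isometry ::
  "('a, 'b, 'm) metcor \<Rightarrow> ('c, 'd, 'n) metcor \<Rightarrow>
   ('m \<Rightarrow> 'n) \<Rightarrow> ('a \<Rightarrow> 'c) \<Rightarrow> ('b \<Rightarrow> 'd) \<Rightarrow> bool" where
  "metrical_quantum_isometry P Q \<Phi> \<pi> \<rho> \<longleftrightarrow>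
     correspondence_morphism P Q \<Phi> \<pi> \<rho> \<and>
     quantum_isometry (lq P) (lq Q) \<pi> \<and> quantum_isometry (rq P) (rq Q) \<rho> \<and>
     \<Phi> ` carrier (hmod P) = carrier (hmod Q) \<and>
     \<Phi> ` dndom P = dndom Q \<and>
     (\<forall>\<omega>\<in>dndom Q. dn Q \<omega> = Inf (dn P ` {\<eta> \<in> dndom P. \<Phi> \<eta> = \<omega>}))"

record ('d, 'e, 'm, 'a1, 'b1, 'm1, 'a2, 'b2, 'm2) mtunnel =
  tun :: "('d, 'e, 'm) metcor"
  mod1 :: "'m \<Rightarrow> 'm1"
  left1 :: "'d \<Rightarrow> 'a1"
  right1 :: "'e \<Rightarrow> 'b1"
  mod2 :: "'m \<Rightarrow> 'm2"
  left2 :: "'d \<Rightarrow> 'a2"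
  right2 :: "'e \<Rightarrow> 'b2"

definition metrical_tunnel ::
  "('a1, 'b1, 'm1) metcor \<Rightarrow> ('a2, 'b2, 'm2) metcor \<Rightarrow>
   ('d, 'e, 'm, 'a1, 'b1, 'm1, 'a2, 'b2, 'm2) mtunnel \<Rightarrow> bool" where
  "metrical_tunnel P Q \<tau> \<longleftrightarrow> metrical_cstar_correspondence (tun \<tau>) \<and>
     metrical_quantum_isometry (tun \<tau>) P (mod1 \<tau>) (left1 \<tau>) (right1 \<tau>) \<and>
     metrical_quantum_isometry (tun \<tau>) Q (mod2 \<tau>) (left2 \<tau>) (right2 \<tau>)"

definition mtunnel_extent ::
  "('a1, 'b1, 'm1) metcor \<Rightarrow> ('a2, 'b2, 'm2) metcor \<Rightarrow>
   ('d, 'e, 'm, 'a1, 'b1, 'm1, 'a2, 'b2, 'm2) mtunnel \<Rightarrow> ennreal" where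
  "mtunnel_extent P Q \<tau> =
     max (tunnel_extent (lq (tun \<tau>)) (lq P) (lq Q) (left1 \<tau>) (left2 \<tau>))
         (tunnel_extent (rq (tun \<tau>)) (rq P) (rq Q) (right1 \<tau>) (right2 \<tau>))"

section \<open>Unbounded operators on Hilbert spaces\<close>

text \<open>A Hilbert space is a Hilbert module over the C*-algebra of complex numbers.\<close>
type_synonym 'h hilbert = "(complex, 'h) hmodule"

abbreviation hilbert_space :: "'h hilbert \<Rightarrow> bool" where
  "hilbert_space H \<equiv> hilbert_module complex_cstar H"

abbreviation vnorm :: "'h hilbert \<Rightarrow> 'h \<Rightarrow> real" where
  "vnorm H \<equiv> hnorm complex_cstar H"

abbreviation vtop :: "'h hilbert \<Rightarrow> 'h topology" where
  "vtop H \<equiv> htop complex_cstar H"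

text \<open>An operator \<open>D\<close> is always given together with its domain \<open>X\<close>.\<close>
definition densely_defined :: "'h hilbert \<Rightarrow> 'h set \<Rightarrow> ('h \<Rightarrow> 'h) \<Rightarrow> bool" where
  "densely_defined H X D \<longleftrightarrow>
     submodule complex_cstar X H \<and> vtop H closure_of X = carrier H \<and>
     D \<in> X \<rightarrow> carrier H \<and>
     (\<forall>\<xi>\<in>X. \<forall>\<eta>\<in>X. D (\<xi> \<oplus>\<^bsub>H\<^esub> \<eta>) = D \<xi> \<oplus>\<^bsub>H\<^esub> D \<eta>) \<and>
     (\<forall>z. \<forall>\<xi>\<in>X. D (z \<odot>\<^bsub>H\<^esub> \<xi>) = z \<odot>\<^bsub>H\<^esub> D \<xi>)"

definition adjoint_graph :: "'h hilbert \<Rightarrow> 'h set \<Rightarrow> ('h \<Rightarrow> 'h) \<Rightarrow> ('h \<times> 'h) set" where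
  "adjoint_graph H X D = {(\<eta>, \<zeta>). \<eta> \<in> carrier H \<and> \<zeta> \<in> carrier H \<and>
     (\<forall>\<xi>\<in>X. ip H (D \<xi>) \<eta> = ip H \<xi> \<zeta>)}"

definition self_adjoint :: "'h hilbert \<Rightarrow> 'h set \<Rightarrow> ('h \<Rightarrow> 'h) \<Rightarrow> bool" where
  "self_adjoint H X D \<longleftrightarrow>
     densely_defined H X D \<and> adjoint_graph H X D = (\<lambda>\<xi>. (\<xi>, D \<xi>)) ` X"

definition resolvent_set :: "'h hilbert \<Rightarrow> 'h set \<Rightarrow> ('h \<Rightarrow> 'h) \<Rightarrow> complex set" where
  "resolvent_set H X D = {z. bij_betw (\<lambda>\<xi>. D \<xi> \<ominus>\<^bsub>H\<^esub> z \<odot>\<^bsub>H\<^esub> \<xi>) X (carrier H) \<and>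
     (\<exists>C. \<forall>\<xi>\<in>X. vnorm H \<xi> \<le> C * vnorm H (D \<xi> \<ominus>\<^bsub>H\<^esub> z \<odot>\<^bsub>H\<^esub> \<xi>))}"

definition resolvent :: "'h hilbert \<Rightarrow> 'h set \<Rightarrow> ('h \<Rightarrow> 'h) \<Rightarrow> complex \<Rightarrow> 'h \<Rightarrow> 'h" where
  "resolvent H X D z = inv_into X (\<lambda>\<xi>. D \<xi> \<ominus>\<^bsub>H\<^esub> z \<odot>\<^bsub>H\<^esub> \<xi>)"

definition compact_operator :: "'h hilbert \<Rightarrow> ('h \<Rightarrow> 'h) \<Rightarrow> bool" where
  "compact_operator H K \<longleftrightarrow>
     compactin (vtop H) (vtop H closure_of (K ` {\<xi> \<in> carrier H. vnorm H \<xi> \<le> 1}))"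

definition compact_resolvent :: "'h hilbert \<Rightarrow> 'h set \<Rightarrow> ('h \<Rightarrow> 'h) \<Rightarrow> bool" where
  "compact_resolvent H X D \<longleftrightarrow>
     (\<exists>z\<in>resolvent_set H X D. compact_operator H (resolvent H X D z))"

definition unitary :: "'h hilbert \<Rightarrow> ('h \<Rightarrow> 'h) \<Rightarrow> bool" where
  "unitary H U \<longleftrightarrow> U ` carrier H = carrier H \<and>
     (\<forall>\<xi>\<in>carrier H. \<forall>\<eta>\<in>carrier H. U (\<xi> \<oplus>\<^bsub>H\<^esub> \<eta>) = U \<xi> \<oplus>\<^bsub>H\<^esub> U \<eta>) \<and>
     (\<forall>z. \<forall>\<xi>\<in>carrier H. U (z \<odot>\<^bsub>H\<^esub> \<xi>) = z \<odot>\<^bsub>H\<^esub> U \<xi>) \<and>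
     (\<forall>\<xi>\<in>carrier H. \<forall>\<eta>\<in>carrier H. ip H (U \<xi>) (U \<eta>) = ip H \<xi> \<eta>)"

text \<open>Strongly continuous one-parameter unitary groups with infinitesimal generator \<open>\<i> D\<close>.\<close>
definition generated_group ::
  "'h hilbert \<Rightarrow> 'h set \<Rightarrow> ('h \<Rightarrow> 'h) \<Rightarrow> (real \<Rightarrow> 'h \<Rightarrow> 'h) \<Rightarrow> bool" where
  "generated_group H X D U \<longleftrightarrow>
     (\<forall>t. unitary H (U t)) \<and>
     (\<forall>\<xi>\<in>carrier H. U 0 \<xi> = \<xi>) \<and>
     (\<forall>s t. \<forall>\<xi>\<in>carrier H. U (s + t) \<xi> = U s (U t \<xi>)) \<and>
     (\<forall>\<xi>\<in>carrier H. \<forall>s. limitin (vtop H) (\<lambda>t. U t \<xi>) (U s \<xi>) (at s)) \<and>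
     {(\<xi>, \<zeta>). \<xi> \<in> carrier H \<and> \<zeta> \<in> carrier H \<and>
        limitin (vtop H) (\<lambda>t. complex_of_real (1/t) \<odot>\<^bsub>H\<^esub> (U t \<xi> \<ominus>\<^bsub>H\<^esub> \<xi>)) \<zeta> (at 0)}
       = (\<lambda>\<xi>. (\<xi>, \<i> \<odot>\<^bsub>H\<^esub> D \<xi>)) ` X"

text \<open>
  \<open>exp_i H X D t\<close> is the operator \<open>exp(i t D)\<close>. By Stone's theorem the group exists
  and is unique on the carrier for every self-adjoint \<open>D\<close>.
\<close>
definition exp_i :: "'h hilbert \<Rightarrow> 'h set \<Rightarrow> ('h \<Rightarrow> 'h) \<Rightarrow> real \<Rightarrow> 'h \<Rightarrow> 'h" where
  "exp_i H X D t \<xi> = (THE \<zeta>. \<exists>U. generated_group H X D U \<and> \<zeta> = U t \<xi>)"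

section \<open>Metric spectral triples\<close>

record ('a, 'h) spectral_triple =
  st_alg :: "'a cstar"
  st_hilb :: "'h hilbert"
  st_rep :: "'a \<Rightarrow> 'h \<Rightarrow> 'h"
  st_dom :: "'h set"
  st_op :: "'h \<Rightarrow> 'h"

definition commutator :: "('a, 'h) spectral_triple \<Rightarrow> 'a \<Rightarrow> 'h \<Rightarrow> 'h" where
  "commutator T a \<xi> =
     st_op T (st_rep T a \<xi>) \<ominus>\<^bsub>st_hilb T\<^esub> st_rep T a (st_op T \<xi>)"

definition lipschitz_elements :: "('a, 'h) spectral_triple \<Rightarrow> 'a set" where
  "lipschitz_elements T = {a \<in> carrier (st_alg T). st_rep T a ` st_dom T \<subseteq> st_dom T \<and>
     (\<exists>C. \<forall>\<xi>\<in>st_dom T. vnorm (st_hilb T) (commutator T a \<xi>) \<le> C * vnorm (st_hilb T) \<xi>)}"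

definition L_D :: "('a, 'h) spectral_triple \<Rightarrow> 'a \<Rightarrow> real" where
  "L_D T a = (SUP \<xi> \<in> {\<xi> \<in> st_dom T. vnorm (st_hilb T) \<xi> \<le> 1}.
     vnorm (st_hilb T) (commutator T a \<xi>))"

definition is_spectral_triple :: "('a, 'h) spectral_triple \<Rightarrow> bool" where
  "is_spectral_triple T \<longleftrightarrow>
     cstar_algebra (st_alg T) \<and> hilbert_space (st_hilb T) \<and>
     star_action (st_alg T) (st_hilb T) (st_rep T) \<and>
     self_adjoint (st_hilb T) (st_dom T) (st_op T) \<and>
     compact_resolvent (st_hilb T) (st_dom T) (st_op T) \<and>
     ctop (st_alg T) closure_of lipschitz_elements T = carrier (st_alg T)"

definition st_qcms :: "('a, 'h) spectral_triple \<Rightarrow> 'a qcms" where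
  "st_qcms T = \<lparr>alg = st_alg T, ldom = sa (st_alg T) \<inter> lipschitz_elements T, lip = L_D T\<rparr>"

definition metric_spectral_triple :: "('a, 'h) spectral_triple \<Rightarrow> bool" where
  "metric_spectral_triple T \<longleftrightarrow>
     is_spectral_triple T \<and> quantum_compact_metric_space (st_qcms T)"

definition metCor :: "('a, 'h) spectral_triple \<Rightarrow> ('a, complex, 'h) metcor" where
  "metCor T = \<lparr>hmod = st_hilb T, dndom = st_dom T,
     dn = (\<lambda>\<xi>. vnorm (st_hilb T) \<xi> + vnorm (st_hilb T) (st_op T \<xi>)),
     lq = st_qcms T,
     rq = \<lparr>alg = complex_cstar, ldom = sa complex_cstar, lip = (\<lambda>_. 0)\<rparr>,
     lact = st_rep T\<rparr>"

definition Sp :: "('a, 'h) spectral_triple \<Rightarrow> complex set" where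
  "Sp T = - resolvent_set (st_hilb T) (st_dom T) (st_op T)"

definition eigenspace :: "('a, 'h) spectral_triple \<Rightarrow> complex \<Rightarrow> 'h set" where
  "eigenspace T z = {\<xi> \<in> st_dom T. st_op T \<xi> = z \<odot>\<^bsub>st_hilb T\<^esub> \<xi>}"

text \<open>
  The library's \<open>dim\<close> is only meaningful in finite dimension, hence the case distinction.
\<close>
definition eig_multiplicity :: "complex \<Rightarrow> ('a, 'h) spectral_triple \<Rightarrow> enat" where
  "eig_multiplicity z T = (let E = (st_hilb T)\<lparr>carrier := eigenspace T z\<rparr> in
     if vectorspace.fin_dim complex_cstar E
     then enat (vectorspace.dim complex_cstar E) else \<infinity>)"

section \<open>The spectral propinquity\<close>

text \<open>
  A tunnel has separable algebras (by definition) and a separable module (the norm's unit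
  ball is compact with dense linear span), so all its spaces have at most the cardinality of the
  continuum. Up to isomorphism every tunnel is therefore carried by subsets of
  \<open>nat set\<close>, and it is enough to let tunnels range over this type.
\<close>
type_synonym ('a, 'h, 'b, 'k) triple_tunnel =
  "(nat set, nat set, nat set, 'a, complex, 'h, 'b, complex, 'k) mtunnel"

definition triple_exp :: "('a, 'h) spectral_triple \<Rightarrow> real \<Rightarrow> 'h \<Rightarrow> 'h" where
  "triple_exp T = exp_i (st_hilb T) (st_dom T) (st_op T)"

definition orbit_distance :: "('a, 'h) spectral_triple \<Rightarrow> ('b, 'k) spectral_triple \<Rightarrow>
   ('a, 'h, 'b, 'k) triple_tunnel \<Rightarrow> real \<Rightarrow> nat set \<Rightarrow> nat set \<Rightarrow> ennreal" where
  "orbit_distance S T \<tau> \<epsilon> \<omega> \<omega>' =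
     (SUP t \<in> {0..1/\<epsilon>}. SUP \<zeta> \<in> dn_ball (tun \<tau>). ennreal (cmod
        (ip (st_hilb S) (triple_exp S t (mod1 \<tau> \<omega>)) (mod1 \<tau> \<zeta>)
         - ip (st_hilb T) (triple_exp T t (mod2 \<tau> \<omega>')) (mod2 \<tau> \<zeta>))))"

definition sep :: "('a, 'h) spectral_triple \<Rightarrow> ('b, 'k) spectral_triple \<Rightarrow>
   ('a, 'h, 'b, 'k) triple_tunnel \<Rightarrow> real \<Rightarrow> ennreal" where
  "sep S T \<tau> \<epsilon> = (let \<B> = dn_ball (tun \<tau>); k = orbit_distance S T \<tau> \<epsilon> in
     max (SUP \<omega>\<in>\<B>. INF \<omega>'\<in>\<B>. k \<omega> \<omega>') (SUP \<omega>'\<in>\<B>. INF \<omega>\<in>\<B>. k \<omega> \<omega>'))"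

definition spectral_propinquity ::
  "('a, 'h) spectral_triple \<Rightarrow> ('b, 'k) spectral_triple \<Rightarrow> ennreal" where
  "spectral_propinquity S T = Inf {ennreal \<epsilon> | \<epsilon>. 0 < \<epsilon> \<and>
     (\<exists>\<tau> :: ('a, 'h, 'b, 'k) triple_tunnel. metrical_tunnel (metCor S) (metCor T) \<tau> \<and>
        max (mtunnel_extent (metCor S) (metCor T) \<tau>) (sep S T \<tau> \<epsilon>) < ennreal \<epsilon>)}"

section \<open>Spectra in compact intervals\<close>

text \<open>
  Continuity of this set in the triple requires that neither endpoint of the interval lies in the
  spectrum of the limit: on a one-dimensional space the operators \<open>-1 - 1/n\<close> converge
  to \<open>-1\<close>, which lies in \<open>[-1, 1]\<close> while they do not.
\<close>

definition Sp_in :: "('a, 'h) spectral_triple \<Rightarrow> real \<Rightarrow> complex set" where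
  "Sp_in T \<Lambda> = Sp T \<inter> complex_of_real ` {-\<Lambda>..\<Lambda>}"

end

theory Submission
  imports Defs
begin

text \<open>
  A tunnel of small extent and separation relates each \<open>x\<close> in the \<open>DN\<close>-ball of one triple to some
  \<open>y\<close> in the \<open>DN\<close>-ball of the other so that \<open>\<langle>exp(itD) x, x'\<rangle>\<close> and \<open>\<langle>exp(itD') y, y'\<rangle>\<close> almost agree for
  all related pairs and all \<open>t\<close> in a long interval: the separation gives this for some partner of
  \<open>x\<close>, and the extent of the right tunnel, between two copies of \<open>\<complex>\<close>, forces all partners to be
  close. If the \<open>y\<^sub>i\<close> are multiples of orthonormal eigenvectors for eigenvalues \<open>\<mu>\<^sub>i\<close>, then the \<open>x\<^sub>i\<close>
  are almost orthogonal and \<open>exp(itD) x\<^sub>i\<close> is close to \<open>exp(it\<mu>\<^sub>i) x\<^sub>i\<close>. Testing this at finitely many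
  times \<open>t = 2\<^sup>j / Q\<close> and bounding large frequencies by \<open>\<parallel>D x\<^sub>i\<parallel> \<le> 1\<close> shows that almost all of the mass
  of \<open>x\<^sub>i\<close> in an eigenbasis of \<open>D\<close> sits at eigenvalues near \<open>\<mu>\<^sub>i\<close>. By a Bessel inequality for
  almost orthonormal families there are then at least as many such eigenvalues, with
  multiplicity, as there are \<open>y\<^sub>i\<close>. The relation is symmetric, so this applies in both directions,
  and the gap of the limit spectrum at \<open>\<plusminus>\<Lambda>\<close> turns the two inequalities into an equality.
\<close>

section \<open>Hilbert spaces\<close>

text \<open>Nothing bounds in advance the number of eigenvalues of \<open>D_n\<close> in the window.
  Families of test vectors are therefore limited in size to one more than the count of the limit,
  which is enough to refute an excess, and all tolerances depend only on the window, the accuracy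
  and that size, so that they serve every \<open>n\<close> at once. The times are powers of two over
  \<open>Q\<close> because doubling an angle at least triples its squared chord as long as this is
  below 1: a number of tests logarithmic in \<open>Q/\<delta>\<close> exposes every frequency offset
  between \<open>\<delta>\<close> and \<open>Q\<close>. The diagonal form of \<open>D\<close> is
  built from the definition of self-adjointness. Eigenvectors minimise the norm of
  \<open>D x\<close>, since the Rayleigh quotient need not be bounded on either side;
  \<open>exp_i\<close>, a definite description, is identified with the diagonal group through a
  scalar differential equation. Multiplicities then become numbers of basis vectors.\<close>

lemma complex_cstar_simps [simp]:
  "carrier complex_cstar = UNIV" "mult complex_cstar = (*)" "one complex_cstar = 1"
  "zero complex_cstar = 0" "add complex_cstar = (+)" "smult complex_cstar = (*)"
  "star complex_cstar = cnj" "cnorm complex_cstar = cmod"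
  by (simp_all add: complex_cstar_def)

lemma cnj_mult_self:
  "cnj z * z = (complex_of_real (cmod z))\<^sup>2" "z * cnj z = (complex_of_real (cmod z))\<^sup>2"
proof -
  show "z * cnj z = (complex_of_real (cmod z))\<^sup>2"
    by (metis complex_norm_square of_real_power)
  then show "cnj z * z = (complex_of_real (cmod z))\<^sup>2" by (simp only: mult.commute)
qed

lemma positive_elements_complex: "positive_elements complex_cstar \<subseteq> {of_real r |r. 0 \<le> r}"
proof
  fix z assume "z \<in> positive_elements complex_cstar"
  then obtain b where "z = cnj b * b" by (auto simp: positive_elements_def)
  then have "z = of_real ((cmod b)\<^sup>2)" by (simp add: cnj_mult_self)
  then show "z \<in> {of_real r |r. 0 \<le> r}" by (intro CollectI exI[of _ "(cmod b)\<^sup>2"]) simp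
qed

locale hilbert = hilbert_module complex_cstar H for H :: "'h hilbert"
begin

abbreviation nrm :: "'h \<Rightarrow> real" where "nrm \<equiv> vnorm H"

lemma closed [simp]:
  "\<zero>\<^bsub>H\<^esub> \<in> carrier H"
  "\<lbrakk>x \<in> carrier H; y \<in> carrier H\<rbrakk> \<Longrightarrow> x \<oplus>\<^bsub>H\<^esub> y \<in> carrier H"
  "\<lbrakk>x \<in> carrier H; y \<in> carrier H\<rbrakk> \<Longrightarrow> x \<ominus>\<^bsub>H\<^esub> y \<in> carrier H"
  "x \<in> carrier H \<Longrightarrow> z \<odot>\<^bsub>H\<^esub> x \<in> carrier H"
  by (simp_all add: M.smult_closed)

lemma cnj_ip: "\<lbrakk>x \<in> carrier H; y \<in> carrier H\<rbrakk> \<Longrightarrow> cnj (ip H x y) = ip H y x"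
  using ip_star[of x y] by simp

lemma ip_add_right [simp]:
  "\<lbrakk>x \<in> carrier H; y \<in> carrier H; z \<in> carrier H\<rbrakk> \<Longrightarrow>
    ip H x (y \<oplus>\<^bsub>H\<^esub> z) = ip H x y + ip H x z"
  using ip_add[of x y z] by simp

lemma ip_smult_right [simp]:
  "\<lbrakk>x \<in> carrier H; y \<in> carrier H\<rbrakk> \<Longrightarrow> ip H x (c \<odot>\<^bsub>H\<^esub> y) = c * ip H x y"
  using ip_smult[of x y c] by simp

lemma ip_zero_right [simp]: "x \<in> carrier H \<Longrightarrow> ip H x \<zero>\<^bsub>H\<^esub> = 0"
  using ip_add_right[of x "\<zero>\<^bsub>H\<^esub>" "\<zero>\<^bsub>H\<^esub>"] by simp

lemma ip_diff_right [simp]: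
  assumes "x \<in> carrier H" "y \<in> carrier H" "z \<in> carrier H"
  shows "ip H x (y \<ominus>\<^bsub>H\<^esub> z) = ip H x y - ip H x z"
proof -
  have "ip H x (z \<oplus>\<^bsub>H\<^esub> \<ominus>\<^bsub>H\<^esub> z) = 0"
    using assms by (simp add: M.r_neg)
  then have "ip H x (\<ominus>\<^bsub>H\<^esub> z) = - ip H x z"
    using assms by (simp add: add_eq_0_iff)
  then show ?thesis using assms by (simp add: a_minus_def)
qed

lemma ip_add_left [simp]:
  "\<lbrakk>x \<in> carrier H; y \<in> carrier H; z \<in> carrier H\<rbrakk> \<Longrightarrow>
    ip H (x \<oplus>\<^bsub>H\<^esub> y) z = ip H x z + ip H y z"
  by (simp flip: cnj_ip[of z])

lemma ip_diff_left [simp]: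
  "\<lbrakk>x \<in> carrier H; y \<in> carrier H; z \<in> carrier H\<rbrakk> \<Longrightarrow>
    ip H (x \<ominus>\<^bsub>H\<^esub> y) z = ip H x z - ip H y z"
  by (simp flip: cnj_ip[of z])

lemma ip_smult_left [simp]:
  "\<lbrakk>x \<in> carrier H; z \<in> carrier H\<rbrakk> \<Longrightarrow> ip H (c \<odot>\<^bsub>H\<^esub> x) z = cnj c * ip H x z"
  by (simp flip: cnj_ip[of z])

lemma ip_zero_left [simp]: "z \<in> carrier H \<Longrightarrow> ip H \<zero>\<^bsub>H\<^esub> z = 0"
  by (simp flip: cnj_ip[of z])

lemma ip_self: "x \<in> carrier H \<Longrightarrow> ip H x x = of_real ((nrm x)\<^sup>2)"
  using ip_pos[of x] positive_elements_complex by (auto simp: hnorm_def)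

lemma nrm_sq: "x \<in> carrier H \<Longrightarrow> (nrm x)\<^sup>2 = Re (ip H x x)"
  by (simp add: ip_self)

lemma nrm_nonneg [simp]: "0 \<le> nrm x"
  by (simp add: hnorm_def)

lemma nrm_eq_0_iff [simp]: "x \<in> carrier H \<Longrightarrow> nrm x = 0 \<longleftrightarrow> x = \<zero>\<^bsub>H\<^esub>"
  using ip_definite[of x] by (auto simp: hnorm_def)

lemma nrm_zero [simp]: "nrm \<zero>\<^bsub>H\<^esub> = 0"
  by (simp add: hnorm_def)

lemma nrm_eqI: "x \<in> carrier H \<Longrightarrow> 0 \<le> c \<Longrightarrow> Re (ip H x x) = c\<^sup>2 \<Longrightarrow> nrm x = c"
  by (metis nrm_nonneg nrm_sq power2_eq_imp_eq)

text \<open>Testing against all vectors turns a vector identity into identities between complex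
  numbers, which the simplifier settles with the rules for \<open>ip\<close>. Vector equations below
  are mostly proved in this way.\<close>

lemma ip_eqI:
  assumes "x \<in> carrier H" "y \<in> carrier H" "\<And>z. z \<in> carrier H \<Longrightarrow> ip H z x = ip H z y"
  shows "x = y"
proof -
  have "ip H (x \<ominus>\<^bsub>H\<^esub> y) (x \<ominus>\<^bsub>H\<^esub> y) = 0" using assms by (simp del: ip_diff_left)
  then have "x \<ominus>\<^bsub>H\<^esub> y = \<zero>\<^bsub>H\<^esub>" using assms by (intro ip_definite) auto
  then show ?thesis using assms by simp
qed

lemma nrm_smult [simp]:
  assumes "x \<in> carrier H"
  shows "nrm (c \<odot>\<^bsub>H\<^esub> x) = cmod c * nrm x"
proof (rule nrm_eqI)
  have "ip H (c \<odot>\<^bsub>H\<^esub> x) (c \<odot>\<^bsub>H\<^esub> x) = (cnj c * c) * ip H x x"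
    using assms by simp
  also have "\<dots> = of_real ((cmod c * nrm x)\<^sup>2)"
    using assms by (simp only: cnj_mult_self ip_self) (simp add: power_mult_distrib)
  finally show "Re (ip H (c \<odot>\<^bsub>H\<^esub> x) (c \<odot>\<^bsub>H\<^esub> x)) = (cmod c * nrm x)\<^sup>2"
    by simp
qed (use assms in auto)

lemma nrm_diff_sq:
  "\<lbrakk>x \<in> carrier H; y \<in> carrier H\<rbrakk> \<Longrightarrow>
    (nrm (x \<ominus>\<^bsub>H\<^esub> y))\<^sup>2 = (nrm x)\<^sup>2 + (nrm y)\<^sup>2 - 2 * Re (ip H x y)"
  by (simp add: nrm_sq, subst cnj_ip[of x y, symmetric], simp_all)

lemma nrm_add_sq:
  "\<lbrakk>x \<in> carrier H; y \<in> carrier H\<rbrakk> \<Longrightarrow>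
    (nrm (x \<oplus>\<^bsub>H\<^esub> y))\<^sup>2 = (nrm x)\<^sup>2 + (nrm y)\<^sup>2 + 2 * Re (ip H x y)"
  by (simp add: nrm_sq, subst cnj_ip[of x y, symmetric], simp_all)

lemma Cauchy_Schwarz:
  assumes x: "x \<in> carrier H" and y: "y \<in> carrier H"
  shows "cmod (ip H x y) \<le> nrm x * nrm y"
proof (cases "nrm y = 0")
  case True
  then show ?thesis using x y by simp
next
  case False
  \<comment> \<open>The coefficient of the orthogonal projection of \<open>x\<close> onto
    \<open>y\<close>.\<close>
  define c where "c = ip H y x / of_real ((nrm y)\<^sup>2)"
  have "0 \<le> (nrm (x \<ominus>\<^bsub>H\<^esub> c \<odot>\<^bsub>H\<^esub> y))\<^sup>2" by simp
  also have "\<dots> = (nrm x)\<^sup>2 + (cmod c * nrm y)\<^sup>2 - 2 * Re (c * ip H x y)"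
    using x y by (simp add: nrm_diff_sq)
  also have "c * ip H x y = of_real ((cmod (ip H x y))\<^sup>2 / (nrm y)\<^sup>2)"
    using x y by (simp add: c_def cnj_mult_self flip: cnj_ip[of x y])
  also have "cmod c * nrm y = cmod (ip H x y) / nrm y"
    using x y False by (simp add: c_def norm_divide norm_mult power2_eq_square flip: cnj_ip[of x y])
  finally have "(cmod (ip H x y))\<^sup>2 / (nrm y)\<^sup>2 \<le> (nrm x)\<^sup>2"
    by (simp add: power_divide)
  then have "(cmod (ip H x y))\<^sup>2 \<le> (nrm x * nrm y)\<^sup>2"
    using False by (simp add: field_simps power_mult_distrib)
  then show ?thesis by (rule power2_le_imp_le) simp
qed

lemma nrm_triangle:
  assumes "x \<in> carrier H" "y \<in> carrier H"
  shows "nrm (x \<oplus>\<^bsub>H\<^esub> y) \<le> nrm x + nrm y"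
proof (rule power2_le_imp_le)
  have "Re (ip H x y) \<le> nrm x * nrm y"
    using Cauchy_Schwarz[OF assms] complex_Re_le_cmod[of "ip H x y"] by linarith
  then show "(nrm (x \<oplus>\<^bsub>H\<^esub> y))\<^sup>2 \<le> (nrm x + nrm y)\<^sup>2"
    using assms by (simp add: nrm_add_sq power2_sum)
qed simp

lemma nrm_minus_commute:
  "\<lbrakk>x \<in> carrier H; y \<in> carrier H\<rbrakk> \<Longrightarrow> nrm (x \<ominus>\<^bsub>H\<^esub> y) = nrm (y \<ominus>\<^bsub>H\<^esub> x)"
  by (rule nrm_eqI) (simp_all add: nrm_sq algebra_simps)

lemma diff_add_diff:
  "\<lbrakk>x \<in> carrier H; y \<in> carrier H; z \<in> carrier H\<rbrakk> \<Longrightarrow>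
    (x \<ominus>\<^bsub>H\<^esub> y) \<oplus>\<^bsub>H\<^esub> (y \<ominus>\<^bsub>H\<^esub> z) = x \<ominus>\<^bsub>H\<^esub> z"
  by (rule ip_eqI) simp_all

lemma nrm_triangle_diff:
  "\<lbrakk>x \<in> carrier H; y \<in> carrier H; z \<in> carrier H\<rbrakk> \<Longrightarrow>
    nrm (x \<ominus>\<^bsub>H\<^esub> z) \<le> nrm (x \<ominus>\<^bsub>H\<^esub> y) + nrm (y \<ominus>\<^bsub>H\<^esub> z)"
  using nrm_triangle[of "x \<ominus>\<^bsub>H\<^esub> y" "y \<ominus>\<^bsub>H\<^esub> z"] by (simp add: diff_add_diff)

lemma diff_eq_0_iff:
  "\<lbrakk>x \<in> carrier H; y \<in> carrier H\<rbrakk> \<Longrightarrow> x \<ominus>\<^bsub>H\<^esub> y = \<zero>\<^bsub>H\<^esub> \<longleftrightarrow> x = y"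
  by simp

sublocale metric: Metric_space "carrier H" "ndist H nrm"
proof
  fix x y
  show "0 \<le> ndist H nrm x y" by (simp add: ndist_def)
  show "ndist H nrm x y = ndist H nrm y x"
    by (simp add: ndist_def nrm_minus_commute)
next
  fix x y z assume "x \<in> carrier H" "y \<in> carrier H" "z \<in> carrier H"
  then show "ndist H nrm x z \<le> ndist H nrm x y + ndist H nrm y z"
    by (simp add: ndist_def nrm_triangle_diff)
next
  fix x y assume "x \<in> carrier H" "y \<in> carrier H"
  then show "ndist H nrm x y = 0 \<longleftrightarrow> x = y" by (simp add: ndist_def)
qed

lemma limitin_iff:
  "limitin (vtop H) f l F \<longleftrightarrow> l \<in> carrier H \<and> (\<forall>\<^sub>F x in F. f x \<in> carrier H) \<and>
     ((\<lambda>x. nrm (f x \<ominus>\<^bsub>H\<^esub> l)) \<longlongrightarrow> 0) F"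
  (is "?L = ?R")
proof -
  have "?L \<longleftrightarrow> l \<in> carrier H \<and>
      (\<forall>e>0. \<forall>\<^sub>F x in F. f x \<in> carrier H \<and> ndist H nrm (f x) l < e)"
    by (simp add: htop_def metric.limitin_metric)
  also have "\<dots> \<longleftrightarrow> l \<in> carrier H \<and>
      (\<forall>e>0. (\<forall>\<^sub>F x in F. f x \<in> carrier H) \<and> (\<forall>\<^sub>F x in F. nrm (f x \<ominus>\<^bsub>H\<^esub> l) < e))"
    by (rule conj_cong[OF refl], simp only: flip: eventually_conj_iff,
        intro all_cong1 imp_cong[OF refl] arg_cong[where f = "\<lambda>P. eventually P F"])
      (auto simp: ndist_def fun_eq_iff)
  also have "\<dots> \<longleftrightarrow> ?R"
  proof -
    have "(\<forall>e>0. P \<and> Q e) \<longleftrightarrow> P \<and> (\<forall>e>0. Q e)" for P and Q :: "real \<Rightarrow> bool"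
      by (cases P) (auto intro: exI[of _ 1])
    then show ?thesis by (simp add: tendsto_iff)
  qed
  finally show ?thesis .
qed

lemma ip_tendsto:
  assumes "limitin (vtop H) f l F" "y \<in> carrier H"
  shows "((\<lambda>x. ip H y (f x)) \<longlongrightarrow> ip H y l) F"
proof (rule Lim_null[THEN iffD2], rule Lim_null_comparison)
  have *: "l \<in> carrier H" "\<forall>\<^sub>F x in F. f x \<in> carrier H"
      "((\<lambda>x. nrm (f x \<ominus>\<^bsub>H\<^esub> l)) \<longlongrightarrow> 0) F"
    using assms by (auto simp: limitin_iff)
  show "\<forall>\<^sub>F x in F. norm (ip H y (f x) - ip H y l) \<le> nrm y * nrm (f x \<ominus>\<^bsub>H\<^esub> l)"
    using *(2)
  proof eventually_elim
    case (elim x)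
    then show ?case using Cauchy_Schwarz[of y "f x \<ominus>\<^bsub>H\<^esub> l"] assms *(1) by simp
  qed
  show "((\<lambda>x. nrm y * nrm (f x \<ominus>\<^bsub>H\<^esub> l)) \<longlongrightarrow> 0) F"
    using tendsto_mult_right_zero[OF *(3)] .
qed

lemma nrm_tendsto:
  assumes "limitin (vtop H) f l F"
  shows "((\<lambda>x. nrm (f x)) \<longlongrightarrow> nrm l) F"
proof (rule Lim_null[THEN iffD2], rule Lim_null_comparison)
  have *: "l \<in> carrier H" "\<forall>\<^sub>F x in F. f x \<in> carrier H"
      "((\<lambda>x. nrm (f x \<ominus>\<^bsub>H\<^esub> l)) \<longlongrightarrow> 0) F"
    using assms by (auto simp: limitin_iff)
  show "\<forall>\<^sub>F x in F. norm (nrm (f x) - nrm l) \<le> nrm (f x \<ominus>\<^bsub>H\<^esub> l)"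
    using *(2)
  proof eventually_elim
    case (elim x)
    have "x \<ominus>\<^bsub>H\<^esub> \<zero>\<^bsub>H\<^esub> = x" if "x \<in> carrier H" for x
      by (rule ip_eqI) (use that in simp_all)
    then have "nrm (f x) \<le> nrm (f x \<ominus>\<^bsub>H\<^esub> l) + nrm l"
        "nrm l \<le> nrm (f x \<ominus>\<^bsub>H\<^esub> l) + nrm (f x)"
      using elim *(1) nrm_triangle_diff[of "f x" l "\<zero>\<^bsub>H\<^esub>"]
        nrm_triangle_diff[of l "f x" "\<zero>\<^bsub>H\<^esub>"] nrm_minus_commute[of l "f x"]
      by simp_all
    then show ?case by simp
  qed
  show "((\<lambda>x. nrm (f x \<ominus>\<^bsub>H\<^esub> l)) \<longlongrightarrow> 0) F" by (rule *(3))
qed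

lemma Cauchy_convergent:
  assumes "\<And>n. x n \<in> carrier H"
    and "\<And>e. 0 < e \<Longrightarrow> \<exists>N. \<forall>m\<ge>N. \<forall>n\<ge>N. nrm (x m \<ominus>\<^bsub>H\<^esub> x n) < e"
  obtains l where "limitin (vtop H) x l sequentially"
proof -
  have "metric.MCauchy x"
    unfolding metric.MCauchy_def
  proof (intro conjI allI impI)
    show "range x \<subseteq> carrier H" using assms(1) by auto
    fix e :: real assume "0 < e"
    then obtain N where "\<forall>m\<ge>N. \<forall>n\<ge>N. nrm (x m \<ominus>\<^bsub>H\<^esub> x n) < e" using assms(2) by blast
    then show "\<exists>N. \<forall>n n'. N \<le> n \<longrightarrow> N \<le> n' \<longrightarrow> ndist H nrm (x n) (x n') < e"
      using assms(1) by (auto simp: ndist_def)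
  qed
  then show ?thesis
    using complete that unfolding metric.mcomplete_def htop_def by blast
qed

text \<open>The family \<open>v\<close> may repeat vectors. \<open>M.lincomb\<close> runs over a
  set, where equal members would merge, so the combination is given here by its inner
  products.\<close>

lemma finite_combination:
  assumes "finite I" "\<And>i. i \<in> I \<Longrightarrow> v i \<in> carrier H"
  obtains x where "x \<in> carrier H"
    "\<And>y. y \<in> carrier H \<Longrightarrow> ip H y x = (\<Sum>i\<in>I. a i * ip H y (v i))"
proof -
  have "\<exists>x\<in>carrier H. \<forall>y\<in>carrier H. ip H y x = (\<Sum>i\<in>I. a i * ip H y (v i))"
    using assms
  proof (induction rule: finite_induct)
    case empty
    then show ?case by (intro bexI[of _ "\<zero>\<^bsub>H\<^esub>"]) auto
  next
    case (insert i I)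
    then obtain x where x: "x \<in> carrier H" "\<forall>y\<in>carrier H. ip H y x = (\<Sum>i\<in>I. a i * ip H y (v i))"
      by auto
    then show ?case
      using insert by (intro bexI[of _ "a i \<odot>\<^bsub>H\<^esub> v i \<oplus>\<^bsub>H\<^esub> x"]) auto
  qed
  then show ?thesis using that by blast
qed

end

section \<open>Orthonormal systems\<close>

context hilbert
begin

lemma lincomb_in_carrier [simp]: "A \<subseteq> carrier H \<Longrightarrow> M.lincomb a A \<in> carrier H"
  by (rule M.lincomb_closed) auto

lemma ip_lincomb:
  assumes "finite A" "A \<subseteq> carrier H" "y \<in> carrier H"
  shows "ip H y (M.lincomb a A) = (\<Sum>e\<in>A. a e * ip H y e)"
  using assms
proof (induction rule: finite_induct)
  case empty
  then show ?case by (simp add: M.lincomb_def)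
next
  case (insert e A)
  then have "M.lincomb a (insert e A) = a e \<odot>\<^bsub>H\<^esub> e \<oplus>\<^bsub>H\<^esub> M.lincomb a A"
    unfolding M.lincomb_def by (subst M.finsum_insert) auto
  then show ?case using insert by simp
qed

lemma ip_lincomb_left:
  assumes "finite A" "A \<subseteq> carrier H" "y \<in> carrier H"
  shows "ip H (M.lincomb a A) y = (\<Sum>e\<in>A. cnj (a e) * ip H e y)"
proof -
  have "ip H (M.lincomb a A) y = cnj (ip H y (M.lincomb a A))"
    using assms by (simp add: cnj_ip)
  also have "\<dots> = (\<Sum>e\<in>A. cnj (a e) * ip H e y)"
    using assms by (auto simp: ip_lincomb cnj_ip intro!: sum.cong)
  finally show ?thesis .
qed

definition orthonormal :: "'h set \<Rightarrow> bool" where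
  "orthonormal S \<longleftrightarrow> S \<subseteq> carrier H \<and> (\<forall>e\<in>S. \<forall>f\<in>S. ip H e f = (if e = f then 1 else 0))"

lemma orthonormal_carrier: "orthonormal S \<Longrightarrow> e \<in> S \<Longrightarrow> e \<in> carrier H"
  by (auto simp: orthonormal_def)

lemma ip_orthonormal_lincomb:
  assumes "orthonormal S" "finite F" "F \<subseteq> S" "e \<in> S"
  shows "ip H e (M.lincomb a F) = (if e \<in> F then a e else 0)"
proof -
  have "ip H e (M.lincomb a F) = (\<Sum>f\<in>F. a f * ip H e f)"
    using assms by (intro ip_lincomb) (auto simp: orthonormal_def)
  also have "\<dots> = (\<Sum>f\<in>F. if f = e then a e else 0)"
    using assms by (intro sum.cong) (auto simp: orthonormal_def subset_eq)
  finally show ?thesis using assms by simp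
qed

lemma ip_lincomb_lincomb:
  assumes "orthonormal S" "finite F" "F \<subseteq> S" "finite G" "G \<subseteq> S"
  shows "ip H (M.lincomb a F) (M.lincomb a G) = of_real (\<Sum>e\<in>F \<inter> G. (cmod (a e))\<^sup>2)"
proof -
  have "F \<subseteq> carrier H" "G \<subseteq> carrier H" using assms by (auto simp: orthonormal_def)
  then have "ip H (M.lincomb a F) (M.lincomb a G)
      = (\<Sum>e\<in>F. cnj (a e) * ip H e (M.lincomb a G))"
    using assms by (intro ip_lincomb_left) auto
  also have "\<dots> = (\<Sum>e\<in>F. if e \<in> G then of_real ((cmod (a e))\<^sup>2) else 0)"
    using assms by (intro sum.cong) (auto simp: ip_orthonormal_lincomb cnj_mult_self subset_eq)
  finally show ?thesis using assms by (auto simp: sum.inter_restrict intro!: sum.cong)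
qed

text \<open>With s the sum of squared coefficients, the squared norm is 2 s(F \<union> G) - s(F) -
  s(G). Each set is thus charged only its own deficit from \<open>A\<close>, which makes nearly
  exhausting sequences of sets Cauchy.\<close>

lemma nrm_lincomb_diff:
  assumes "orthonormal S" "finite F" "F \<subseteq> S" "finite G" "G \<subseteq> S"
    and bound: "(\<Sum>e\<in>F \<union> G. (cmod (a e))\<^sup>2) \<le> A"
  shows "(nrm (M.lincomb a F \<ominus>\<^bsub>H\<^esub> M.lincomb a G))\<^sup>2
      \<le> (A - (\<Sum>e\<in>F. (cmod (a e))\<^sup>2)) + (A - (\<Sum>e\<in>G. (cmod (a e))\<^sup>2))"
proof -
  have "F \<subseteq> carrier H" "G \<subseteq> carrier H" using assms by (auto simp: orthonormal_def)
  then have "(nrm (M.lincomb a F \<ominus>\<^bsub>H\<^esub> M.lincomb a G))\<^sup>2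
      = (\<Sum>e\<in>F. (cmod (a e))\<^sup>2) + (\<Sum>e\<in>G. (cmod (a e))\<^sup>2) - 2 * (\<Sum>e\<in>F \<inter> G. (cmod (a e))\<^sup>2)"
    using assms by (simp add: nrm_diff_sq ip_lincomb_lincomb nrm_sq Int_commute
        del: of_real_sum of_real_power)
  moreover have "(\<Sum>e\<in>F. (cmod (a e))\<^sup>2) + (\<Sum>e\<in>G. (cmod (a e))\<^sup>2)
      = (\<Sum>e\<in>F \<union> G. (cmod (a e))\<^sup>2) + (\<Sum>e\<in>F \<inter> G. (cmod (a e))\<^sup>2)"
    using assms by (simp add: sum.union_inter)
  ultimately show ?thesis using bound by linarith
qed

text \<open>\<open>S\<close> may be uncountable, so the vector is a limit along finite sets
  \<open>F n\<close> whose sums miss the total by less than 1/(n+1). The unordered expansion is then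
  recovered weakly, against each \<open>y\<close>.\<close>

lemma Riesz_Fischer:
  assumes S: "orthonormal S" and a: "(\<lambda>e. (cmod (a e))\<^sup>2) summable_on S"
  obtains x where "x \<in> carrier H"
    "\<And>y. y \<in> carrier H \<Longrightarrow> ((\<lambda>e. a e * ip H y e) has_sum ip H y x) S"
    "\<And>e. e \<in> S \<Longrightarrow> ip H e x = a e"
proof -
  define A where "A = (\<Sum>\<^sub>\<infinity>e\<in>S. (cmod (a e))\<^sup>2)"
  define s where "s F = (\<Sum>e\<in>F. (cmod (a e))\<^sup>2)" for F
  have SC: "S \<subseteq> carrier H" using S by (simp add: orthonormal_def)
  have le: "s F \<le> A" if "finite F" "F \<subseteq> S" for F
    unfolding A_def s_def using that a by (intro finite_sum_le_infsum) auto
  have close: "\<exists>F. finite F \<and> F \<subseteq> S \<and> A - s F < r" if "0 < r" for r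
  proof -
    have "((\<lambda>e. (cmod (a e))\<^sup>2) has_sum A) S" using a by (simp add: A_def)
    then have "\<forall>\<^sub>F F in finite_subsets_at_top S. dist (s F) A < r"
      using that by (auto simp: has_sum_def tendsto_iff s_def)
    then obtain F where "finite F" "F \<subseteq> S" "dist (s F) A < r"
      by (auto simp: eventually_finite_subsets_at_top)
    then show ?thesis by (intro exI[of _ F]) (auto simp: dist_real_def)
  qed
  then have "\<forall>n. \<exists>F. finite F \<and> F \<subseteq> S \<and> A - s F < inverse (real (Suc n))"
    by simp
  then obtain F where F: "\<And>n. finite (F n)" "\<And>n. F n \<subseteq> S"
      "\<And>n. A - s (F n) < inverse (real (Suc n))"
    by metis
  define u where "u n = M.lincomb a (F n)" for n
  have u: "u n \<in> carrier H" for n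
    unfolding u_def using F SC by (intro lincomb_in_carrier) blast
  have diff: "(nrm (M.lincomb a G \<ominus>\<^bsub>H\<^esub> u n))\<^sup>2 \<le> (A - s G) + inverse (real (Suc n))"
    if "finite G" "G \<subseteq> S" for G n
  proof -
    have "(nrm (M.lincomb a G \<ominus>\<^bsub>H\<^esub> u n))\<^sup>2 \<le> (A - s G) + (A - s (F n))"
      unfolding u_def s_def using that F S le[of "G \<union> F n"]
      by (intro nrm_lincomb_diff) (auto simp: s_def)
    then show ?thesis using F(3)[of n] by linarith
  qed
  obtain x where x: "limitin (vtop H) u x sequentially"
  proof (rule Cauchy_convergent[OF u])
    fix r :: real assume "0 < r"
    then obtain N where N: "inverse (real (Suc N)) < r\<^sup>2 / 2"
      using reals_Archimedean[of "r\<^sup>2 / 2"] by auto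
    have "nrm (u m \<ominus>\<^bsub>H\<^esub> u n) < r" if "N \<le> m" "N \<le> n" for m n
    proof -
      have "inverse (real (Suc m)) \<le> inverse (real (Suc N))"
          "inverse (real (Suc n)) \<le> inverse (real (Suc N))"
        using that by (simp_all add: inverse_le_iff_le)
      moreover have "(nrm (u m \<ominus>\<^bsub>H\<^esub> u n))\<^sup>2 \<le> (A - s (F m)) + inverse (real (Suc n))"
        using diff[OF F(1,2), of m n] by (simp only: u_def)
      ultimately have "(nrm (u m \<ominus>\<^bsub>H\<^esub> u n))\<^sup>2 < r\<^sup>2"
        using F(3)[of m] N by linarith
      then show ?thesis by (rule power2_less_imp_less) (use \<open>0 < r\<close> in simp)
    qed
    then show "\<exists>N. \<forall>m\<ge>N. \<forall>n\<ge>N. nrm (u m \<ominus>\<^bsub>H\<^esub> u n) < r" by blast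
  qed
  have xC: "x \<in> carrier H" using x by (simp add: limitin_iff)
  \<comment> \<open>Letting \<open>n\<close> tend to infinity in Cauchy-Schwarz leaves a rate that
    sees \<open>G\<close> only through its deficit, so it also serves all finite supersets of a good
    set.\<close>
  have approx: "cmod (ip H y (M.lincomb a G) - ip H y x) \<le> nrm y * sqrt (A - s G)"
    if y: "y \<in> carrier H" and G: "finite G" "G \<subseteq> S" for y G
  proof (rule LIMSEQ_le)
    have GC: "M.lincomb a G \<in> carrier H" using G SC by (intro lincomb_in_carrier) auto
    show "(\<lambda>n. cmod (ip H y (M.lincomb a G) - ip H y (u n)))
        \<longlonglongrightarrow> cmod (ip H y (M.lincomb a G) - ip H y x)"
      by (intro tendsto_norm tendsto_diff tendsto_const ip_tendsto x y)
    show "(\<lambda>n. nrm y * sqrt ((A - s G) + inverse (real (Suc n)))) \<longlonglongrightarrow> nrm y * sqrt (A - s G)"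
      using tendsto_mult_left[OF tendsto_real_sqrt[OF tendsto_add[OF tendsto_const
            LIMSEQ_inverse_real_of_nat]], of "nrm y" "A - s G"] by (simp only: add_0_right)
    have "cmod (ip H y (M.lincomb a G) - ip H y (u n))
        \<le> nrm y * sqrt ((A - s G) + inverse (real (Suc n)))" for n
    proof -
      have "cmod (ip H y (M.lincomb a G \<ominus>\<^bsub>H\<^esub> u n)) \<le> nrm y * nrm (M.lincomb a G \<ominus>\<^bsub>H\<^esub> u n)"
        using y u GC by (intro Cauchy_Schwarz) auto
      also have "\<dots> \<le> nrm y * sqrt ((A - s G) + inverse (real (Suc n)))"
        using diff[OF G, of n] by (intro mult_left_mono real_le_rsqrt) auto
      finally show ?thesis using y u GC by simp
    qed
    then show "\<exists>N. \<forall>n\<ge>N. cmod (ip H y (M.lincomb a G) - ip H y (u n))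
        \<le> nrm y * sqrt ((A - s G) + inverse (real (Suc n)))" by blast
  qed
  have sum: "((\<lambda>e. a e * ip H y e) has_sum ip H y x) S" if y: "y \<in> carrier H" for y
    unfolding has_sum_def tendsto_iff
  proof (intro allI impI)
    fix r :: real assume r: "0 < r"
    define d where "d = r / (1 + nrm y)"
    have d: "0 < d" "nrm y * d < r"
      using r nrm_nonneg[of y] by (auto simp: d_def field_simps simp del: nrm_nonneg intro: add_pos_nonneg)
    obtain G where G: "finite G" "G \<subseteq> S" "A - s G < d\<^sup>2" using close[of "d\<^sup>2"] d by auto
    have "dist (\<Sum>e\<in>F. a e * ip H y e) (ip H y x) < r"
      if F: "finite F" "G \<subseteq> F" "F \<subseteq> S" for F
    proof -
      have "s G \<le> s F" unfolding s_def using F by (intro sum_mono2) auto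
      then have "sqrt (A - s F) \<le> d"
        using G d by (intro real_le_lsqrt) auto
      then have "nrm y * sqrt (A - s F) < r"
        using mult_left_mono[of "sqrt (A - s F)" d "nrm y"] d(2) nrm_nonneg[of y] by linarith
      moreover have "ip H y (M.lincomb a F) = (\<Sum>e\<in>F. a e * ip H y e)"
        using F SC y by (intro ip_lincomb) auto
      ultimately show ?thesis using approx[OF y, of F] F by (simp add: dist_norm)
    qed
    then show "\<forall>\<^sub>F F in finite_subsets_at_top S. dist (\<Sum>e\<in>F. a e * ip H y e) (ip H y x) < r"
      using G unfolding eventually_finite_subsets_at_top by blast
  qed
  have "ip H e x = a e" if e: "e \<in> S" for e
  proof -
    have "((\<lambda>f. a f * ip H e f) has_sum a e) {e}"
      using S e by (simp add: has_sum_finite_iff orthonormal_def)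
    then have "((\<lambda>f. a f * ip H e f) has_sum a e) S"
      by (rule has_sum_cong_neutral[THEN iffD1, rotated -1])
        (use S e in \<open>auto simp: orthonormal_def\<close>)
    then show ?thesis using sum[of e] e SC has_sum_unique by blast
  qed
  then show ?thesis using that xC sum by blast
qed

lemma Bessel:
  assumes S: "orthonormal S" and x: "x \<in> carrier H"
  shows "(\<lambda>e. (cmod (ip H e x))\<^sup>2) summable_on S"
proof (rule nonneg_bdd_above_summable_on)
  have "(\<Sum>e\<in>F. (cmod (ip H e x))\<^sup>2) \<le> (nrm x)\<^sup>2" if F: "finite F" "F \<subseteq> S" for F
  proof -
    define a where "a e = ip H e x" for e
    have FC: "F \<subseteq> carrier H" using S F by (auto simp: orthonormal_def)
    have "ip H (M.lincomb a F) x = (\<Sum>e\<in>F. cnj (a e) * ip H e x)"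
      using F FC x by (intro ip_lincomb_left) auto
    also have "\<dots> = of_real (\<Sum>e\<in>F. (cmod (ip H e x))\<^sup>2)"
      by (simp add: a_def cnj_mult_self)
    finally have "Re (ip H (M.lincomb a F) x) = (\<Sum>e\<in>F. (cmod (ip H e x))\<^sup>2)" by simp
    moreover have "(nrm (M.lincomb a F))\<^sup>2 = (\<Sum>e\<in>F. (cmod (ip H e x))\<^sup>2)"
      using S F FC by (simp add: nrm_sq ip_lincomb_lincomb a_def del: of_real_sum of_real_power)
    moreover have "0 \<le> (nrm (M.lincomb a F \<ominus>\<^bsub>H\<^esub> x))\<^sup>2" by simp
    ultimately show ?thesis using FC x by (simp add: nrm_diff_sq)
  qed
  then show "bdd_above (sum (\<lambda>e. (cmod (ip H e x))\<^sup>2) ` {F. F \<subseteq> S \<and> finite F})"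
    by (intro bdd_aboveI2) auto
qed simp

definition is_total :: "'h set \<Rightarrow> bool" where
  "is_total S \<longleftrightarrow> (\<forall>x\<in>carrier H. (\<forall>e\<in>S. ip H e x = 0) \<longrightarrow> x = \<zero>\<^bsub>H\<^esub>)"

lemma total_eqI:
  assumes "orthonormal S" "is_total S" "x \<in> carrier H" "y \<in> carrier H"
    and "\<And>e. e \<in> S \<Longrightarrow> ip H e x = ip H e y"
  shows "x = y"
proof -
  have "ip H e (x \<ominus>\<^bsub>H\<^esub> y) = 0" if "e \<in> S" for e
    using ip_diff_right[OF orthonormal_carrier[OF assms(1) that] assms(3,4)] assms(5)[OF that]
    by simp
  moreover have "x \<ominus>\<^bsub>H\<^esub> y \<in> carrier H" using assms(3,4) by (rule closed)
  ultimately have "x \<ominus>\<^bsub>H\<^esub> y = \<zero>\<^bsub>H\<^esub>"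
    using assms(2) unfolding is_total_def by blast
  then show ?thesis using diff_eq_0_iff[OF assms(3,4)] by blast
qed

text \<open>The vector rebuilt by \<open>Riesz_Fischer\<close> from the coefficients of
  \<open>x\<close> has those same coefficients, and totality identifies the two.\<close>

lemma Parseval:
  assumes S: "orthonormal S" "is_total S" and x: "x \<in> carrier H" and y: "y \<in> carrier H"
  shows "((\<lambda>e. ip H e x * ip H y e) has_sum ip H y x) S"
proof -
  obtain x' where x': "x' \<in> carrier H"
    "\<And>y. y \<in> carrier H \<Longrightarrow> ((\<lambda>e. ip H e x * ip H y e) has_sum ip H y x') S"
    "\<And>e. e \<in> S \<Longrightarrow> ip H e x' = ip H e x"
    by (rule Riesz_Fischer[OF S(1) Bessel[OF S(1) x]]) blast
  then have "x' = x" using S x by (intro total_eqI[of S]) auto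
  then show ?thesis using x' y by auto
qed

lemma Parseval_nrm:
  assumes S: "orthonormal S" "is_total S" and x: "x \<in> carrier H"
  shows "((\<lambda>e. (cmod (ip H e x))\<^sup>2) has_sum (nrm x)\<^sup>2) S"
proof -
  have "((\<lambda>e. complex_of_real ((cmod (ip H e x))\<^sup>2)) has_sum of_real ((nrm x)\<^sup>2)) S"
  proof (rule has_sum_cong[THEN iffD1])
    show "((\<lambda>e. ip H e x * ip H x e) has_sum of_real ((nrm x)\<^sup>2)) S"
      using Parseval[OF S x x] x by (simp add: ip_self)
    show "ip H e x * ip H x e = complex_of_real ((cmod (ip H e x))\<^sup>2)" if "e \<in> S" for e
      using S x that cnj_ip[of e x] by (simp add: orthonormal_carrier cnj_mult_self flip: cnj_ip[of e x])
  qed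
  then show ?thesis by (simp only: has_sum_of_real_iff)
qed

end

section \<open>The eigenbasis of a self-adjoint operator with compact resolvent\<close>

context hilbert
begin

lemma Cauchy_convergent_sq:
  assumes "\<And>n. x n \<in> carrier H"
    and "\<And>m n. (nrm (x m \<ominus>\<^bsub>H\<^esub> x n))\<^sup>2 \<le> b m + b n" and "b \<longlonglongrightarrow> 0"
  obtains l where "limitin (vtop H) x l sequentially"
proof (rule Cauchy_convergent[OF assms(1)])
  fix e :: real assume e: "0 < e"
  then have "\<forall>\<^sub>F n in sequentially. b n < e\<^sup>2 / 2"
    using assms(3) by (intro order_tendstoD) auto
  then obtain N where N: "\<And>n. N \<le> n \<Longrightarrow> b n < e\<^sup>2 / 2"
    by (auto simp: eventually_sequentially)
  have "nrm (x m \<ominus>\<^bsub>H\<^esub> x n) < e" if "N \<le> m" "N \<le> n" for m n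
  proof (rule power2_less_imp_less)
    show "(nrm (x m \<ominus>\<^bsub>H\<^esub> x n))\<^sup>2 < e\<^sup>2"
      using assms(2)[of m n] N[OF that(1)] N[OF that(2)] by linarith
  qed (use e in simp)
  then show "\<exists>N. \<forall>m\<ge>N. \<forall>n\<ge>N. nrm (x m \<ominus>\<^bsub>H\<^esub> x n) < e" by blast
qed

lemma parallelogram:
  "\<lbrakk>x \<in> carrier H; y \<in> carrier H\<rbrakk> \<Longrightarrow>
    (nrm (x \<oplus>\<^bsub>H\<^esub> y))\<^sup>2 + (nrm (x \<ominus>\<^bsub>H\<^esub> y))\<^sup>2 = 2 * (nrm x)\<^sup>2 + 2 * (nrm y)\<^sup>2"
  by (simp add: nrm_add_sq nrm_diff_sq)

end

text \<open>Move against the gradient, \<open>c = - t * cnj p\<close>, with \<open>t\<close> so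
  small that the linear part outweighs the quadratic one. This extracts the first variation at a
  minimiser.\<close>

lemma quadratic_nonneg_imp_zero:
  fixes p :: complex and q :: real
  assumes "\<And>c. 0 \<le> 2 * Re (c * p) + (cmod c)\<^sup>2 * q"
  shows "p = 0"
proof -
  define t where "t = 1 / (\<bar>q\<bar> + 1)"
  have t: "0 < t" "t * q < 1"
    unfolding t_def by (auto simp: field_simps intro: add_nonneg_pos)
  have "(cnj p * p) = of_real ((cmod p)\<^sup>2)" by (simp add: cnj_mult_self)
  then have "Re (- of_real t * cnj p * p) = - t * (cmod p)\<^sup>2"
    by (simp add: mult.assoc)
  moreover have "(cmod (- of_real t * cnj p))\<^sup>2 = t\<^sup>2 * (cmod p)\<^sup>2"
    using t by (simp add: norm_mult power_mult_distrib)
  ultimately have "0 \<le> 2 * (- t * (cmod p)\<^sup>2) + t\<^sup>2 * (cmod p)\<^sup>2 * q"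
    using assms[of "- of_real t * cnj p"] by metis
  also have "\<dots> = t * (cmod p)\<^sup>2 * (t * q - 2)" by (simp add: algebra_simps power2_eq_square)
  finally have "0 \<le> t * (cmod p)\<^sup>2 * (t * q - 2)" .
  then have "t * (cmod p)\<^sup>2 \<le> 0"
    using t by (simp add: zero_le_mult_iff)
  then show ?thesis using t by (simp add: mult_le_0_iff)
qed

section \<open>Domain, graph and compactness of the operator\<close>

locale spectral_op = hilbert H for H :: "'h hilbert" +
  fixes X :: "'h set" and D :: "'h \<Rightarrow> 'h"
  assumes self_adjoint: "self_adjoint H X D" and compact_resolvent: "compact_resolvent H X D"
begin

lemma dom_carrier [simp]: "x \<in> X \<Longrightarrow> x \<in> carrier H"
  using self_adjoint by (auto simp: self_adjoint_def densely_defined_def dest: submodule.subset)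

lemma dom_closed [simp]:
  "\<zero>\<^bsub>H\<^esub> \<in> X" "\<lbrakk>x \<in> X; y \<in> X\<rbrakk> \<Longrightarrow> x \<oplus>\<^bsub>H\<^esub> y \<in> X" "x \<in> X \<Longrightarrow> c \<odot>\<^bsub>H\<^esub> x \<in> X"
  using self_adjoint
  by (auto simp: self_adjoint_def densely_defined_def
      intro: submodule.zero_closed submodule.m_closed submodule.smult_closed)

lemma op_closed [simp]: "x \<in> X \<Longrightarrow> D x \<in> carrier H"
  using self_adjoint by (auto simp: self_adjoint_def densely_defined_def)

lemma op_add [simp]: "\<lbrakk>x \<in> X; y \<in> X\<rbrakk> \<Longrightarrow> D (x \<oplus>\<^bsub>H\<^esub> y) = D x \<oplus>\<^bsub>H\<^esub> D y"
  and op_smult [simp]: "x \<in> X \<Longrightarrow> D (c \<odot>\<^bsub>H\<^esub> x) = c \<odot>\<^bsub>H\<^esub> D x"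
  using self_adjoint by (auto simp: self_adjoint_def densely_defined_def)

lemma op_zero [simp]: "D \<zero>\<^bsub>H\<^esub> = \<zero>\<^bsub>H\<^esub>"
proof -
  have "0 \<odot>\<^bsub>H\<^esub> x = \<zero>\<^bsub>H\<^esub>" if "x \<in> carrier H" for x
    by (rule ip_eqI) (use that in simp_all)
  then show ?thesis using op_smult[of "\<zero>\<^bsub>H\<^esub>" 0] by simp
qed

lemma diff_eq: "\<lbrakk>x \<in> carrier H; y \<in> carrier H\<rbrakk> \<Longrightarrow> x \<ominus>\<^bsub>H\<^esub> y = x \<oplus>\<^bsub>H\<^esub> (-1) \<odot>\<^bsub>H\<^esub> y"
  by (rule ip_eqI) auto

lemma dom_diff [simp]: "\<lbrakk>x \<in> X; y \<in> X\<rbrakk> \<Longrightarrow> x \<ominus>\<^bsub>H\<^esub> y \<in> X"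
  and op_diff [simp]: "\<lbrakk>x \<in> X; y \<in> X\<rbrakk> \<Longrightarrow> D (x \<ominus>\<^bsub>H\<^esub> y) = D x \<ominus>\<^bsub>H\<^esub> D y"
  by (simp_all add: diff_eq)

lemma op_symmetric:
  assumes "x \<in> X" "y \<in> X"
  shows "ip H (D x) y = ip H x (D y)"
proof -
  have "(y, D y) \<in> adjoint_graph H X D"
    using self_adjoint assms by (auto simp: self_adjoint_def)
  then show ?thesis using assms by (auto simp: adjoint_graph_def)
qed

text \<open>Here self-adjointness is more than symmetry: a weak solution of \<open>D y = z\<close>
  already lies in the domain.\<close>

lemma adjointI:
  assumes "y \<in> carrier H" "z \<in> carrier H" "\<And>x. x \<in> X \<Longrightarrow> ip H (D x) y = ip H x z"
  shows "y \<in> X" "D y = z"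
proof -
  have "(y, z) \<in> adjoint_graph H X D"
    using assms by (simp add: adjoint_graph_def)
  then have "(y, z) \<in> (\<lambda>\<xi>. (\<xi>, D \<xi>)) ` X"
    using self_adjoint by (simp add: self_adjoint_def)
  then show "y \<in> X" "D y = z" by auto
qed

lemma op_graph_closed:
  assumes "\<And>n. x n \<in> X" "limitin (vtop H) x l sequentially"
    "limitin (vtop H) (\<lambda>n. D (x n)) k sequentially"
  shows "l \<in> X" "D l = k"
proof -
  have lk: "l \<in> carrier H" "k \<in> carrier H" using assms by (auto simp: limitin_iff)
  have "ip H (D y) l = ip H y k" if y: "y \<in> X" for y
  proof (rule LIMSEQ_unique)
    show "(\<lambda>n. ip H (D y) (x n)) \<longlonglongrightarrow> ip H (D y) l" using y assms by (intro ip_tendsto) auto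
    have "(\<lambda>n. ip H y (D (x n))) \<longlonglongrightarrow> ip H y k" using y assms by (intro ip_tendsto) auto
    then show "(\<lambda>n. ip H (D y) (x n)) \<longlonglongrightarrow> ip H y k" using y assms(1) by (simp add: op_symmetric)
  qed
  then show "l \<in> X" "D l = k" using adjointI lk by blast+
qed

text \<open>\<open>x n\<close> is the resolvent applied to (D - z) x n, which stays bounded. A
  compact resolvent thus makes balls of the graph norm relatively compact.\<close>

lemma op_bounded_convergent_subseq:
  assumes x: "\<And>n. x n \<in> X" and "\<And>n. nrm (x n) \<le> C" "\<And>n. nrm (D (x n)) \<le> C"
  obtains l r where "strict_mono (r :: nat \<Rightarrow> nat)" "limitin (vtop H) (x \<circ> r) l sequentially"
proof -
  obtain z where z: "z \<in> resolvent_set H X D" "compact_operator H (resolvent H X D z)"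
    using compact_resolvent by (auto simp: compact_resolvent_def)
  define f where "f = (\<lambda>\<xi>. D \<xi> \<ominus>\<^bsub>H\<^esub> z \<odot>\<^bsub>H\<^esub> \<xi>)"
  define K where "K = inv_into X f"
  define B where "B = {\<xi> \<in> carrier H. nrm \<xi> \<le> 1}"
  have bij: "bij_betw f X (carrier H)" using z by (simp add: resolvent_set_def f_def)
  have K: "compactin (vtop H) (vtop H closure_of (K ` B))"
    using z by (simp add: compact_operator_def resolvent_def K_def f_def B_def)
  have KX: "K y \<in> X" if "y \<in> carrier H" for y
    using bij that by (metis K_def bij_betw_def inv_into_into)
  have Kf: "K (f y) = y" if "y \<in> X" for y
    using bij that by (simp add: K_def bij_betw_def)
  \<comment> \<open>A bound for the norm of (D - z) x n, increased by 1 to stay positive when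
    \<open>C = 0\<close>. Dividing by it lands in the unit ball, where compactness of the resolvent
    is stated.\<close>
  define c where "c = C * (1 + cmod z) + 1"
  have C: "0 \<le> C" using assms(2)[of 0] nrm_nonneg order_trans by blast
  then have c: "0 < c" by (auto simp: c_def intro: add_nonneg_pos)
  define y where "y n = complex_of_real (1 / c) \<odot>\<^bsub>H\<^esub> x n" for n
  have y: "y n \<in> X" for n using x by (simp add: y_def)
  have "nrm (f (y n)) \<le> 1" for n
  proof -
    have "f (y n) = complex_of_real (1 / c) \<odot>\<^bsub>H\<^esub> f (x n)"
      by (rule ip_eqI) (use x[of n] in \<open>simp_all add: f_def y_def algebra_simps\<close>)
    moreover have "f (x n) \<in> carrier H" using x by (simp add: f_def)
    ultimately have "nrm (f (y n)) = nrm (f (x n)) / c" using c by (simp add: norm_divide)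
    also have "nrm (f (x n)) \<le> nrm (D (x n)) + cmod z * nrm (x n)"
      using x[of n] nrm_triangle[of "D (x n)" "(- z) \<odot>\<^bsub>H\<^esub> x n"]
      by (simp add: f_def diff_eq) (metis (no_types, lifting) M.smult_assoc1 complex_cstar_simps(1,2) UNIV_I dom_carrier mult_minus1)
    also have "\<dots> \<le> C + cmod z * C" using assms(2,3) by (intro add_mono mult_left_mono) auto
    also have "\<dots> \<le> c" by (simp add: c_def algebra_simps)
    finally show ?thesis using c by (simp add: divide_right_mono)
  qed
  then have "f (y n) \<in> B" for n using y by (simp add: B_def f_def)
  then have "y n \<in> K ` B" for n using Kf[OF y] by (metis imageI)
  moreover have "K ` B \<subseteq> topspace (vtop H)" using KX by (auto simp: B_def htop_def)
  ultimately have "range y \<subseteq> vtop H closure_of (K ` B)"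
    using closure_of_subset by blast
  then obtain l r where lr: "strict_mono (r :: nat \<Rightarrow> nat)" "limitin (vtop H) (y \<circ> r) l sequentially"
    using K unfolding htop_def metric.compactin_sequentially by blast
  have "limitin (vtop H) (x \<circ> r) (of_real c \<odot>\<^bsub>H\<^esub> l) sequentially"
  proof -
    have l: "l \<in> carrier H" using lr by (simp add: limitin_iff)
    have "nrm (x (r n) \<ominus>\<^bsub>H\<^esub> of_real c \<odot>\<^bsub>H\<^esub> l) = c * nrm (y (r n) \<ominus>\<^bsub>H\<^esub> l)" for n
    proof -
      have "x (r n) \<ominus>\<^bsub>H\<^esub> of_real c \<odot>\<^bsub>H\<^esub> l = of_real c \<odot>\<^bsub>H\<^esub> (y (r n) \<ominus>\<^bsub>H\<^esub> l)"
        by (rule ip_eqI) (use x[of "r n"] l c in \<open>simp_all add: y_def algebra_simps\<close>)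
      then show ?thesis using c l y by simp
    qed
    moreover have "(\<lambda>n. c * nrm (y (r n) \<ominus>\<^bsub>H\<^esub> l)) \<longlonglongrightarrow> 0"
      using lr by (intro tendsto_mult_right_zero) (simp add: limitin_iff)
    ultimately show ?thesis using x l by (simp add: limitin_iff)
  qed
  then show ?thesis using that lr by blast
qed

section \<open>Variational construction of eigenvectors\<close>

definition eigvecs :: "'h set" where
  "eigvecs = {e \<in> X. nrm e = 1 \<and> (\<exists>r::real. D e = of_real r \<odot>\<^bsub>H\<^esub> e)}"

text \<open>The Rayleigh quotient: on \<open>eigvecs\<close> it is the eigenvalue, and it avoids
  choosing a witness.\<close>

definition lam :: "'h \<Rightarrow> real" where "lam e = Re (ip H e (D e))"

lemma op_eigvec: "e \<in> eigvecs \<Longrightarrow> D e = of_real (lam e) \<odot>\<^bsub>H\<^esub> e"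
  by (auto simp: eigvecs_def lam_def ip_self)

lemma ip_eigvec_op:
  assumes "e \<in> eigvecs" "x \<in> X"
  shows "ip H e (D x) = lam e * ip H e x"
proof -
  have e: "e \<in> X" using assms by (simp add: eigvecs_def)
  have "ip H e (D x) = ip H (D e) x" using e assms by (simp add: op_symmetric)
  then show ?thesis using e assms by (simp add: op_eigvec)
qed

lemma normalized_eigvec:
  assumes "x \<in> X" "x \<noteq> \<zero>\<^bsub>H\<^esub>" "D x = of_real r \<odot>\<^bsub>H\<^esub> x"
  shows "of_real (1 / nrm x) \<odot>\<^bsub>H\<^esub> x \<in> eigvecs"
proof -
  have "nrm x \<noteq> 0" using assms by simp
  then have "nrm x > 0" using nrm_nonneg[of x] by linarith
  moreover have "of_real (1 / nrm x) \<odot>\<^bsub>H\<^esub> (of_real r \<odot>\<^bsub>H\<^esub> x)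
      = of_real r \<odot>\<^bsub>H\<^esub> (of_real (1 / nrm x) \<odot>\<^bsub>H\<^esub> x)"
    by (rule ip_eqI) (use assms in \<open>simp_all del: nrm_eq_0_iff\<close>)
  ultimately show ?thesis
    using assms by (auto simp: eigvecs_def norm_divide intro!: exI[of _ r])
qed

text \<open>Compactness yields a minimiser \<open>l\<close> of the norm of \<open>D x\<close> among
  unit vectors of the domain orthogonal to \<open>S\<close>. With \<open>m\<close> the minimum, the
  Euler-Lagrange equation is D^2 l = m^2 l, and factoring D^2 - m^2 turns \<open>l\<close> into an
  eigenvector.\<close>

lemma op_min_eigvec:
  assumes S: "orthonormal S" "S \<subseteq> eigvecs"
    and w: "w \<in> X" "nrm w = 1" "\<And>e. e \<in> S \<Longrightarrow> ip H e w = 0"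
  obtains u where "u \<in> eigvecs" "\<And>e. e \<in> S \<Longrightarrow> ip H e u = 0"
proof -
  define W where "W = {x \<in> X. \<forall>e\<in>S. ip H e x = 0}"
  define V where "V = (\<lambda>x. nrm (D x)) ` {x \<in> W. nrm x = 1}"
  define m where "m = Inf V"
  have SX: "e \<in> X" if "e \<in> S" for e using S that by (auto simp: eigvecs_def)
  have WX: "x \<in> X" if "x \<in> W" for x using that by (simp add: W_def)
  have Wadd: "x \<oplus>\<^bsub>H\<^esub> y \<in> W" if "x \<in> W" "y \<in> W" for x y
    using that SX by (simp add: W_def)
  have Wsmult: "c \<odot>\<^bsub>H\<^esub> x \<in> W" if "x \<in> W" for x c
    using that SX by (simp add: W_def)
  have V: "V \<noteq> {}" "bdd_below V" using w by (auto simp: V_def W_def intro: bdd_belowI[of _ 0])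
  have m0: "0 \<le> m" unfolding m_def using V(1) by (intro cInf_greatest) (auto simp: V_def)
  have lower: "m * nrm x \<le> nrm (D x)" if x: "x \<in> W" for x
  proof (cases "nrm x = 0")
    case False
    then have pos: "0 < nrm x" using nrm_nonneg[of x] by linarith
    define y where "y = complex_of_real (1 / nrm x) \<odot>\<^bsub>H\<^esub> x"
    have "y \<in> W" "nrm y = 1"
      using Wsmult[OF x] pos WX[OF x] by (auto simp: y_def norm_divide)
    then have "m \<le> nrm (D y)" unfolding m_def using V by (intro cInf_lower) (auto simp: V_def)
    also have "\<dots> = nrm (D x) / nrm x" using WX[OF x] pos by (simp add: y_def norm_divide)
    finally show ?thesis using pos by (simp add: pos_le_divide_eq)
  qed simp
  have "\<exists>x. x \<in> W \<and> nrm x = 1 \<and> nrm (D x) < m + inverse (real (Suc n))" for n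
  proof -
    have "Inf V < m + inverse (real (Suc n))" by (simp add: m_def)
    then show ?thesis using cInf_lessD[OF V(1)] by (fastforce simp: V_def)
  qed
  then obtain x where x: "\<And>n. x n \<in> W" "\<And>n. nrm (x n) = 1"
      "\<And>n. nrm (D (x n)) < m + inverse (real (Suc n))"
    by metis
  have inv1: "inverse (real (Suc n)) \<le> 1" for n by (simp add: inverse_le_1_iff)
  have "nrm (D (x n)) \<le> m + 1" for n using x(3)[of n] inv1[of n] by linarith
  moreover have "nrm (x n) \<le> m + 1" for n using x(2)[of n] m0 by linarith
  ultimately obtain l r where r: "strict_mono (r :: nat \<Rightarrow> nat)"
      and lim: "limitin (vtop H) (x \<circ> r) l sequentially"
    using op_bounded_convergent_subseq[of x "m + 1"] x(1) WX by metis
  define y where "y n = x (r n)" for n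
  have y: "y n \<in> W" "nrm (y n) = 1" for n using x by (simp_all add: y_def)
  have ylim: "limitin (vtop H) y l sequentially"
    using lim by (simp add: y_def[abs_def] comp_def)
  have lC: "l \<in> carrier H" using ylim by (simp add: limitin_iff)
  define a where "a n = nrm (D (y n))" for n
  have "a \<longlonglongrightarrow> m"
  proof (rule tendsto_sandwich)
    show "\<forall>\<^sub>F n in sequentially. m \<le> a n"
      using lower[OF y(1)] y(2) by (simp add: a_def)
    have "a n \<le> m + inverse (real (Suc n))" for n
    proof -
      have "inverse (real (Suc (r n))) \<le> inverse (real (Suc n))"
        using seq_suble[OF r, of n] by (simp add: inverse_le_iff_le)
      then show ?thesis using x(3)[of "r n"] unfolding a_def y_def by linarith
    qed
    then show "\<forall>\<^sub>F n in sequentially. a n \<le> m + inverse (real (Suc n))" by simp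
    show "(\<lambda>n. m + inverse (real (Suc n))) \<longlonglongrightarrow> m"
      by (rule LIMSEQ_inverse_real_of_nat_add)
  qed simp
  \<comment> \<open>Convergence of \<open>y\<close> says nothing yet about \<open>D (y n)\<close>.
    The parallelogram law, with the lower bound \<open>m\<close> applied to sums, makes these images
    Cauchy. The first term of \<open>b\<close> is the excess over the minimum, the second comes from
    estimating the distance of \<open>y i\<close> and \<open>y j\<close> through
    \<open>l\<close>.\<close>
  define b where "b n = 2 * ((a n)\<^sup>2 - m\<^sup>2) + 2 * m\<^sup>2 * (nrm (y n \<ominus>\<^bsub>H\<^esub> l))\<^sup>2" for n
  have "b \<longlonglongrightarrow> 2 * (m\<^sup>2 - m\<^sup>2) + 2 * m\<^sup>2 * 0\<^sup>2"
    unfolding b_def using ylim \<open>a \<longlonglongrightarrow> m\<close>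
    by (intro tendsto_intros) (simp_all add: limitin_iff)
  then have b: "b \<longlonglongrightarrow> 0" by simp
  have D_diff: "(nrm (D (y i) \<ominus>\<^bsub>H\<^esub> D (y j)))\<^sup>2 \<le> b i + b j" for i j
  proof -
    have C: "y i \<in> X" "y j \<in> X" using y WX by auto
    have "m * nrm (y i \<oplus>\<^bsub>H\<^esub> y j) \<le> nrm (D (y i) \<oplus>\<^bsub>H\<^esub> D (y j))"
      using lower[OF Wadd[OF y(1) y(1)], of i j] C by simp
    then have "(m * nrm (y i \<oplus>\<^bsub>H\<^esub> y j))\<^sup>2 \<le> (nrm (D (y i) \<oplus>\<^bsub>H\<^esub> D (y j)))\<^sup>2"
      using m0 by (intro power_mono) auto
    moreover have "(nrm (y i \<oplus>\<^bsub>H\<^esub> y j))\<^sup>2 = 4 - (nrm (y i \<ominus>\<^bsub>H\<^esub> y j))\<^sup>2"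
      using parallelogram[of "y i" "y j"] C y(2) by simp
    moreover have "(nrm (y i \<ominus>\<^bsub>H\<^esub> y j))\<^sup>2
        \<le> 2 * (nrm (y i \<ominus>\<^bsub>H\<^esub> l))\<^sup>2 + 2 * (nrm (y j \<ominus>\<^bsub>H\<^esub> l))\<^sup>2"
    proof -
      have "(y i \<ominus>\<^bsub>H\<^esub> l) \<ominus>\<^bsub>H\<^esub> (y j \<ominus>\<^bsub>H\<^esub> l) = y i \<ominus>\<^bsub>H\<^esub> y j"
        by (rule ip_eqI) (use C lC in simp_all)
      then have "(nrm ((y i \<ominus>\<^bsub>H\<^esub> l) \<oplus>\<^bsub>H\<^esub> (y j \<ominus>\<^bsub>H\<^esub> l)))\<^sup>2 + (nrm (y i \<ominus>\<^bsub>H\<^esub> y j))\<^sup>2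
          = 2 * (nrm (y i \<ominus>\<^bsub>H\<^esub> l))\<^sup>2 + 2 * (nrm (y j \<ominus>\<^bsub>H\<^esub> l))\<^sup>2"
        using parallelogram[of "y i \<ominus>\<^bsub>H\<^esub> l" "y j \<ominus>\<^bsub>H\<^esub> l"] C lC by simp
      then show ?thesis
        using zero_le_power2[of "nrm ((y i \<ominus>\<^bsub>H\<^esub> l) \<oplus>\<^bsub>H\<^esub> (y j \<ominus>\<^bsub>H\<^esub> l))"] by linarith
    qed
    then have "m\<^sup>2 * (nrm (y i \<ominus>\<^bsub>H\<^esub> y j))\<^sup>2
        \<le> m\<^sup>2 * (2 * (nrm (y i \<ominus>\<^bsub>H\<^esub> l))\<^sup>2 + 2 * (nrm (y j \<ominus>\<^bsub>H\<^esub> l))\<^sup>2)"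
      by (intro mult_left_mono) auto
    moreover have "(nrm (D (y i) \<oplus>\<^bsub>H\<^esub> D (y j)))\<^sup>2 + (nrm (D (y i) \<ominus>\<^bsub>H\<^esub> D (y j)))\<^sup>2
        = 2 * (a i)\<^sup>2 + 2 * (a j)\<^sup>2"
      unfolding a_def using C by (intro parallelogram) auto
    ultimately show ?thesis
      unfolding b_def by (simp add: power_mult_distrib algebra_simps)
  qed
  obtain k where k: "limitin (vtop H) (\<lambda>n. D (y n)) k sequentially"
    by (rule Cauchy_convergent_sq[OF _ D_diff b]) (use y WX in auto)
  have l: "l \<in> X" "D l = k" using op_graph_closed[OF _ ylim k] y WX by auto
  have nl: "nrm l = 1"
    using nrm_tendsto[OF ylim] y(2) by (simp add: LIMSEQ_const_iff)
  have "nrm k = m"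
    using nrm_tendsto[OF k] \<open>a \<longlonglongrightarrow> m\<close> unfolding a_def[abs_def] by (rule LIMSEQ_unique)
  then have nDl: "nrm (D l) = m" using l by simp
  have lS: "ip H e l = 0" if "e \<in> S" for e
  proof -
    have "(\<lambda>n. ip H e (y n)) \<longlonglongrightarrow> ip H e l" using that SX ylim by (intro ip_tendsto) auto
    then show ?thesis using y(1) that by (simp add: W_def LIMSEQ_const_iff)
  qed
  then have lW: "l \<in> W" using l by (simp add: W_def)
  have DlS: "ip H e (D l) = 0" if "e \<in> S" for e
    using that S(2) l(1) lS[OF that] ip_eigvec_op[of e l] by auto
  \<comment> \<open>\<open>l\<close> minimises \<open>\<parallel>D x\<parallel>\<^sup>2 - m\<^sup>2 \<parallel>x\<parallel>\<^sup>2\<close> on \<open>W\<close>, so the first variation vanishes.\<close>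
  have var: "ip H (D l) (D x) = m\<^sup>2 * ip H l x" if x: "x \<in> W" for x
  proof -
    have xX: "x \<in> X" using WX x .
    have "0 \<le> 2 * Re (c * (ip H (D l) (D x) - m\<^sup>2 * ip H l x))
        + (cmod c)\<^sup>2 * ((nrm (D x))\<^sup>2 - m\<^sup>2 * (nrm x)\<^sup>2)" for c
    proof -
      have "m * nrm (l \<oplus>\<^bsub>H\<^esub> c \<odot>\<^bsub>H\<^esub> x) \<le> nrm (D (l \<oplus>\<^bsub>H\<^esub> c \<odot>\<^bsub>H\<^esub> x))"
        by (intro lower Wadd Wsmult lW x)
      then have "(m * nrm (l \<oplus>\<^bsub>H\<^esub> c \<odot>\<^bsub>H\<^esub> x))\<^sup>2 \<le> (nrm (D l \<oplus>\<^bsub>H\<^esub> c \<odot>\<^bsub>H\<^esub> D x))\<^sup>2"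
        using m0 l(1) xX by (intro power_mono) auto
      then have "m\<^sup>2 * ((nrm l)\<^sup>2 + (cmod c * nrm x)\<^sup>2 + 2 * Re (c * ip H l x))
          \<le> (nrm (D l))\<^sup>2 + (cmod c * nrm (D x))\<^sup>2 + 2 * Re (c * ip H (D l) (D x))"
        using l(1) xX by (simp add: nrm_add_sq power_mult_distrib[of m])
      then have *: "m\<^sup>2 * (cmod c * nrm x)\<^sup>2 + 2 * (m\<^sup>2 * Re (c * ip H l x))
          \<le> (cmod c * nrm (D x))\<^sup>2 + 2 * Re (c * ip H (D l) (D x))"
        by (simp only: nl nDl) (simp add: algebra_simps)
      have "Re (c * (m\<^sup>2 * ip H l x)) = m\<^sup>2 * Re (c * ip H l x)"
        by (simp add: algebra_simps flip: of_real_power)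
      then show ?thesis using * by (simp add: right_diff_distrib power_mult_distrib mult_ac)
    qed
    then have "ip H (D l) (D x) - m\<^sup>2 * ip H l x = 0" by (rule quadratic_nonneg_imp_zero)
    then show ?thesis by simp
  qed
  \<comment> \<open>\<open>adjointI\<close> asks for test vectors from the whole domain, not only
    from \<open>W\<close>. Split off the projection \<open>p\<close> of \<open>x\<close> onto the
    closed span of \<open>S\<close>: it stays in the domain because \<open>q\<close>, the projection
    of \<open>D x\<close>, serves as \<open>D p\<close>, and it contributes nothing since
    \<open>l\<close> and \<open>D l\<close> are orthogonal to \<open>S\<close>.\<close>
  have var': "ip H (D l) (D x) = m\<^sup>2 * ip H l x" if xX: "x \<in> X" for x
  proof -
    obtain p where p: "p \<in> carrier H"
      "\<And>y. y \<in> carrier H \<Longrightarrow> ((\<lambda>e. ip H e x * ip H y e) has_sum ip H y p) S"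
      "\<And>e. e \<in> S \<Longrightarrow> ip H e p = ip H e x"
      by (rule Riesz_Fischer[OF S(1) Bessel[OF S(1) dom_carrier[OF xX]]]) blast
    obtain q where q: "q \<in> carrier H"
      "\<And>y. y \<in> carrier H \<Longrightarrow> ((\<lambda>e. ip H e (D x) * ip H y e) has_sum ip H y q) S"
      "\<And>e. e \<in> S \<Longrightarrow> ip H e q = ip H e (D x)"
      by (rule Riesz_Fischer[OF S(1) Bessel[OF S(1) op_closed[OF xX]]]) blast
    have pq: "p \<in> X" "D p = q"
    proof -
      have "ip H (D y) p = ip H y q" if y: "y \<in> X" for y
      proof -
        have "ip H e x * ip H (D y) e = ip H e (D x) * ip H y e" if "e \<in> S" for e
        proof -
          have e: "e \<in> eigvecs" "e \<in> X" using that S SX by auto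
          then have "ip H (D y) e = lam e * ip H y e"
            using y by (simp add: op_symmetric op_eigvec)
          then show ?thesis using e xX by (simp add: ip_eigvec_op)
        qed
        then have "((\<lambda>e. ip H e (D x) * ip H y e) has_sum ip H (D y) p) S"
          using p(2)[of "D y"] y by (simp cong: has_sum_cong)
        then show ?thesis using q(2)[OF dom_carrier[OF y]] has_sum_unique by blast
      qed
      then show "p \<in> X" "D p = q" using adjointI p(1) q(1) by blast+
    qed
    have "ip H l p = 0"
    proof -
      have "ip H e x * ip H l e = 0" if "e \<in> S" for e
        using lS[OF that] cnj_ip[of e l] SX[OF that] lC by simp
      then have "((\<lambda>e. ip H e x * ip H l e) has_sum 0) S" by (rule has_sum_0)
      then show ?thesis using p(2)[OF lC] has_sum_unique by blast
    qed
    moreover have "ip H (D l) q = 0"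
    proof -
      have "ip H e (D x) * ip H (D l) e = 0" if "e \<in> S" for e
        using DlS[OF that] cnj_ip[of e "D l"] SX[OF that] l(1) by simp
      then have "((\<lambda>e. ip H e (D x) * ip H (D l) e) has_sum 0) S" by (rule has_sum_0)
      then show ?thesis using q(2)[OF op_closed[OF l(1)]] has_sum_unique by blast
    qed
    moreover have "x \<ominus>\<^bsub>H\<^esub> p \<in> W"
      using xX pq(1) p(3) SX by (simp add: W_def)
    ultimately show ?thesis
      using var[of "x \<ominus>\<^bsub>H\<^esub> p"] xX pq q(1) l(1) by simp
  qed
  have Dl: "D l \<in> X" "D (D l) = of_real (m\<^sup>2) \<odot>\<^bsub>H\<^esub> l"
  proof -
    have *: "ip H (D x) (D l) = ip H x (of_real (m\<^sup>2) \<odot>\<^bsub>H\<^esub> l)" if x: "x \<in> X" for x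
    proof -
      have "cnj (ip H (D l) (D x)) = cnj (m\<^sup>2 * ip H l x)" using var'[OF x] by simp
      then show ?thesis using x l(1) by (simp add: cnj_ip)
    qed
    show "D l \<in> X" "D (D l) = of_real (m\<^sup>2) \<odot>\<^bsub>H\<^esub> l"
      by (rule adjointI[OF op_closed[OF l(1)] _ *]; use l(1) in simp)+
  qed
  \<comment> \<open>D^2 - m^2 is (D - m) (D + m), and \<open>v\<close> is (D + m) l. If
    \<open>v\<close> vanishes, \<open>l\<close> is an eigenvector for -m; otherwise \<open>v\<close>
    is one for m.\<close>
  define v where "v = D l \<oplus>\<^bsub>H\<^esub> of_real m \<odot>\<^bsub>H\<^esub> l"
  show thesis
  proof (cases "v = \<zero>\<^bsub>H\<^esub>")
    case True
    have "D l = of_real (- m) \<odot>\<^bsub>H\<^esub> l"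
    proof (rule ip_eqI)
      fix z assume z: "z \<in> carrier H"
      have "ip H z v = 0" using True z by simp
      then show "ip H z (D l) = ip H z (of_real (- m) \<odot>\<^bsub>H\<^esub> l)"
        using z l(1) by (simp add: v_def add_eq_0_iff2)
    qed (use l(1) in auto)
    then have "l \<in> eigvecs" using l(1) nl unfolding eigvecs_def by blast
    then show thesis using that lS by blast
  next
    case False
    have vX: "v \<in> X" using Dl l(1) by (simp add: v_def)
    have "D v = of_real m \<odot>\<^bsub>H\<^esub> v"
      by (rule ip_eqI) (use Dl l(1) in \<open>simp_all add: v_def algebra_simps power2_eq_square\<close>)
    then have "of_real (1 / nrm v) \<odot>\<^bsub>H\<^esub> v \<in> eigvecs" using normalized_eigvec vX False by blast
    moreover have "ip H e (of_real (1 / nrm v) \<odot>\<^bsub>H\<^esub> v) = 0" if "e \<in> S" for e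
      using lS[OF that] DlS[OF that] SX[OF that] l(1) by (simp add: v_def)
    ultimately show thesis using that by blast
  qed
qed

text \<open>A vector orthogonal to \<open>S\<close> need not lie in the domain, as
  \<open>op_min_eigvec\<close> demands. The resolvent moves it there and only divides its
  coefficient at \<open>e\<close> by lam e - z, so it stays orthogonal to \<open>S\<close>.\<close>

lemma maximal_eigvecs_total:
  assumes S: "orthonormal S" "S \<subseteq> eigvecs"
    and max: "\<And>u. u \<in> eigvecs \<Longrightarrow> \<exists>e\<in>S. ip H e u \<noteq> 0"
  shows "is_total S"
  unfolding is_total_def
proof (intro ballI impI, rule ccontr)
  fix w assume w: "w \<in> carrier H" "\<forall>e\<in>S. ip H e w = 0" "w \<noteq> \<zero>\<^bsub>H\<^esub>"
  obtain z where "z \<in> resolvent_set H X D"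
    using compact_resolvent by (auto simp: compact_resolvent_def)
  define f where "f = (\<lambda>\<xi>. D \<xi> \<ominus>\<^bsub>H\<^esub> z \<odot>\<^bsub>H\<^esub> \<xi>)"
  have bij: "bij_betw f X (carrier H)"
    using \<open>z \<in> resolvent_set H X D\<close> by (simp add: resolvent_set_def f_def)
  then obtain x where x: "x \<in> X" "f x = w" using w(1) by (metis bij_betw_def imageE)
  have xS: "ip H e x = 0" if e: "e \<in> S" for e
  proof -
    have eE: "e \<in> eigvecs" "e \<in> X" using S e by (auto simp: eigvecs_def)
    have "lam e \<noteq> z"
    proof
      assume "lam e = z"
      then have "f e = f \<zero>\<^bsub>H\<^esub>"
        by (intro ip_eqI) (use eE in \<open>simp_all add: f_def op_eigvec\<close>)
      then have "e = \<zero>\<^bsub>H\<^esub>" using bij eE by (auto simp: bij_betw_def inj_on_def)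
      then show False using eE by (simp add: eigvecs_def)
    qed
    moreover have "ip H e (f x) = (lam e - z) * ip H e x"
      using eE x(1) by (simp add: f_def ip_eigvec_op algebra_simps)
    ultimately show ?thesis using x w e by simp
  qed
  have "x \<noteq> \<zero>\<^bsub>H\<^esub>"
  proof
    assume "x = \<zero>\<^bsub>H\<^esub>"
    then have "f x = \<zero>\<^bsub>H\<^esub>"
      by (intro ip_eqI) (simp_all add: f_def)
    then show False using x w by simp
  qed
  then have "nrm x \<noteq> 0" using x by simp
  then have "0 < nrm x" using nrm_nonneg[of x] by linarith
  then have y: "of_real (1 / nrm x) \<odot>\<^bsub>H\<^esub> x \<in> X" "nrm (of_real (1 / nrm x) \<odot>\<^bsub>H\<^esub> x) = 1"
    using x(1) by (auto simp: norm_divide)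
  have "ip H e (of_real (1 / nrm x) \<odot>\<^bsub>H\<^esub> x) = 0" if "e \<in> S" for e
    using xS[OF that] x(1) orthonormal_carrier[OF S(1) that] by simp
  then obtain u where "u \<in> eigvecs" "\<And>e. e \<in> S \<Longrightarrow> ip H e u = 0"
    by (rule op_min_eigvec[OF S y]) blast+
  then show False using max by blast
qed

theorem eigenbasis_exists: "\<exists>S. orthonormal S \<and> S \<subseteq> eigvecs \<and> is_total S"
proof -
  define A where "A = {S. orthonormal S \<and> S \<subseteq> eigvecs}"
  have "\<exists>S\<in>A. \<forall>T\<in>A. S \<subseteq> T \<longrightarrow> T = S"
  proof (rule subset_Zorn_nonempty)
    show "A \<noteq> {}" by (auto simp: A_def orthonormal_def)
    fix C assume C: "C \<noteq> {}" "subset.chain A C"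
    then have CA: "E \<in> A" and chain: "E \<subseteq> F \<or> F \<subseteq> E" if "E \<in> C" "F \<in> C" for E F
      using that unfolding subset_chain_def by blast+
    have "ip H e f = (if e = f then 1 else 0)" if ef: "e \<in> \<Union>C" "f \<in> \<Union>C" for e f
    proof -
      obtain E F where EF: "e \<in> E" "E \<in> C" "f \<in> F" "F \<in> C" using ef by blast
      then obtain G where G: "G \<in> C" "e \<in> G" "f \<in> G" using chain[of E F] by blast
      then have "orthonormal G" using CA by (simp add: A_def)
      then show ?thesis using G by (simp add: orthonormal_def)
    qed
    moreover have "\<Union>C \<subseteq> eigvecs" using CA by (auto simp: A_def)
    moreover have "eigvecs \<subseteq> carrier H" by (auto simp: eigvecs_def)
    ultimately show "\<Union>C \<in> A" unfolding A_def orthonormal_def by blast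
  qed
  then obtain S where S: "orthonormal S" "S \<subseteq> eigvecs"
      and max: "\<And>T. orthonormal T \<Longrightarrow> T \<subseteq> eigvecs \<Longrightarrow> S \<subseteq> T \<Longrightarrow> T = S"
    by (auto simp: A_def)
  have "is_total S"
  proof (rule maximal_eigvecs_total[OF S], rule ccontr)
    fix u assume u: "u \<in> eigvecs" and "\<not> (\<exists>e\<in>S. ip H e u \<noteq> 0)"
    then have 0: "\<And>e. e \<in> S \<Longrightarrow> ip H e u = 0" by blast
    have uC: "u \<in> carrier H" using u by (auto simp: eigvecs_def)
    have uu: "ip H u u = 1" using u uC by (simp add: ip_self eigvecs_def)
    have "ip H u e = 0" if "e \<in> S" for e
      using 0[OF that] cnj_ip[OF orthonormal_carrier[OF S(1) that] uC] by simp
    then have "orthonormal (insert u S)"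
      using S(1) uC uu 0 by (auto simp: orthonormal_def)
    then have "insert u S = S" using S(2) u by (intro max) auto
    then show False using 0[of u] uu by auto
  qed
  then show ?thesis using S by blast
qed

section \<open>Coefficients in a fixed eigenbasis\<close>

definition eigenbasis :: "'h set" where
  "eigenbasis = (SOME S. orthonormal S \<and> S \<subseteq> eigvecs \<and> is_total S)"

lemma eigenbasis: "orthonormal eigenbasis" "eigenbasis \<subseteq> eigvecs" "is_total eigenbasis"
  using someI_ex[OF eigenbasis_exists] by (auto simp: eigenbasis_def)

lemma eigenbasis_dom [simp]: "e \<in> eigenbasis \<Longrightarrow> e \<in> X"
  using eigenbasis(2) by (auto simp: eigvecs_def)

lemma ip_eigenbasis:
  "\<lbrakk>e \<in> eigenbasis; f \<in> eigenbasis\<rbrakk> \<Longrightarrow> ip H e f = (if e = f then 1 else 0)"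
  using eigenbasis(1) by (auto simp: orthonormal_def)

lemma nrm_eigenbasis: "e \<in> eigenbasis \<Longrightarrow> nrm e = 1"
  using eigenbasis(2) by (auto simp: eigvecs_def)

lemma op_eigenbasis: "e \<in> eigenbasis \<Longrightarrow> D e = of_real (lam e) \<odot>\<^bsub>H\<^esub> e"
  using eigenbasis(2) op_eigvec by blast

lemma ip_eigenbasis_op:
  "\<lbrakk>e \<in> eigenbasis; x \<in> X\<rbrakk> \<Longrightarrow> ip H e (D x) = lam e * ip H e x"
  using eigenbasis(2) ip_eigvec_op by blast

lemmas eigenbasis_eqI = total_eqI[OF eigenbasis(1,3)]
  and eigenbasis_Parseval = Parseval[OF eigenbasis(1,3)]
  and eigenbasis_Parseval_nrm = Parseval_nrm[OF eigenbasis(1,3)]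

text \<open>Parseval turns the relation between coefficients into the weak equation of
  \<open>adjointI\<close>. Hence \<open>D\<close> is the multiplication operator on its maximal
  domain, and membership can be read off coefficients.\<close>

lemma op_domI:
  assumes "x \<in> carrier H" "y \<in> carrier H"
    and coef: "\<And>e. e \<in> eigenbasis \<Longrightarrow> ip H e y = lam e * ip H e x"
  shows "x \<in> X" "D x = y"
proof -
  have "ip H (D z) x = ip H z y" if z: "z \<in> X" for z
  proof -
    have "ip H e x * ip H (D z) e = ip H e y * ip H z e" if e: "e \<in> eigenbasis" for e
      using z e by (simp add: op_symmetric op_eigenbasis coef)
    then have "((\<lambda>e. ip H e y * ip H z e) has_sum ip H (D z) x) eigenbasis"
      using eigenbasis_Parseval[OF assms(1), of "D z"] z by (simp cong: has_sum_cong)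
    then show ?thesis using eigenbasis_Parseval[OF assms(2) dom_carrier[OF z]] has_sum_unique by blast
  qed
  then show "x \<in> X" "D x = y" using adjointI assms by blast+
qed

text \<open>Otherwise there is an orthonormal sequence bounded in the graph norm. It has a
  convergent subsequence, although its members are at mutual distance sqrt 2.\<close>

lemma finite_eigenbasis_bounded: "finite {e \<in> eigenbasis. \<bar>lam e\<bar> \<le> R}"
proof (rule ccontr)
  assume "infinite {e \<in> eigenbasis. \<bar>lam e\<bar> \<le> R}"
  then obtain x :: "nat \<Rightarrow> 'h" where x: "inj x" "range x \<subseteq> {e \<in> eigenbasis. \<bar>lam e\<bar> \<le> R}"
    using infinite_countable_subset by blast
  then have xe: "\<And>n. x n \<in> eigenbasis" "\<And>n. \<bar>lam (x n)\<bar> \<le> R" by auto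
  then have R: "0 \<le> R" using abs_ge_zero order_trans by blast
  have "x n \<in> X" "nrm (x n) \<le> R + 1" "nrm (D (x n)) \<le> R + 1" for n
    using xe[of n] R by (auto simp: nrm_eigenbasis op_eigenbasis)
  then obtain l r where r: "strict_mono (r :: nat \<Rightarrow> nat)"
      and lim: "limitin (vtop H) (x \<circ> r) l sequentially"
    by (rule op_bounded_convergent_subseq)
  have l: "l \<in> carrier H" and to0: "(\<lambda>n. nrm (x (r n) \<ominus>\<^bsub>H\<^esub> l)) \<longlonglongrightarrow> 0"
    using lim by (auto simp: limitin_iff)
  then obtain N where N: "\<And>n. N \<le> n \<Longrightarrow> nrm (x (r n) \<ominus>\<^bsub>H\<^esub> l) < 1 / 2"
    using order_tendstoD(2)[OF to0, of "1/2"] by (auto simp: eventually_sequentially)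
  let ?a = "x (r N)" and ?b = "x (r (Suc N))"
  have ab: "?a \<in> X" "?b \<in> X" "?a \<noteq> ?b"
    using xe x(1) strict_monoD[OF r, of N "Suc N"] by (auto dest: injD)
  have "(nrm (?a \<ominus>\<^bsub>H\<^esub> ?b))\<^sup>2 = 2"
    using ab xe by (simp add: nrm_diff_sq nrm_eigenbasis ip_eigenbasis)
  moreover have "nrm (?a \<ominus>\<^bsub>H\<^esub> ?b) < 1"
    using nrm_triangle_diff[of ?a l ?b] nrm_minus_commute[of l ?b] N[of N] N[of "Suc N"] ab l
    by simp
  then have "(nrm (?a \<ominus>\<^bsub>H\<^esub> ?b))\<^sup>2 < 1" by (simp add: power_less_one_iff)
  ultimately show False by simp
qed

end

section \<open>The unitary group\<close>

text \<open>A finite set carries all but r/2 of the majorant, and on it termwise convergence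
  suffices: dominated convergence for unordered sums, along any filter so as to cover real limits in
  \<open>t\<close>.\<close>

lemma has_sum_dominated_null:
  fixes f :: "'t \<Rightarrow> 'e \<Rightarrow> real"
  assumes null: "\<And>e. e \<in> S \<Longrightarrow> ((\<lambda>t. f t e) \<longlongrightarrow> 0) F"
    and nonneg: "\<And>t e. e \<in> S \<Longrightarrow> 0 \<le> f t e"
    and le: "\<And>t e. e \<in> S \<Longrightarrow> f t e \<le> g e"
    and g: "g summable_on S" and s: "\<And>t. (f t has_sum s t) S"
  shows "(s \<longlongrightarrow> 0) F"
  unfolding tendsto_iff
proof (intro allI impI)
  fix r :: real assume r: "0 < r"
  have "(g has_sum infsum g S) S" using g by simp
  then have "\<forall>\<^sub>F G in finite_subsets_at_top S. dist (sum g G) (infsum g S) < r / 2"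
    unfolding has_sum_def by (rule tendstoD[OF _ half_gt_zero[OF r]])
  then obtain G where G: "finite G" "G \<subseteq> S" "dist (sum g G) (infsum g S) < r / 2"
    by (auto simp: eventually_finite_subsets_at_top)
  have tail: "s t - sum (f t) G \<le> infsum g S - sum g G" for t
  proof (rule has_sum_mono)
    show "(f t has_sum (s t - sum (f t) G)) (S - G)"
      using G by (intro has_sum_Diff s) (auto intro: has_sum_finite)
    show "(g has_sum (infsum g S - sum g G)) (S - G)"
      using G g by (intro has_sum_Diff) (auto intro: has_sum_finite)
  qed (use le in auto)
  have "((\<lambda>t. sum (f t) G) \<longlongrightarrow> 0) F"
    using G null by (intro tendsto_null_sum) auto
  then have "\<forall>\<^sub>F t in F. sum (f t) G < r / 2"
    using r by (intro order_tendstoD) auto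
  then show "\<forall>\<^sub>F t in F. dist (s t) 0 < r"
  proof eventually_elim
    case (elim t)
    have "0 \<le> s t" using s nonneg by (rule has_sum_nonneg)
    then show ?case using elim tail[of t] G(3) unfolding dist_real_def by linarith
  qed
qed

lemma cmod_cis_diff: "(cmod (cis a - 1))\<^sup>2 = 4 * (sin (a / 2))\<^sup>2"
proof -
  have "(cmod (cis a - 1))\<^sup>2 = 2 - 2 * cos a"
    using sin_cos_squared_add2[of a] by (simp add: cmod_power2 power2_diff)
  then show ?thesis using cos_double_sin[of "a / 2"] by simp
qed

lemma cmod_cis_diff_le: "cmod (cis a - 1) \<le> \<bar>a\<bar>"
proof (rule power2_le_imp_le)
  have "(sin (a / 2))\<^sup>2 \<le> (a / 2)\<^sup>2"
    by (rule abs_le_square_iff[THEN iffD1, OF abs_sin_x_le_abs_x])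
  then show "(cmod (cis a - 1))\<^sup>2 \<le> \<bar>a\<bar>\<^sup>2" by (simp add: cmod_cis_diff power_divide)
qed simp

lemma has_vector_derivative_iff_quotient:
  fixes f :: "real \<Rightarrow> 'a::real_normed_vector"
  shows "(f has_vector_derivative d) (at x) \<longleftrightarrow> ((\<lambda>h. (f (x + h) - f x) /\<^sub>R h) \<longlongrightarrow> d) (at 0)"
proof -
  have eq: "norm (f (x + h) - f x - h *\<^sub>R d) / norm h = norm ((f (x + h) - f x) /\<^sub>R h - d)"
    if "h \<noteq> 0" for h
  proof -
    have "(f (x + h) - f x) /\<^sub>R h - d = (f (x + h) - f x - h *\<^sub>R d) /\<^sub>R h"
      using that by (simp add: scaleR_diff_right)
    then show ?thesis by (simp add: divide_inverse mult.commute)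
  qed
  have "(f has_vector_derivative d) (at x) \<longleftrightarrow>
      ((\<lambda>h. norm (f (x + h) - f x - h *\<^sub>R d) / norm h) \<longlongrightarrow> 0) (at 0)"
    by (simp add: has_vector_derivative_def has_derivative_at bounded_linear_scaleR_left)
  also have "\<dots> \<longleftrightarrow> ((\<lambda>h. norm ((f (x + h) - f x) /\<^sub>R h - d)) \<longlongrightarrow> 0) (at 0)"
    by (rule tendsto_cong, unfold eventually_at_filter, intro always_eventually allI impI eq)
  also have "\<dots> \<longleftrightarrow> ((\<lambda>h. (f (x + h) - f x) /\<^sub>R h) \<longlongrightarrow> d) (at 0)"
    by (simp only: tendsto_norm_zero_iff LIM_zero_iff)
  finally show ?thesis .
qed

lemma diffquot_cis_tendsto:
  "((\<lambda>t. complex_of_real (1/t) * (cis (t * l) - 1)) \<longlongrightarrow> \<i> * of_real l) (at 0)"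
proof -
  have "((\<lambda>t. exp (t *\<^sub>R (\<i> * of_real l))) has_vector_derivative
      exp (0 *\<^sub>R (\<i> * of_real l)) * (\<i> * of_real l)) (at 0)"
    by (rule exp_scaleR_has_vector_derivative_right)
  then have "((\<lambda>t. (exp (t *\<^sub>R (\<i> * of_real l)) - 1) /\<^sub>R t) \<longlongrightarrow> \<i> * of_real l) (at 0)"
    by (simp add: has_vector_derivative_iff_quotient)
  moreover have "(exp (t *\<^sub>R (\<i> * of_real l)) - 1) /\<^sub>R t = complex_of_real (1/t) * (cis (t * l) - 1)" for t
    by (simp add: cis_conv_exp scaleR_conv_of_real divide_inverse mult_ac)
  ultimately show ?thesis by simp
qed

context spectral_op
begin

text \<open>The bound keeps the new coefficients square summable. Both the group, with entries of
  modulus 1, and the resolvent, with entries 1/(lam e - z), arise from this.\<close>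

lemma diagonal_exists:
  assumes g: "\<And>e. e \<in> eigenbasis \<Longrightarrow> cmod (g e) \<le> C" and x: "x \<in> carrier H"
  obtains y where "y \<in> carrier H" "\<And>e. e \<in> eigenbasis \<Longrightarrow> ip H e y = g e * ip H e x"
proof -
  have "(\<lambda>e. C\<^sup>2 * (cmod (ip H e x))\<^sup>2) summable_on eigenbasis"
    by (intro summable_on_cmult_right Bessel eigenbasis x)
  then have "(\<lambda>e. (cmod (g e * ip H e x))\<^sup>2) summable_on eigenbasis"
  proof (rule summable_on_comparison_test)
    fix e assume "e \<in> eigenbasis"
    then have "cmod (g e) \<le> C" by (rule g)
    then show "(cmod (g e * ip H e x))\<^sup>2 \<le> C\<^sup>2 * (cmod (ip H e x))\<^sup>2"
      by (simp add: norm_mult power_mult_distrib mult_right_mono power_mono)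
  qed auto
  then show ?thesis
    by (rule Riesz_Fischer[OF eigenbasis(1)]) (use that in blast)
qed

text \<open>\<open>exp_i\<close> is a definite description; this diagonal operator is the concrete
  candidate that \<open>exp_i_eq_expD\<close> identifies with it.\<close>

definition expD :: "real \<Rightarrow> 'h \<Rightarrow> 'h" where
  "expD t x = (SOME y. y \<in> carrier H \<and> (\<forall>e\<in>eigenbasis. ip H e y = cis (t * lam e) * ip H e x))"

lemma expD:
  assumes "x \<in> carrier H"
  shows expD_closed [simp]: "expD t x \<in> carrier H"
    and ip_expD: "e \<in> eigenbasis \<Longrightarrow> ip H e (expD t x) = cis (t * lam e) * ip H e x"
proof -
  have "\<exists>y. y \<in> carrier H \<and> (\<forall>e\<in>eigenbasis. ip H e y = cis (t * lam e) * ip H e x)"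
    by (rule diagonal_exists[of "\<lambda>e. cis (t * lam e)" 1 x]) (use assms in auto)
  then have "expD t x \<in> carrier H \<and> (\<forall>e\<in>eigenbasis. ip H e (expD t x) = cis (t * lam e) * ip H e x)"
    unfolding expD_def by (rule someI_ex)
  then show "expD t x \<in> carrier H"
    "e \<in> eigenbasis \<Longrightarrow> ip H e (expD t x) = cis (t * lam e) * ip H e x" by auto
qed

lemma expD_0: "x \<in> carrier H \<Longrightarrow> expD 0 x = x"
  by (rule eigenbasis_eqI) (auto simp: ip_expD)

lemma expD_add: "x \<in> carrier H \<Longrightarrow> expD (s + t) x = expD s (expD t x)"
  by (rule eigenbasis_eqI) (auto simp: ip_expD cis_mult distrib_right)

lemma ip_expD_expD:
  assumes x: "x \<in> carrier H" and y: "y \<in> carrier H"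
  shows "ip H (expD t x) (expD t y) = ip H x y"
proof -
  have "ip H e (expD t y) * ip H (expD t x) e = ip H e y * ip H x e" if e: "e \<in> eigenbasis" for e
  proof -
    have "ip H (expD t x) e = cnj (cis (t * lam e)) * ip H x e"
      using x e cnj_ip[of e "expD t x"] cnj_ip[of e x] by (simp add: ip_expD)
    moreover have "cis (t * lam e) * cnj (cis (t * lam e)) = 1"
      by (simp add: cis_cnj cis_mult)
    ultimately show ?thesis using y e by (simp add: ip_expD mult.assoc mult.left_commute)
  qed
  then have "((\<lambda>e. ip H e y * ip H x e) has_sum ip H (expD t x) (expD t y)) eigenbasis"
    using eigenbasis_Parseval[of "expD t y" "expD t x"] x y by (simp cong: has_sum_cong)
  then show ?thesis using eigenbasis_Parseval[OF y x] has_sum_unique by blast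
qed

lemma unitary_expD: "unitary H (expD t)"
  unfolding unitary_def
proof (intro conjI ballI allI)
  have "x \<in> expD t ` carrier H" if x: "x \<in> carrier H" for x
    using expD_add[OF x, of t "- t"] expD_0[OF x] x by (intro image_eqI[of _ _ "expD (- t) x"]) auto
  then show "expD t ` carrier H = carrier H" by auto
qed (auto simp: ip_expD_expD ip_expD algebra_simps intro!: eigenbasis_eqI)

lemma nrm_tendsto_0I:
  assumes "((\<lambda>t. (nrm (f t))\<^sup>2) \<longlongrightarrow> 0) F"
  shows "((\<lambda>t. nrm (f t)) \<longlongrightarrow> 0) F"
  using tendsto_real_sqrt[OF assms] by simp

lemma limitin_expD:
  assumes x: "x \<in> carrier H"
  shows "limitin (vtop H) (\<lambda>t. expD t x) (expD s x) (at s)"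
  unfolding limitin_iff
proof (intro conjI nrm_tendsto_0I)
  let ?f = "\<lambda>t e. (cmod (ip H e (expD t x \<ominus>\<^bsub>H\<^esub> expD s x)))\<^sup>2"
  have f: "?f t e = (cmod (cis (t * lam e) - cis (s * lam e)))\<^sup>2 * (cmod (ip H e x))\<^sup>2"
    if "e \<in> eigenbasis" for e t
    using that x by (simp add: ip_expD norm_mult power_mult_distrib flip: left_diff_distrib)
  show "((\<lambda>t. (nrm (expD t x \<ominus>\<^bsub>H\<^esub> expD s x))\<^sup>2) \<longlongrightarrow> 0) (at s)"
  proof (rule has_sum_dominated_null[where f = ?f and g = "\<lambda>e. 2\<^sup>2 * (cmod (ip H e x))\<^sup>2"])
    fix e assume e: "e \<in> eigenbasis"
    have "((\<lambda>t. (cmod (cis (t * lam e) - cis (s * lam e)))\<^sup>2 * (cmod (ip H e x))\<^sup>2)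
        \<longlongrightarrow> (cmod (cis (s * lam e) - cis (s * lam e)))\<^sup>2 * (cmod (ip H e x))\<^sup>2) (at s)"
      unfolding cis_conv_exp by (intro tendsto_intros)
    then show "((\<lambda>t. ?f t e) \<longlongrightarrow> 0) (at s)" using e by (simp add: f)
    have "cmod (cis (t * lam e) - cis (s * lam e)) \<le> 2" for t
      using norm_triangle_ineq4[of "cis (t * lam e)" "cis (s * lam e)"] by simp
    then show "?f t e \<le> 2\<^sup>2 * (cmod (ip H e x))\<^sup>2" for t
      using e by (simp only: f) (intro mult_right_mono power_mono, auto)
  next
    show "(\<lambda>e. 2\<^sup>2 * (cmod (ip H e x))\<^sup>2) summable_on eigenbasis"
      by (intro summable_on_cmult_right Bessel eigenbasis x)
    show "(?f t has_sum (nrm (expD t x \<ominus>\<^bsub>H\<^esub> expD s x))\<^sup>2) eigenbasis" for t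
      using x by (intro eigenbasis_Parseval_nrm) auto
  qed auto
qed (use x in auto)

abbreviation diffquot :: "(real \<Rightarrow> 'h \<Rightarrow> 'h) \<Rightarrow> real \<Rightarrow> 'h \<Rightarrow> 'h" where
  "diffquot U t x \<equiv> complex_of_real (1/t) \<odot>\<^bsub>H\<^esub> (U t x \<ominus>\<^bsub>H\<^esub> x)"

lemma limitin_diffquot_expD:
  assumes x: "x \<in> X"
  shows "limitin (vtop H) (\<lambda>t. diffquot expD t x) (\<i> \<odot>\<^bsub>H\<^esub> D x) (at 0)"
  unfolding limitin_iff
proof (intro conjI nrm_tendsto_0I)
  let ?v = "\<lambda>t. diffquot expD t x \<ominus>\<^bsub>H\<^esub> \<i> \<odot>\<^bsub>H\<^esub> D x"
  let ?f = "\<lambda>t e. (cmod (ip H e (?v t)))\<^sup>2"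
  let ?q = "\<lambda>t e. complex_of_real (1/t) * (cis (t * lam e) - 1)"
  have f: "?f t e = (cmod (?q t e - \<i> * of_real (lam e)))\<^sup>2 * (cmod (ip H e x))\<^sup>2"
    if "e \<in> eigenbasis" for e t
  proof -
    have "ip H e (?v t) = (?q t e - \<i> * of_real (lam e)) * ip H e x"
      using that x by (simp add: ip_expD ip_eigenbasis_op algebra_simps)
    then show ?thesis by (simp only: norm_mult power_mult_distrib)
  qed
  show "((\<lambda>t. (nrm (?v t))\<^sup>2) \<longlongrightarrow> 0) (at 0)"
  proof (rule has_sum_dominated_null[where f = ?f and g = "\<lambda>e. 2\<^sup>2 * (cmod (ip H e (D x)))\<^sup>2"])
    fix e assume e: "e \<in> eigenbasis"
    have "((\<lambda>t. (cmod (?q t e - \<i> * of_real (lam e)))\<^sup>2 * (cmod (ip H e x))\<^sup>2)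
        \<longlongrightarrow> (cmod (\<i> * of_real (lam e) - \<i> * of_real (lam e)))\<^sup>2 * (cmod (ip H e x))\<^sup>2) (at 0)"
      by (intro tendsto_mult tendsto_power tendsto_norm tendsto_diff tendsto_const
          diffquot_cis_tendsto)
    then show "((\<lambda>t. ?f t e) \<longlongrightarrow> 0) (at 0)"
      by (simp only: f[OF e] diff_self norm_zero zero_power2 mult_zero_left)
    show "?f t e \<le> 2\<^sup>2 * (cmod (ip H e (D x)))\<^sup>2" for t
    proof -
      \<comment> \<open>The majorant must hold for every \<open>t\<close>, including
        \<open>t = 0\<close>, where 1/0 = 0 makes the quotient vanish. It is summable because
        \<open>lam e\<close> times a coefficient of \<open>x\<close> is a coefficient of
        \<open>D x\<close>.\<close>
      have "cmod (?q t e) \<le> \<bar>lam e\<bar>"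
        using cmod_cis_diff_le[of "t * lam e"]
        by (cases "t = 0") (auto simp: norm_mult norm_divide field_simps abs_mult)
      then have "cmod (?q t e - \<i> * of_real (lam e)) \<le> 2 * \<bar>lam e\<bar>"
        using norm_triangle_ineq4[of "?q t e" "\<i> * of_real (lam e)"] by (simp add: norm_mult)
      then have "(cmod (?q t e - \<i> * of_real (lam e)))\<^sup>2 * (cmod (ip H e x))\<^sup>2
          \<le> (2 * \<bar>lam e\<bar>)\<^sup>2 * (cmod (ip H e x))\<^sup>2"
        by (intro mult_right_mono power_mono) auto
      then show ?thesis
        using e x by (simp only: f) (simp add: ip_eigenbasis_op norm_mult power_mult_distrib)
    qed
  next
    show "(\<lambda>e. 2\<^sup>2 * (cmod (ip H e (D x)))\<^sup>2) summable_on eigenbasis"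
      using x by (intro summable_on_cmult_right Bessel eigenbasis) auto
    show "(?f t has_sum (nrm (?v t))\<^sup>2) eigenbasis" for t
      using x by (intro eigenbasis_Parseval_nrm) auto
  qed auto
qed (use x in auto)

lemma generated_group_expD: "generated_group H X D expD"
  unfolding generated_group_def
proof (intro conjI allI ballI unitary_expD)
  show "{(\<xi>, \<zeta>). \<xi> \<in> carrier H \<and> \<zeta> \<in> carrier H \<and>
      limitin (vtop H) (\<lambda>t. diffquot expD t \<xi>) \<zeta> (at 0)} = (\<lambda>\<xi>. (\<xi>, \<i> \<odot>\<^bsub>H\<^esub> D \<xi>)) ` X"
    (is "?L = ?R")
  proof
    show "?R \<subseteq> ?L" using limitin_diffquot_expD by auto
    \<comment> \<open>The generator does not exceed \<open>D\<close>: the limit, read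
      coefficientwise, determines the coefficients of \<open>z\<close>, and \<open>op_domI\<close>
      puts \<open>x\<close> into the domain.\<close>
    show "?L \<subseteq> ?R"
    proof
      fix p assume "p \<in> ?L"
      then obtain x z where p: "p = (x, z)" and xz: "x \<in> carrier H" "z \<in> carrier H"
        and lim: "limitin (vtop H) (\<lambda>t. diffquot expD t x) z (at 0)" by auto
      define y where "y = (- \<i>) \<odot>\<^bsub>H\<^esub> z"
      have "ip H e y = lam e * ip H e x" if e: "e \<in> eigenbasis" for e
      proof -
        have "((\<lambda>t. ip H e (diffquot expD t x)) \<longlongrightarrow> ip H e z) (at 0)"
          using lim e by (intro ip_tendsto) auto
        moreover have "ip H e (diffquot expD t x)
            = (complex_of_real (1/t) * (cis (t * lam e) - 1)) * ip H e x" for t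
          using e xz by (simp add: ip_expD algebra_simps)
        moreover have "((\<lambda>t. (complex_of_real (1/t) * (cis (t * lam e) - 1)) * ip H e x)
            \<longlongrightarrow> (\<i> * of_real (lam e)) * ip H e x) (at 0)"
          by (intro tendsto_mult tendsto_const diffquot_cis_tendsto)
        ultimately have "ip H e z = (\<i> * of_real (lam e)) * ip H e x"
          using tendsto_unique[OF trivial_limit_at] by (metis (no_types, lifting) ext)
        then show ?thesis using e xz by (simp add: y_def flip: mult.assoc)
      qed
      then have "x \<in> X" "D x = y" using op_domI[of x y] xz by (auto simp: y_def)
      moreover have "\<i> \<odot>\<^bsub>H\<^esub> y = z"
        by (rule ip_eqI) (use xz in \<open>simp_all add: y_def flip: mult.assoc\<close>)
      ultimately show "p \<in> ?R" using p by auto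
    qed
  qed
qed (auto simp: expD_0 expD_add limitin_expD)

text \<open>Moving \<open>U t\<close> to the other side as \<open>U (- t)\<close> shifts the
  difference quotient at 0 to time \<open>t\<close>. The matrix coefficient then solves the scalar
  equation g' = i (lam e) g; testing against \<open>y\<close> reduces everything to complex-valued
  calculus.\<close>

lemma generated_group_eigenbasis:
  assumes U: "generated_group H X D U" and e: "e \<in> eigenbasis" and y: "y \<in> carrier H"
  shows "ip H y (U t e) = cis (t * lam e) * ip H y e"
proof -
  have "U t ` carrier H = carrier H" for t
    using U by (simp add: generated_group_def unitary_def)
  then have Uclosed: "U t x \<in> carrier H" if "x \<in> carrier H" for x t using that by blast
  have Uip: "ip H (U t x) (U t z) = ip H x z" if "x \<in> carrier H" "z \<in> carrier H" for x z t
    using U that by (auto simp: generated_group_def unitary_def)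
  have Uadd: "U (s + t) x = U s (U t x)" and U0: "U 0 x = x" if "x \<in> carrier H" for s t x
    using U that by (auto simp: generated_group_def)
  have adj: "ip H y (U t x) = ip H (U (- t) y) x" if "x \<in> carrier H" for t x
    using Uip[of "U (- t) y" x t] Uclosed[OF y, of "- t"] that Uadd[OF y, of t "- t"] U0[OF y] by simp
  have "(e, \<i> \<odot>\<^bsub>H\<^esub> D e) \<in> (\<lambda>\<xi>. (\<xi>, \<i> \<odot>\<^bsub>H\<^esub> D \<xi>)) ` X" using e by simp
  also have "\<dots> = {(\<xi>, \<zeta>). \<xi> \<in> carrier H \<and> \<zeta> \<in> carrier H \<and>
      limitin (vtop H) (\<lambda>t. diffquot U t \<xi>) \<zeta> (at 0)}"
    using U by (simp add: generated_group_def)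
  finally have lim: "limitin (vtop H) (\<lambda>t. diffquot U t e) (\<i> \<odot>\<^bsub>H\<^esub> D e) (at 0)" by simp
  define g where "g t = ip H y (U t e)" for t
  have g': "(g has_vector_derivative (\<i> * of_real (lam e)) * g t) (at t)" for t
  proof -
    have "((\<lambda>h. ip H (U (- t) y) (diffquot U h e)) \<longlongrightarrow> ip H (U (- t) y) (\<i> \<odot>\<^bsub>H\<^esub> D e)) (at 0)"
      using lim y by (intro ip_tendsto Uclosed)
    moreover have "ip H (U (- t) y) (diffquot U h e) = (g (t + h) - g t) /\<^sub>R h" for h
      using e y Uclosed
      by (simp add: g_def Uadd adj scaleR_conv_of_real divide_inverse)
    moreover have "ip H (U (- t) y) (\<i> \<odot>\<^bsub>H\<^esub> D e) = (\<i> * of_real (lam e)) * g t"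
      using e y Uclosed by (simp add: g_def adj op_eigenbasis)
    ultimately show ?thesis
      by (simp add: has_vector_derivative_iff_quotient)
  qed
  \<comment> \<open>Integrating factor: the derivative of \<open>k\<close> vanishes.\<close>
  define k where "k t = exp (t *\<^sub>R (- \<i> * of_real (lam e))) * g t" for t :: real
  have "(k has_vector_derivative 0) (at t)" for t
    unfolding k_def
    using has_vector_derivative_mult[OF exp_scaleR_has_vector_derivative_right g', of "- \<i> * of_real (lam e)" t]
    by (simp add: algebra_simps)
  then obtain c where "\<And>t. t \<in> UNIV \<Longrightarrow> k t = c"
    by (rule has_vector_derivative_zero_constant[OF convex_UNIV, of k]) auto
  then have "k t = k 0" by simp
  then have "cis (- (t * lam e)) * g t = g 0"
    by (simp add: k_def cis_conv_exp scaleR_conv_of_real mult_ac)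
  then have "cis (t * lam e) * (cis (- (t * lam e)) * g t) = cis (t * lam e) * g 0" by simp
  then show ?thesis using e U0 by (simp add: g_def cis_mult flip: mult.assoc)
qed

lemma generated_group_unique:
  assumes U: "generated_group H X D U" and x: "x \<in> carrier H"
  shows "U t x = expD t x"
proof (rule eigenbasis_eqI)
  have "U t ` carrier H = carrier H" for t
    using U by (simp add: generated_group_def unitary_def)
  then have Uclosed: "U t x \<in> carrier H" if "x \<in> carrier H" for x t using that by blast
  have Uip: "ip H (U t x) (U t z) = ip H x z" if "x \<in> carrier H" "z \<in> carrier H" for x z t
    using U that by (auto simp: generated_group_def unitary_def)
  have Uadd: "U (s + t) x = U s (U t x)" and U0: "U 0 x = x" if "x \<in> carrier H" for s t x
    using U that by (auto simp: generated_group_def)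
  show "U t x \<in> carrier H" using Uclosed x .
  fix e assume e: "e \<in> eigenbasis"
  then have eC: "e \<in> carrier H" by simp
  have "ip H e (U t x) = ip H (U (- t) e) x"
    using Uip[of "U (- t) e" x t] Uclosed[OF eC, of "- t"] x Uadd[OF eC, of t "- t"] U0[OF eC] by simp
  also have "\<dots> = cnj (ip H x (U (- t) e))" using x Uclosed[OF eC] by (simp add: cnj_ip)
  also have "\<dots> = cis (t * lam e) * ip H e x"
    using generated_group_eigenbasis[OF U e x, of "- t"] x e by (simp add: cnj_ip cis_cnj)
  finally show "ip H e (U t x) = ip H e (expD t x)" using e x by (simp add: ip_expD)
qed (use x in auto)

theorem exp_i_eq_expD:
  assumes "x \<in> carrier H"
  shows "exp_i H X D t x = expD t x"
  unfolding exp_i_def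
proof (rule the_equality)
  show "\<exists>U. generated_group H X D U \<and> expD t x = U t x"
    using generated_group_expD by blast
qed (use generated_group_unique assms in blast)

end

section \<open>Spectrum and multiplicities\<close>

lemma field_complex_cstar: "cring complex_cstar \<Longrightarrow> field complex_cstar"
proof (rule cring.cring_fieldI)
  have "\<exists>y. y * x = 1 \<and> x * y = 1" if "x \<noteq> 0" for x :: complex
    using that by (intro exI[of _ "inverse x"]) simp
  then show "Units complex_cstar = carrier complex_cstar - {\<zero>\<^bsub>complex_cstar\<^esub>}"
    by (fastforce simp: Units_def)
qed

context spectral_op
begin

lemma eigenvalue_not_in_resolvent_set:
  assumes e: "e \<in> eigenbasis"
  shows "complex_of_real (lam e) \<notin> resolvent_set H X D"
proof
  define f where "f = (\<lambda>\<xi>. D \<xi> \<ominus>\<^bsub>H\<^esub> complex_of_real (lam e) \<odot>\<^bsub>H\<^esub> \<xi>)"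
  assume "complex_of_real (lam e) \<in> resolvent_set H X D"
  then have inj: "inj_on f X" by (simp add: resolvent_set_def bij_betw_def f_def)
  have "f e = f \<zero>\<^bsub>H\<^esub>"
    by (rule ip_eqI) (use e in \<open>simp_all add: f_def op_eigenbasis\<close>)
  then have "e = \<zero>\<^bsub>H\<^esub>" using inj e by (auto dest: inj_onD)
  then show False using nrm_eigenbasis[OF e] by simp
qed

text \<open>The inverse of D - z is diagonal with entries 1/(lam e - z). They are bounded because
  the eigenvalues do not accumulate, so \<open>z\<close> has a positive distance from all of
  them.\<close>

lemma resolvent_setI:
  assumes z: "z \<notin> complex_of_real ` lam ` eigenbasis"
  shows "z \<in> resolvent_set H X D"
proof -
  define f where "f = (\<lambda>\<xi>. D \<xi> \<ominus>\<^bsub>H\<^esub> z \<odot>\<^bsub>H\<^esub> \<xi>)"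
  define B where "B = {e \<in> eigenbasis. \<bar>lam e\<bar> \<le> cmod z + 1}"
  obtain d where d: "0 < d" "\<And>e. e \<in> eigenbasis \<Longrightarrow> d \<le> cmod (lam e - z)"
  proof -
    \<comment> \<open>Eigenvalues outside \<open>B\<close> are at distance at least 1 from
      \<open>z\<close>; inserting 1 accounts for them and keeps the minimum over a nonempty
      set.\<close>
    define d where "d = Min (insert 1 ((\<lambda>e. cmod (lam e - z)) ` B))"
    have fin: "finite B" unfolding B_def by (rule finite_eigenbasis_bounded)
    have "0 < d" unfolding d_def using fin z by (subst Min_gr_iff) (auto simp: B_def)
    moreover have "d \<le> cmod (lam e - z)" if e: "e \<in> eigenbasis" for e
    proof (cases "e \<in> B")
      case True
      then show ?thesis unfolding d_def using fin by (intro Min_le) auto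
    next
      case False
      have "d \<le> 1" unfolding d_def using fin by (intro Min_le) auto
      also have "1 \<le> cmod (lam e - z)"
        using False e norm_triangle_ineq2[of "complex_of_real (lam e)" z] by (simp add: B_def)
      finally show ?thesis .
    qed
    ultimately show thesis by (rule that)
  qed
  have coef: "ip H e (f x) = (lam e - z) * ip H e x" if "e \<in> eigenbasis" "x \<in> X" for e x
    using that by (simp add: f_def ip_eigenbasis_op algebra_simps)
  have fC: "f x \<in> carrier H" if "x \<in> X" for x using that by (simp add: f_def)
  have lower: "d * nrm x \<le> nrm (f x)" if x: "x \<in> X" for x
  proof (rule power2_le_imp_le)
    show "(d * nrm x)\<^sup>2 \<le> (nrm (f x))\<^sup>2"
    proof (rule has_sum_mono)
      show "((\<lambda>e. d\<^sup>2 * (cmod (ip H e x))\<^sup>2) has_sum (d * nrm x)\<^sup>2) eigenbasis"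
        using x by (simp add: power_mult_distrib) (intro has_sum_cmult_right eigenbasis_Parseval_nrm, simp)
      show "((\<lambda>e. (cmod (ip H e (f x)))\<^sup>2) has_sum (nrm (f x))\<^sup>2) eigenbasis"
        using fC[OF x] by (rule eigenbasis_Parseval_nrm)
      fix e assume e: "e \<in> eigenbasis"
      then show "d\<^sup>2 * (cmod (ip H e x))\<^sup>2 \<le> (cmod (ip H e (f x)))\<^sup>2"
        using d(1) d(2)[OF e] x
        by (simp add: coef norm_mult power_mult_distrib mult_right_mono power_mono)
    qed
  qed simp
  have "inj_on f X"
  proof (rule inj_onI)
    fix x y assume xy: "x \<in> X" "y \<in> X" "f x = f y"
    show "x = y"
    proof (rule eigenbasis_eqI)
      fix e assume e: "e \<in> eigenbasis"
      then have "(lam e - z) * ip H e x = (lam e - z) * ip H e y" "lam e \<noteq> z"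
        using coef[of e x] coef[of e y] xy z by auto
      then show "ip H e x = ip H e y" by simp
    qed (use xy in auto)
  qed
  moreover have "f ` X = carrier H"
  proof
    show "f ` X \<subseteq> carrier H" using fC by auto
    show "carrier H \<subseteq> f ` X"
    proof
      fix y assume y: "y \<in> carrier H"
      have "cmod (1 / (lam e - z)) \<le> 1 / d" if "e \<in> eigenbasis" for e
        using d(1) d(2)[OF that] by (simp add: norm_divide frac_le)
      then obtain x where x: "x \<in> carrier H"
          "\<And>e. e \<in> eigenbasis \<Longrightarrow> ip H e x = 1 / (lam e - z) * ip H e y"
        using diagonal_exists[of "\<lambda>e. 1 / (lam e - z)" "1 / d" y] y by blast
      have ne: "complex_of_real (lam e) \<noteq> z" if "e \<in> eigenbasis" for e using z that by auto
      have "ip H e (y \<oplus>\<^bsub>H\<^esub> z \<odot>\<^bsub>H\<^esub> x) = lam e * ip H e x" if "e \<in> eigenbasis" for e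
        using that x y ne[OF that] by (simp add: field_simps)
      then have X: "x \<in> X" "D x = y \<oplus>\<^bsub>H\<^esub> z \<odot>\<^bsub>H\<^esub> x"
        using op_domI[of x "y \<oplus>\<^bsub>H\<^esub> z \<odot>\<^bsub>H\<^esub> x"] x(1) y by simp_all
      have "f x = y"
        by (rule ip_eqI) (use X x(1) y in \<open>simp_all add: f_def\<close>)
      then show "y \<in> f ` X" using X by blast
    qed
  qed
  ultimately have "bij_betw f X (carrier H)" by (simp add: bij_betw_def)
  moreover have "nrm x \<le> (1 / d) * nrm (f x)" if "x \<in> X" for x
    using lower[OF that] d(1) by (simp add: field_simps)
  ultimately show ?thesis unfolding resolvent_set_def f_def by blast
qed

lemma spectrum_eq: "- resolvent_set H X D = complex_of_real ` lam ` eigenbasis"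
  using resolvent_setI eigenvalue_not_in_resolvent_set by blast

lemma eigenspace_dim:
  fixes r :: real
  defines "E \<equiv> {\<xi> \<in> X. D \<xi> = complex_of_real r \<odot>\<^bsub>H\<^esub> \<xi>}"
  shows "vectorspace.fin_dim complex_cstar (H\<lparr>carrier := E\<rparr>)"
    and "vectorspace.dim complex_cstar (H\<lparr>carrier := E\<rparr>) = card {e \<in> eigenbasis. lam e = r}"
proof -
  define F where "F = {e \<in> eigenbasis. lam e = r}"
  have finF: "finite F"
    by (rule finite_subset[OF _ finite_eigenbasis_bounded[of "\<bar>r\<bar>"]]) (auto simp: F_def)
  have FE: "F \<subseteq> E" by (auto simp: F_def E_def op_eigenbasis)
  have EC: "E \<subseteq> carrier H" by (auto simp: E_def)
  have sub: "submodule complex_cstar E H"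
  proof (unfold_locales)
    show "E \<subseteq> carrier H" by (rule EC)
  next
    fix v w assume "v \<in> E" "w \<in> E"
    then show "v \<oplus>\<^bsub>H\<^esub> w \<in> E" by (auto simp: E_def intro!: ip_eqI simp: algebra_simps)
  next
    show "\<zero>\<^bsub>H\<^esub> \<in> E" by (auto simp: E_def intro!: ip_eqI)
  next
    fix c v assume "v \<in> E"
    then show "c \<odot>\<^bsub>H\<^esub> v \<in> E" by (auto simp: E_def intro!: ip_eqI)
  qed
  interpret V: vectorspace complex_cstar "H\<lparr>carrier := E\<rparr>"
  proof (rule vectorspace.intro)
    show "module complex_cstar (H\<lparr>carrier := E\<rparr>)" by (rule M.submodule_is_module[OF sub])
    show "field complex_cstar" by (rule field_complex_cstar) unfold_locales
  qed
  have ind: "\<not> M.lin_dep F"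
  proof (rule M.finite_lin_indpt2[OF finF])
    show "F \<subseteq> carrier H" using FE EC by blast
    fix a :: "'h \<Rightarrow> complex" assume 0: "M.lincomb a F = \<zero>\<^bsub>H\<^esub>"
    have "a v = 0" if "v \<in> F" for v
      using ip_orthonormal_lincomb[OF eigenbasis(1) finF, of v a] that 0 by (auto simp: F_def)
    then show "\<forall>v\<in>F. a v = \<zero>\<^bsub>complex_cstar\<^esub>" by simp
  qed
  have span: "M.span F = E"
  proof
    show "M.span F \<subseteq> E" by (rule M.span_is_subset[OF FE sub])
    show "E \<subseteq> M.span F"
    proof
      fix x assume x: "x \<in> E"
      have "x = M.lincomb (\<lambda>e. ip H e x) F"
      proof (rule eigenbasis_eqI)
        fix e assume e: "e \<in> eigenbasis"
        have "lam e * ip H e x = r * ip H e x"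
          using ip_eigenbasis_op[OF e, of x] x e by (auto simp: E_def)
        then have "ip H e x = 0" if "lam e \<noteq> r" using that by simp
        then show "ip H e x = ip H e (M.lincomb (\<lambda>e. ip H e x) F)"
          using ip_orthonormal_lincomb[OF eigenbasis(1) finF _ e, of "\<lambda>e. ip H e x"] e
          by (auto simp: F_def)
      qed (use x FE EC in auto)
      then show "x \<in> M.span F"
        using M.finite_span[OF finF] FE EC by (auto simp: Pi_def)
    qed
  qed
  have basis: "V.basis F"
    using M.span_li_not_depend[OF FE sub] ind span FE by (simp add: V.basis_def)
  show "V.fin_dim" using basis finF by (auto simp: V.fin_dim_def V.basis_def)
  show "V.dim = card {e \<in> eigenbasis. lam e = r}"
    using V.dim_basis[OF finF basis] by (simp add: F_def)
qed

end

section \<open>Eigenvalue data of a spectral triple\<close>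

definition basis :: "('a, 'h) spectral_triple \<Rightarrow> 'h set" where
  "basis T = spectral_op.eigenbasis (st_hilb T) (st_dom T) (st_op T)"

definition eigval :: "('a, 'h) spectral_triple \<Rightarrow> 'h \<Rightarrow> real" where
  "eigval T = spectral_op.lam (st_hilb T) (st_op T)"

lemma spectral_op_triple:
  "is_spectral_triple T \<Longrightarrow> spectral_op (st_hilb T) (st_dom T) (st_op T)"
  by (simp add: is_spectral_triple_def spectral_op_def hilbert_def spectral_op_axioms_def)

text \<open>Its size counts the eigenvalues in [-R, R] with multiplicity, and its image under
  \<open>eigval T\<close> is the spectrum there. Both claims of the theorem become claims about
  these finite sets.\<close>

definition below :: "('a, 'h) spectral_triple \<Rightarrow> real \<Rightarrow> 'h set" where
  "below T R = {e \<in> basis T. \<bar>eigval T e\<bar> \<le> R}"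

context
  fixes T :: "('a, 'h) spectral_triple"
  assumes T: "is_spectral_triple T"
begin

interpretation spectral_op "st_hilb T" "st_dom T" "st_op T"
  by (rule spectral_op_triple[OF T])

lemma finite_below: "finite (below T R)"
  unfolding below_def basis_def eigval_def by (rule finite_eigenbasis_bounded)

lemma Sp_eq: "Sp T = complex_of_real ` eigval T ` basis T"
  unfolding Sp_def basis_def eigval_def by (rule spectrum_eq)

lemma Sp_in_eq: "Sp_in T R = complex_of_real ` eigval T ` below T R"
  unfolding Sp_in_def Sp_eq below_def by (auto simp: abs_le_iff)

lemma eig_multiplicity_eq:
  "eig_multiplicity (complex_of_real r) T = enat (card {e \<in> basis T. eigval T e = r})"
  unfolding eig_multiplicity_def eigenspace_def basis_def eigval_def Let_def
  using eigenspace_dim[of r] by simp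

lemma sum_multiplicity_eq:
  "(\<Sum>\<^sub>\<infinity>z\<in>Sp_in T R. eig_multiplicity z T) = enat (card (below T R))"
proof -
  let ?B = "below T R"
  have "(\<Sum>\<^sub>\<infinity>z\<in>Sp_in T R. eig_multiplicity z T)
      = (\<Sum>z\<in>complex_of_real ` eigval T ` ?B. eig_multiplicity z T)"
    unfolding Sp_in_eq by (rule infsum_finite) (simp add: finite_below)
  also have "\<dots> = (\<Sum>r\<in>eigval T ` ?B. enat (card {e \<in> basis T. eigval T e = r}))"
    by (subst sum.reindex) (auto simp: inj_on_def eig_multiplicity_eq)
  also have "\<dots> = (\<Sum>r\<in>eigval T ` ?B. of_nat (card {e \<in> ?B. eigval T e = r}))"
  proof (rule sum.cong)
    fix r assume "r \<in> eigval T ` ?B"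
    then have "{e \<in> basis T. eigval T e = r} = {e \<in> ?B. eigval T e = r}" by (auto simp: below_def)
    then show "enat (card {e \<in> basis T. eigval T e = r}) = of_nat (card {e \<in> ?B. eigval T e = r})"
      by (simp add: of_nat_eq_enat)
  qed simp
  also have "\<dots> = of_nat (\<Sum>r\<in>eigval T ` ?B. card {e \<in> ?B. eigval T e = r})" by simp
  also have "(\<Sum>r\<in>eigval T ` ?B. card {e \<in> ?B. eigval T e = r}) = card ?B"
    using sum.image_gen[OF finite_below, of "\<lambda>_. 1::nat" R "eigval T"] by simp
  finally show ?thesis by (simp add: of_nat_eq_enat)
qed

end

section \<open>Almost orthonormal almost eigenvectors\<close>

text \<open>On the squared chord u, doubling the angle acts as the logistic map u -> u (4 - u),
  whose growth factor is at least 3 while u < 1.\<close>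

lemma cmod_cis_double:
  "(cmod (cis (2 * a) - 1))\<^sup>2 = (cmod (cis a - 1))\<^sup>2 * (4 - (cmod (cis a - 1))\<^sup>2)"
proof -
  have "(sin a)\<^sup>2 = 4 * (sin (a / 2))\<^sup>2 * (1 - (sin (a / 2))\<^sup>2)"
    using sin_double[of "a / 2"] by (simp add: power_mult_distrib cos_squared_eq)
  then show ?thesis by (simp add: cmod_cis_diff algebra_simps)
qed

lemma cmod_cis_double_power:
  assumes "\<And>j. j \<le> n \<Longrightarrow> (cmod (cis (2 ^ j * a) - 1))\<^sup>2 < 1"
  shows "3 ^ n * (cmod (cis a - 1))\<^sup>2 \<le> (cmod (cis (2 ^ n * a) - 1))\<^sup>2"
  using assms
proof (induction n)
  case (Suc n)
  let ?u = "(cmod (cis (2 ^ n * a) - 1))\<^sup>2"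
  have "3 ^ Suc n * (cmod (cis a - 1))\<^sup>2 \<le> 3 * ?u" using Suc by simp
  also have "\<dots> \<le> (4 - ?u) * ?u"
    using Suc.prems[of n] by (intro mult_right_mono) auto
  also have "\<dots> = (cmod (cis (2 ^ Suc n * a) - 1))\<^sup>2"
    using cmod_cis_double[of "2 ^ n * a"] by (simp add: mult_ac)
  finally show ?case .
qed simp

text \<open>Sine stays above half its argument on [0, 1], because cosine is at least 1/2 up to
  \<pi>/3, which exceeds 1.\<close>

lemma cmod_cis_diff_ge:
  assumes "\<bar>a\<bar> \<le> 1"
  shows "a\<^sup>2 / 4 \<le> (cmod (cis a - 1))\<^sup>2"
proof -
  define x where "x = \<bar>a\<bar> / 2"
  have x: "0 \<le> x" "x \<le> 1" using assms by (auto simp: x_def)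
  have "x / 2 \<le> sin x"
  proof (cases "x = 0")
    case False
    then have "0 < x" using x by simp
    then obtain z where z: "0 < z" "z < x" "sin x - sin 0 = (x - 0) * cos z"
      using MVT2[of 0 x sin cos] DERIV_sin by blast
    have "cos (pi / 3) \<le> cos z"
      using z x pi_gt3 by (intro cos_monotone_0_pi_le) auto
    then have "1 / 2 \<le> cos z" by (simp add: cos_60)
    then have "x * (1 / 2) \<le> x * cos z" using x by (intro mult_left_mono) auto
    then show ?thesis using z by simp
  qed simp
  then have "(x / 2)\<^sup>2 \<le> (sin x)\<^sup>2" using x by (intro power_mono) auto
  moreover have "(sin x)\<^sup>2 = (sin (a / 2))\<^sup>2" by (cases "0 \<le> a") (auto simp: x_def)
  ultimately show ?thesis by (simp add: cmod_cis_diff x_def power_divide)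
qed

text \<open>At time 1/Q the angle y/Q lies between \<delta>/Q and 1 in absolute value, so its
  squared chord is bounded below and repeated doubling lifts it to 1. One \<open>J\<close> serves
  all offsets between \<delta> and \<open>Q\<close>.\<close>

lemma cis_escape:
  assumes "0 < \<delta>" "0 < Q"
  obtains J :: nat where
    "\<And>y. \<delta> \<le> \<bar>y\<bar> \<Longrightarrow> \<bar>y\<bar> \<le> Q \<Longrightarrow> \<exists>j\<le>J. 1 \<le> (cmod (cis (2 ^ j / Q * y) - 1))\<^sup>2"
proof -
  \<comment> \<open>The squared chord at time 1/Q is at least (\<delta>/Q)^2 / 4; tripling it
    \<open>J\<close> times would exceed 1.\<close>
  obtain J where J: "4 * (Q / \<delta>)\<^sup>2 < 3 ^ J"
    using real_arch_pow[of 3 "4 * (Q / \<delta>)\<^sup>2"] by auto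
  have "\<exists>j\<le>J. 1 \<le> (cmod (cis (2 ^ j / Q * y) - 1))\<^sup>2" if y: "\<delta> \<le> \<bar>y\<bar>" "\<bar>y\<bar> \<le> Q" for y
  proof (rule ccontr)
    assume neg: "\<not> ?thesis"
    have lt: "(cmod (cis (2 ^ j * (y / Q)) - 1))\<^sup>2 < 1" if j: "j \<le> J" for j
    proof -
      have "\<not> 1 \<le> (cmod (cis (2 ^ j / Q * y) - 1))\<^sup>2" using neg j by blast
      then show ?thesis by simp
    qed
    have "(\<delta> / Q)\<^sup>2 \<le> (y / Q)\<^sup>2"
      by (rule abs_le_square_iff[THEN iffD1])
        (use y assms in \<open>simp add: abs_divide divide_right_mono\<close>)
    moreover have "(y / Q)\<^sup>2 / 4 \<le> (cmod (cis (y / Q) - 1))\<^sup>2"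
      using y assms by (intro cmod_cis_diff_ge) (simp add: abs_divide)
    ultimately have "(\<delta> / Q)\<^sup>2 / 4 \<le> (cmod (cis (y / Q) - 1))\<^sup>2" by linarith
    then have "3 ^ J * ((\<delta> / Q)\<^sup>2 / 4) \<le> 3 ^ J * (cmod (cis (y / Q) - 1))\<^sup>2"
      by (intro mult_left_mono) auto
    also have "\<dots> \<le> (cmod (cis (2 ^ J * (y / Q)) - 1))\<^sup>2" by (rule cmod_cis_double_power[OF lt])
    also have "\<dots> < 1" by (rule lt) simp
    finally have "3 ^ J * ((\<delta> / Q)\<^sup>2 / 4) < 1" .
    then have "3 ^ J < 4 * (Q / \<delta>)\<^sup>2" using assms by (simp add: field_simps)
    then show False using J by simp
  qed
  then show thesis by (rule that)
qed

lemma has_sum_sum_finite: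
  fixes f :: "'i \<Rightarrow> 'e \<Rightarrow> real"
  assumes "finite A" "\<And>i. i \<in> A \<Longrightarrow> (f i has_sum s i) S"
  shows "((\<lambda>e. \<Sum>i\<in>A. f i e) has_sum (\<Sum>i\<in>A. s i)) S"
  using assms by (induction rule: finite_induct) (auto intro: has_sum_add)

context hilbert
begin

text \<open>The Boas--Bellman form of Bessel's inequality.\<close>
lemma almost_orthonormal_Bessel:
  fixes C \<eta> :: real
  assumes F: "finite F" and x: "\<And>i. i \<in> F \<Longrightarrow> x i \<in> carrier H"
    and gram: "\<And>i j. i \<in> F \<Longrightarrow> j \<in> F \<Longrightarrow> cmod (ip H (x i) (x j)) \<le> (if i = j then C else 0) + \<eta>"
    and nonneg: "0 \<le> C" "0 \<le> \<eta>" and f: "f \<in> carrier H" "nrm f = 1"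
  shows "(\<Sum>i\<in>F. (cmod (ip H f (x i)))\<^sup>2) \<le> C + card F * \<eta>"
proof -
  define a where "a i = ip H (x i) f" for i
  define s where "s = (\<Sum>i\<in>F. (cmod (a i))\<^sup>2)"
  have fx: "ip H f (x i) = cnj (a i)" if "i \<in> F" for i
    using that x f by (simp add: a_def cnj_ip)
  have s0: "0 \<le> s" by (simp add: s_def sum_nonneg)
  \<comment> \<open>The dual test vector: pairing it with \<open>f\<close> returns \<open>s\<close>,
    so \<open>s\<close> is at most its norm, while the Gram bounds limit its squared norm to s (C +
    |F| \<eta>). Cancelling \<open>s\<close> gives the claim.\<close>
  obtain y where y: "y \<in> carrier H"
      "\<And>z. z \<in> carrier H \<Longrightarrow> ip H z y = (\<Sum>i\<in>F. a i * ip H z (x i))"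
    by (rule finite_combination[OF F x, where a = a]) blast+
  have "ip H f y = (\<Sum>i\<in>F. complex_of_real ((cmod (a i))\<^sup>2))"
    using y(2)[OF f(1)] by (simp add: fx cnj_mult_self cong: sum.cong)
  then have "ip H f y = complex_of_real s" by (simp add: s_def)
  then have "s = cmod (ip H f y)" using s0 by simp
  also have "\<dots> \<le> nrm y" using Cauchy_Schwarz[OF f(1) y(1)] f by simp
  finally have sy: "s \<le> nrm y" .
  have "(nrm y)\<^sup>2 = cmod (ip H y y)" using y(1) by (simp add: ip_self norm_power)
  also have "ip H y y = (\<Sum>i\<in>F. a i * cnj (\<Sum>j\<in>F. a j * ip H (x i) (x j)))"
    unfolding y(2)[OF y(1)]
  proof (rule sum.cong)
    fix i assume "i \<in> F"
    then show "a i * ip H y (x i) = a i * cnj (\<Sum>j\<in>F. a j * ip H (x i) (x j))"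
      using y(2)[OF x, of i] cnj_ip[OF x y(1), of i] by simp
  qed simp
  also have "cmod \<dots> \<le> (\<Sum>i\<in>F. cmod (a i) * (\<Sum>j\<in>F. cmod (a j) * ((if i = j then C else 0) + \<eta>)))"
  proof (rule sum_norm_le)
    fix i assume i: "i \<in> F"
    have "cmod (\<Sum>j\<in>F. a j * ip H (x i) (x j)) \<le> (\<Sum>j\<in>F. cmod (a j) * ((if i = j then C else 0) + \<eta>))"
      by (rule sum_norm_le, unfold norm_mult, rule mult_left_mono[OF gram[OF i]]) auto
    then show "cmod (a i * cnj (\<Sum>j\<in>F. a j * ip H (x i) (x j)))
        \<le> cmod (a i) * (\<Sum>j\<in>F. cmod (a j) * ((if i = j then C else 0) + \<eta>))"
      by (simp only: norm_mult complex_mod_cnj) (intro mult_left_mono, auto)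
  qed
  also have "\<dots> = (\<Sum>i\<in>F. cmod (a i) * (C * cmod (a i) + \<eta> * (\<Sum>j\<in>F. cmod (a j))))"
  proof (rule sum.cong)
    fix i assume i: "i \<in> F"
    have "(\<Sum>j\<in>F. cmod (a j) * ((if i = j then C else 0) + \<eta>))
        = (\<Sum>j\<in>F. (if j = i then C * cmod (a i) else 0) + \<eta> * cmod (a j))"
      by (rule sum.cong) (auto simp: algebra_simps)
    also have "\<dots> = C * cmod (a i) + \<eta> * (\<Sum>j\<in>F. cmod (a j))"
      using F i by (simp add: sum.distrib sum_distrib_left)
    finally show "cmod (a i) * (\<Sum>j\<in>F. cmod (a j) * ((if i = j then C else 0) + \<eta>))
        = cmod (a i) * (C * cmod (a i) + \<eta> * (\<Sum>j\<in>F. cmod (a j)))" by simp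
  qed simp
  also have "\<dots> = C * s + \<eta> * (\<Sum>i\<in>F. cmod (a i))\<^sup>2"
  proof -
    have "(\<Sum>i\<in>F. cmod (a i) * (C * cmod (a i) + \<eta> * (\<Sum>j\<in>F. cmod (a j))))
        = (\<Sum>i\<in>F. C * (cmod (a i))\<^sup>2 + cmod (a i) * (\<eta> * (\<Sum>j\<in>F. cmod (a j))))"
      by (rule sum.cong) (auto simp: power2_eq_square algebra_simps)
    then show ?thesis
      by (simp add: sum.distrib s_def power2_eq_square sum_distrib_left[symmetric]
          sum_distrib_right[symmetric])
  qed
  also have "\<dots> \<le> C * s + \<eta> * (s * card F)"
    unfolding s_def using nonneg
    by (intro add_left_mono mult_left_mono sum_squared_le_sum_of_squares) auto
  finally have "(nrm y)\<^sup>2 \<le> s * (C + card F * \<eta>)" by (simp add: algebra_simps)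
  moreover have "s\<^sup>2 \<le> (nrm y)\<^sup>2" using sy s0 by (intro power_mono)
  ultimately have "s * s \<le> s * (C + card F * \<eta>)" by (simp add: power2_eq_square)
  then have "s \<le> C + card F * \<eta>"
    using s0 nonneg by (cases "s = 0") (auto simp: mult_le_cancel_left)
  moreover have "s = (\<Sum>i\<in>F. (cmod (ip H f (x i)))\<^sup>2)"
    unfolding s_def by (rule sum.cong) (simp_all add: fx)
  ultimately show ?thesis by simp
qed

end

section \<open>Spectral mass of almost eigenvectors\<close>

context spectral_op
begin

text \<open>The squared norm of exp(itD) x - exp(it\<mu>) x, computed once by Parseval and once by
  expanding the inner product and using unitarity.\<close>

lemma orbit_spectral_sum:
  assumes x: "x \<in> carrier H"
  shows "((\<lambda>e. (cmod (cis (t * (lam e - \<mu>)) - 1))\<^sup>2 * (cmod (ip H e x))\<^sup>2) has_sum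
      2 * (nrm x)\<^sup>2 - 2 * Re (cis (t * \<mu>) * ip H (expD t x) x)) eigenbasis"
proof -
  let ?y = "expD t x \<ominus>\<^bsub>H\<^esub> cis (t * \<mu>) \<odot>\<^bsub>H\<^esub> x"
  have eq: "(cmod (ip H e ?y))\<^sup>2 = (cmod (cis (t * (lam e - \<mu>)) - 1))\<^sup>2 * (cmod (ip H e x))\<^sup>2"
    if e: "e \<in> eigenbasis" for e
  proof -
    have "ip H e ?y = cis (t * \<mu>) * ((cis (t * (lam e - \<mu>)) - 1) * ip H e x)"
      using e x by (simp add: ip_expD algebra_simps cis_mult)
    then show ?thesis by (simp only: norm_mult norm_cis mult_1_left power_mult_distrib)
  qed
  have sum: "((\<lambda>e. (cmod (ip H e ?y))\<^sup>2) has_sum (nrm ?y)\<^sup>2) eigenbasis"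
    using x by (intro eigenbasis_Parseval_nrm) auto
  have nrm: "(nrm ?y)\<^sup>2 = 2 * (nrm x)\<^sup>2 - 2 * Re (cis (t * \<mu>) * ip H (expD t x) x)"
  proof -
    have "nrm (expD t x) = nrm x"
      using ip_expD_expD[OF x x, of t] by (simp add: hnorm_def)
    then show ?thesis using x by (simp add: nrm_diff_sq)
  qed
  show ?thesis using sum unfolding nrm by (simp only: eq cong: has_sum_cong)
qed

text \<open>Every coefficient of \<open>x\<close> is dominated in one of three ways: by itself if
  its eigenvalue is near \<mu>; by an orbit term of weight at least 1 at some test time if the
  offset is at most \<open>Q\<close>; otherwise, Chebyshev's way, by the coefficient of
  \<open>D x\<close> over Q - R, since the eigenvalue then has size at least Q - R.\<close>

lemma spectral_mass_near:
  assumes x: "x \<in> X" "nrm (D x) \<le> 1" and \<mu>: "\<bar>\<mu>\<bar> \<le> R" and RQ: "R < Q" and \<delta>: "0 < \<delta>"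
    and J: "\<And>y. \<delta> \<le> \<bar>y\<bar> \<Longrightarrow> \<bar>y\<bar> \<le> Q \<Longrightarrow> \<exists>j\<le>J. 1 \<le> (cmod (cis (2 ^ j / Q * y) - 1))\<^sup>2"
    and orbit: "\<And>j. j \<le> J \<Longrightarrow>
      2 * (nrm x)\<^sup>2 - 2 * Re (cis (2 ^ j / Q * \<mu>) * ip H (expD (2 ^ j / Q) x) x) \<le> \<kappa>"
  shows "(nrm x)\<^sup>2 \<le> (\<Sum>e\<in>{e \<in> eigenbasis. \<bar>lam e - \<mu>\<bar> < \<delta>}. (cmod (ip H e x))\<^sup>2)
      + real (Suc J) * \<kappa> + 1 / (Q - R)\<^sup>2"
proof -
  define N where "N = {e \<in> eigenbasis. \<bar>lam e - \<mu>\<bar> < \<delta>}"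
  define k where "k j = 2 * (nrm x)\<^sup>2 - 2 * Re (cis (2 ^ j / Q * \<mu>) * ip H (expD (2 ^ j / Q) x) x)" for j :: nat
  define a where "a e = (cmod (ip H e x))\<^sup>2" for e
  define g where "g j e = (cmod (cis (2 ^ j / Q * (lam e - \<mu>)) - 1))\<^sup>2 * a e" for j :: nat and e
  have a0: "0 \<le> a e" for e by (simp add: a_def)
  have g0: "0 \<le> g j e" for j e by (simp add: g_def a_def)
  have finN: "finite N"
    by (rule finite_subset[OF _ finite_eigenbasis_bounded[of "R + \<delta>"]]) (use \<mu> in \<open>auto simp: N_def\<close>)
  have 1: "((\<lambda>e. if e \<in> N then a e else 0) has_sum (\<Sum>e\<in>N. a e)) eigenbasis"
    by (rule has_sum_cong_neutral[THEN iffD1, OF _ _ _ has_sum_finite[OF finN]]) (auto simp: N_def)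
  have 2: "((\<lambda>e. \<Sum>j\<le>J. g j e) has_sum (\<Sum>j\<le>J. k j)) eigenbasis"
    unfolding g_def k_def a_def using x by (intro has_sum_sum_finite orbit_spectral_sum) auto
  have 3: "((\<lambda>e. (cmod (ip H e (D x)))\<^sup>2 * (1 / (Q - R)\<^sup>2)) has_sum
      (nrm (D x))\<^sup>2 * (1 / (Q - R)\<^sup>2)) eigenbasis"
    using x by (intro has_sum_cmult_left eigenbasis_Parseval_nrm) auto
  have "(nrm x)\<^sup>2 \<le> (\<Sum>e\<in>N. a e) + ((\<Sum>j\<le>J. k j) + (nrm (D x))\<^sup>2 * (1 / (Q - R)\<^sup>2))"
  proof (rule has_sum_mono)
    show "(a has_sum (nrm x)\<^sup>2) eigenbasis"
      unfolding a_def using x by (intro eigenbasis_Parseval_nrm) auto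
    show "((\<lambda>e. (if e \<in> N then a e else 0) + ((\<Sum>j\<le>J. g j e)
        + (cmod (ip H e (D x)))\<^sup>2 * (1 / (Q - R)\<^sup>2))) has_sum
        (\<Sum>e\<in>N. a e) + ((\<Sum>j\<le>J. k j) + (nrm (D x))\<^sup>2 * (1 / (Q - R)\<^sup>2))) eigenbasis"
      by (intro has_sum_add 1 2 3)
    fix e assume e: "e \<in> eigenbasis"
    have s0: "0 \<le> (\<Sum>j\<le>J. g j e)" by (intro sum_nonneg g0)
    have t0: "0 \<le> (cmod (ip H e (D x)))\<^sup>2 * (1 / (Q - R)\<^sup>2)" by simp
    consider "e \<in> N" | "e \<notin> N" "\<bar>lam e - \<mu>\<bar> \<le> Q" | "Q < \<bar>lam e - \<mu>\<bar>" by linarith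
    then show "a e \<le> (if e \<in> N then a e else 0) + ((\<Sum>j\<le>J. g j e)
        + (cmod (ip H e (D x)))\<^sup>2 * (1 / (Q - R)\<^sup>2))"
    proof cases
      case 1
      then show ?thesis using s0 t0 by simp
    next
      case 2
      then have "\<delta> \<le> \<bar>lam e - \<mu>\<bar>" using e by (auto simp: N_def)
      then obtain j where j: "j \<le> J" "1 \<le> (cmod (cis (2 ^ j / Q * (lam e - \<mu>)) - 1))\<^sup>2"
        using J 2 by blast
      have "a e \<le> g j e" unfolding g_def using mult_right_mono[OF j(2) a0[of e]] by simp
      also have "\<dots> \<le> (\<Sum>j\<le>J. g j e)" using j(1) g0 by (intro member_le_sum) auto
      finally show ?thesis using t0 2(1) by (simp only: if_False)
    next
      case 3
      then have "Q - R \<le> \<bar>lam e\<bar>" using \<mu> by linarith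
      then have "(Q - R)\<^sup>2 \<le> \<bar>lam e\<bar>\<^sup>2" using RQ by (intro power_mono) auto
      then have "1 \<le> (lam e)\<^sup>2 * (1 / (Q - R)\<^sup>2)" using RQ by (simp add: field_simps)
      then have "1 * a e \<le> (lam e)\<^sup>2 * (1 / (Q - R)\<^sup>2) * a e" by (intro mult_right_mono a0)
      also have "\<dots> = (cmod (ip H e (D x)))\<^sup>2 * (1 / (Q - R)\<^sup>2)"
        using e x by (simp add: a_def ip_eigenbasis_op norm_mult power_mult_distrib)
      finally show ?thesis using s0 a0[of e] by simp
    qed
  qed
  also have "(\<Sum>j\<le>J. k j) \<le> (\<Sum>j\<le>J. \<kappa>)" using orbit by (intro sum_mono) (auto simp: k_def)
  also have "(nrm (D x))\<^sup>2 * (1 / (Q - R)\<^sup>2) \<le> 1 * (1 / (Q - R)\<^sup>2)"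
    using x by (intro mult_right_mono power_le_one) auto
  finally show ?thesis by (simp add: N_def a_def algebra_simps)
qed

text \<open>Sum the squared coefficients over \<open>F\<close> and over the nearby basis vectors in
  two orders. Each \<open>x i\<close> puts almost \<open>C\<close> on these vectors, and each of
  them receives hardly more than \<open>C\<close> in total, by
  \<open>almost_orthonormal_Bessel\<close>. With fewer basis vectors than elements of
  \<open>F\<close>, a whole \<open>C\<close> would be missing, more than the errors collected in
  \<open>small\<close>.\<close>

lemma eigenvalue_count_lower_bound:
  fixes x :: "'i \<Rightarrow> 'h" and C \<eta> R Q \<delta> :: real
  assumes F: "finite F" and x: "\<And>i. i \<in> F \<Longrightarrow> x i \<in> X" "\<And>i. i \<in> F \<Longrightarrow> nrm (D (x i)) \<le> 1"
    and \<mu>: "\<And>i. i \<in> F \<Longrightarrow> \<bar>\<mu> i\<bar> \<le> R" and RQ: "0 \<le> R" "R < Q" and \<delta>: "0 < \<delta>"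
    and J: "\<And>y. \<delta> \<le> \<bar>y\<bar> \<Longrightarrow> \<bar>y\<bar> \<le> Q \<Longrightarrow> \<exists>j\<le>J. 1 \<le> (cmod (cis (2 ^ j / Q * y) - 1))\<^sup>2"
    and \<eta>: "0 \<le> \<eta>" and C: "0 \<le> C"
    and gram: "\<And>i j. i \<in> F \<Longrightarrow> j \<in> F \<Longrightarrow>
      cmod (ip H (x i) (x j) - (if i = j then of_real C else 0)) \<le> \<eta>"
    and orbit: "\<And>i j. i \<in> F \<Longrightarrow> j \<le> J \<Longrightarrow>
      cmod (ip H (expD (2 ^ j / Q) (x i)) (x i) - cis (- (2 ^ j / Q * \<mu> i)) * of_real C) \<le> \<eta>"
    and small: "card F * (\<eta> + (real (Suc J) * (4 * \<eta>) + 1 / (Q - R)\<^sup>2)) + (card F)\<^sup>2 * \<eta> < C"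
  shows "card F \<le> card {e \<in> eigenbasis. \<exists>i\<in>F. \<bar>lam e - \<mu> i\<bar> < \<delta>}"
proof (rule ccontr)
  define G where "G = {e \<in> eigenbasis. \<exists>i\<in>F. \<bar>lam e - \<mu> i\<bar> < \<delta>}"
  define N where "N i = {e \<in> eigenbasis. \<bar>lam e - \<mu> i\<bar> < \<delta>}" for i
  define \<kappa> where "\<kappa> = real (Suc J) * (4 * \<eta>) + 1 / (Q - R)\<^sup>2"
  assume "\<not> card F \<le> card {e \<in> eigenbasis. \<exists>i\<in>F. \<bar>lam e - \<mu> i\<bar> < \<delta>}"
  then have less: "card G + 1 \<le> card F" by (simp add: G_def)
  have finG: "finite G"
  proof (rule finite_subset[OF _ finite_eigenbasis_bounded[of "R + \<delta>"]])
    show "G \<subseteq> {e \<in> eigenbasis. \<bar>lam e\<bar> \<le> R + \<delta>}" using \<mu> by (fastforce simp: G_def)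
  qed
  have norm_x: "\<bar>(nrm (x i))\<^sup>2 - C\<bar> \<le> \<eta>" if i: "i \<in> F" for i
    using gram[OF i i] x(1)[OF i] by (simp add: ip_self flip: of_real_diff of_real_power)
  have mass: "C - \<eta> - \<kappa> \<le> (\<Sum>e\<in>G. (cmod (ip H e (x i)))\<^sup>2)" if i: "i \<in> F" for i
  proof -
    have "(nrm (x i))\<^sup>2 \<le> (\<Sum>e\<in>N i. (cmod (ip H e (x i)))\<^sup>2)
        + real (Suc J) * (4 * \<eta>) + 1 / (Q - R)\<^sup>2"
      unfolding N_def
    proof (rule spectral_mass_near[OF x(1,2)[OF i] \<mu>[OF i] RQ(2) \<delta> J])
      fix j assume j: "j \<le> J"
      define t where "t = 2 ^ j / Q"
      define z where "z = ip H (expD t (x i)) (x i) - cis (- (t * \<mu> i)) * of_real C"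
      have "cis (t * \<mu> i) * ip H (expD t (x i)) (x i) = of_real C + cis (t * \<mu> i) * z"
        by (simp add: z_def algebra_simps cis_mult flip: mult.assoc)
      moreover have "\<bar>Re (cis (t * \<mu> i) * z)\<bar> \<le> cmod z"
        using abs_Re_le_cmod[of "cis (t * \<mu> i) * z"] by (simp add: norm_mult)
      moreover have "cmod z \<le> \<eta>" using orbit[OF i j] by (simp add: z_def t_def)
      \<comment> \<open>Comparing the squared norm with \<open>C\<close> costs 2 \<eta>, and the
        orbit term costs another 2 \<eta>.\<close>
      ultimately show "2 * (nrm (x i))\<^sup>2 - 2 * Re (cis (2 ^ j / Q * \<mu> i) *
          ip H (expD (2 ^ j / Q) (x i)) (x i)) \<le> 4 * \<eta>"
        using norm_x[OF i] by (simp flip: t_def)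
    qed
    also have "(\<Sum>e\<in>N i. (cmod (ip H e (x i)))\<^sup>2) \<le> (\<Sum>e\<in>G. (cmod (ip H e (x i)))\<^sup>2)"
      using i finG by (intro sum_mono2) (auto simp: N_def G_def)
    finally show ?thesis using norm_x[OF i] by (simp add: \<kappa>_def)
  qed
  have bessel: "(\<Sum>i\<in>F. (cmod (ip H e (x i)))\<^sup>2) \<le> C + card F * \<eta>" if e: "e \<in> G" for e
  proof (rule almost_orthonormal_Bessel)
    show "finite F" "0 \<le> C" "0 \<le> \<eta>" by fact+
    show "x i \<in> carrier H" if "i \<in> F" for i using x(1)[OF that] by simp
    show "e \<in> carrier H" "nrm e = 1" using e by (auto simp: G_def nrm_eigenbasis)
    fix i j assume ij: "i \<in> F" "j \<in> F"
    show "cmod (ip H (x i) (x j)) \<le> (if i = j then C else 0) + \<eta>"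
      using gram[OF ij] C
        norm_triangle_ineq2[of "ip H (x i) (x j)" "if i = j then complex_of_real C else 0"]
      by (auto split: if_splits)
  qed
  have "card F * (C - \<eta> - \<kappa>) \<le> (\<Sum>i\<in>F. \<Sum>e\<in>G. (cmod (ip H e (x i)))\<^sup>2)"
    using sum_mono[of F "\<lambda>_. C - \<eta> - \<kappa>", OF mass] by simp
  also have "\<dots> = (\<Sum>e\<in>G. \<Sum>i\<in>F. (cmod (ip H e (x i)))\<^sup>2)" by (rule sum.swap)
  also have "\<dots> \<le> card G * (C + card F * \<eta>)"
    using sum_mono[of G _ "\<lambda>_. C + card F * \<eta>", OF bessel] by simp
  also have "\<dots> \<le> (real (card F) - 1) * (C + card F * \<eta>)"
    using less C \<eta> by (intro mult_right_mono) auto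
  finally have "C \<le> card F * (\<eta> + \<kappa>) + (card F)\<^sup>2 * \<eta> - card F * \<eta>"
    by (simp add: algebra_simps power2_eq_square)
  also have "\<dots> \<le> card F * (\<eta> + \<kappa>) + (card F)\<^sup>2 * \<eta>" using \<eta> by simp
  also have "\<dots> < C" using small by (simp add: \<kappa>_def)
  finally show False by simp
qed

end

section \<open>Transfer of eigenvalues\<close>

definition DN :: "('a, 'h) spectral_triple \<Rightarrow> 'h \<Rightarrow> real" where
  "DN T \<xi> = vnorm (st_hilb T) \<xi> + vnorm (st_hilb T) (st_op T \<xi>)"

text \<open>
  The relation that a tunnel induces between the balls of \<open>DN\<close>. Partners are only required for
  vectors in the open balls, which avoids having to attain the infima in the quantum isometries.
\<close>
definition correlated ::
  "('a, 'h) spectral_triple \<Rightarrow> ('b, 'k) spectral_triple \<Rightarrow> ('h \<times> 'k) set \<Rightarrow> real \<Rightarrow> real \<Rightarrow> bool"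
where
  "correlated S T G \<eta> b \<longleftrightarrow>
     (\<forall>x y. (x, y) \<in> G \<longrightarrow> x \<in> st_dom S \<and> DN S x \<le> 1 \<and> y \<in> st_dom T \<and> DN T y \<le> 1) \<and>
     (\<forall>x\<in>st_dom S. DN S x < 1 \<longrightarrow> (\<exists>y. (x, y) \<in> G)) \<and>
     (\<forall>y\<in>st_dom T. DN T y < 1 \<longrightarrow> (\<exists>x. (x, y) \<in> G)) \<and>
     (\<forall>x y x' y' t. (x, y) \<in> G \<longrightarrow> (x', y') \<in> G \<longrightarrow> 0 \<le> t \<longrightarrow> t \<le> b \<longrightarrow>
        cmod (ip (st_hilb S) (triple_exp S t x) x' - ip (st_hilb T) (triple_exp T t y) y') \<le> \<eta>)"

lemma correlated_converse:
  assumes "correlated S T G \<eta> b"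
  shows "correlated T S (G\<inverse>) \<eta> b"
proof -
  have "cmod (ip (st_hilb T) (triple_exp T t y) y' - ip (st_hilb S) (triple_exp S t x) x') \<le> \<eta>"
    if "(x, y) \<in> G" "(x', y') \<in> G" "0 \<le> t" "t \<le> b" for x y x' y' t
    using assms that unfolding correlated_def norm_minus_commute[of "ip (st_hilb T) _ _"] by blast
  then show ?thesis using assms unfolding correlated_def converse_iff by blast
qed

lemma correlated_mono:
  assumes "correlated S T G \<eta> b" "\<eta> \<le> \<eta>'" "b' \<le> b"
  shows "correlated S T G \<eta>' b'"
proof -
  have "cmod (ip (st_hilb S) (triple_exp S t x) x' - ip (st_hilb T) (triple_exp T t y) y') \<le> \<eta>'"
    if "(x, y) \<in> G" "(x', y') \<in> G" "0 \<le> t" "t \<le> b'" for x y x' y' t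
  proof -
    have "t \<le> b" using that(4) assms(3) by linarith
    then have "cmod (ip (st_hilb S) (triple_exp S t x) x' - ip (st_hilb T) (triple_exp T t y) y') \<le> \<eta>"
      using assms(1) that unfolding correlated_def by blast
    then show ?thesis using assms(2) by linarith
  qed
  then show ?thesis using assms(1) unfolding correlated_def by blast
qed

lemma eigenvalue_transfer_aux:
  fixes S :: "('a, 'h) spectral_triple" and T :: "('b, 'k) spectral_triple"
    and \<eta> R Q \<delta> :: real
  assumes S: "is_spectral_triple S" and T: "is_spectral_triple T"
    and corr: "correlated S T G \<eta> (2 ^ J / Q)"
    and F: "F \<subseteq> below T R" and RQ: "0 \<le> R" "R < Q" and \<delta>: "0 < \<delta>" and \<eta>: "0 \<le> \<eta>"
    and J: "\<And>y. \<delta> \<le> \<bar>y\<bar> \<Longrightarrow> \<bar>y\<bar> \<le> Q \<Longrightarrow> \<exists>j\<le>J. 1 \<le> (cmod (cis (2 ^ j / Q * y) - 1))\<^sup>2"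
    and small: "card F * (\<eta> + (real (Suc J) * (4 * \<eta>) + 1 / (Q - R)\<^sup>2)) + (card F)\<^sup>2 * \<eta>
      < (1 / (2 * (1 + R)))\<^sup>2"
  shows "card F \<le> card {f \<in> basis S. \<exists>e\<in>F. \<bar>eigval S f - eigval T e\<bar> < \<delta>}"
proof -
  interpret S: spectral_op "st_hilb S" "st_dom S" "st_op S" by (rule spectral_op_triple[OF S])
  interpret T: spectral_op "st_hilb T" "st_dom T" "st_op T" by (rule spectral_op_triple[OF T])
  \<comment> \<open>Makes \<open>DN T (y e)\<close> at most 1/2, inside the open ball where
    \<open>correlated\<close> supplies partners.\<close>
  define c where "c = 1 / (2 * (1 + R))"
  have c: "0 < c" "c * (1 + R) = 1 / 2" using RQ by (auto simp: c_def field_simps)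
  define y where "y e = complex_of_real c \<odot>\<^bsub>st_hilb T\<^esub> e" for e
  have e: "e \<in> T.eigenbasis" "\<bar>T.lam e\<bar> \<le> R" if "e \<in> F" for e
    using that F by (auto simp: below_def basis_def eigval_def)
  have yX: "y e \<in> st_dom T" if "e \<in> F" for e using e[OF that] by (simp add: y_def)
  have "DN T (y e) < 1" if "e \<in> F" for e
  proof -
    have "DN T (y e) = c * (1 + \<bar>T.lam e\<bar>)"
      using e[OF that] c by (simp add: DN_def y_def T.nrm_eigenbasis T.op_eigenbasis algebra_simps)
    also have "\<dots> \<le> c * (1 + R)" using e[OF that] c by (intro mult_left_mono) auto
    finally show ?thesis using c by simp
  qed
  then have "\<exists>x. (x, y e) \<in> G" if "e \<in> F" for e
    using corr yX[OF that] that unfolding correlated_def by blast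
  then obtain x where x: "\<And>e. e \<in> F \<Longrightarrow> (x e, y e) \<in> G" by metis
  have xX: "x e \<in> st_dom S" and DNx: "DN S (x e) \<le> 1" if "e \<in> F" for e
    using corr x[OF that] unfolding correlated_def by blast+
  have orbit: "cmod (ip (st_hilb S) (S.expD t (x e)) (x f) - ip (st_hilb T) (T.expD t (y e)) (y f)) \<le> \<eta>"
    if ef: "e \<in> F" "f \<in> F" and t: "0 \<le> t" "t \<le> 2 ^ J / Q" for e f t
  proof -
    have "cmod (ip (st_hilb S) (triple_exp S t (x e)) (x f)
        - ip (st_hilb T) (triple_exp T t (y e)) (y f)) \<le> \<eta>"
      using corr x[OF ef(1)] x[OF ef(2)] t unfolding correlated_def by blast
    then show ?thesis
      using xX[OF ef(1)] yX[OF ef(1)]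
      by (simp add: triple_exp_def S.exp_i_eq_expD T.exp_i_eq_expD)
  qed
  have ipT: "ip (st_hilb T) (T.expD t (y e)) (y f)
      = cis (- (t * T.lam e)) * (if e = f then of_real (c\<^sup>2) else 0)"
    if ef: "e \<in> F" "f \<in> F" for e f t
  proof -
    have *: "e \<in> T.eigenbasis" "f \<in> T.eigenbasis" using ef e by auto
    have "ip (st_hilb T) (T.expD t (y e)) f = cnj (ip (st_hilb T) f (T.expD t (y e)))"
      using * by (simp add: T.cnj_ip y_def)
    also have "\<dots> = cis (- (t * T.lam f)) * (c * (if e = f then 1 else 0))"
      using * by (simp add: T.ip_expD T.ip_eigenbasis y_def cis_cnj)
    finally show ?thesis using * by (simp add: y_def power2_eq_square)
  qed
  have "card F \<le> card {f \<in> S.eigenbasis. \<exists>e\<in>F. \<bar>S.lam f - T.lam e\<bar> < \<delta>}"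
  proof (rule S.eigenvalue_count_lower_bound[where x = x and C = "c\<^sup>2" and \<eta> = \<eta> and R = R and Q = Q and J = J])
    show "finite F" using F finite_below[OF T] finite_subset by blast
    show "vnorm (st_hilb S) (st_op S (x e)) \<le> 1" if "e \<in> F" for e
      using DNx[OF that] S.nrm_nonneg[of "x e"] unfolding DN_def by linarith
    \<comment> \<open>Time 0 of the orbit relation compares the Gram matrices themselves.\<close>
    show "cmod (ip (st_hilb S) (x e) (x f) - (if e = f then of_real (c\<^sup>2) else 0)) \<le> \<eta>"
      if ef: "e \<in> F" "f \<in> F" for e f
      using orbit[OF ef, of 0] ipT[OF ef, of 0] xX[OF ef(1)] RQ by (simp add: S.expD_0)
    show "cmod (ip (st_hilb S) (S.expD (2 ^ j / Q) (x e)) (x e)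
        - cis (- (2 ^ j / Q * T.lam e)) * of_real (c\<^sup>2)) \<le> \<eta>"
      if ej: "e \<in> F" "j \<le> J" for e j
      using orbit[OF ej(1) ej(1), of "2 ^ j / Q"] ipT[OF ej(1) ej(1), of "2 ^ j / Q"] RQ ej(2)
      by (simp add: divide_right_mono)
    show "card F * (\<eta> + (real (Suc J) * (4 * \<eta>) + 1 / (Q - R)\<^sup>2)) + (card F)\<^sup>2 * \<eta> < c\<^sup>2"
      using small by (simp add: c_def)
  qed (use xX e RQ \<delta> \<eta> J in auto)
  then show ?thesis by (simp add: basis_def eigval_def)
qed

text \<open>The tolerances are fixed before the triples, from \<open>R\<close>,
  \<open>\<delta>\<close> and \<open>m\<close> alone, so one choice works along a whole sequence.
  Bounding the size of \<open>F\<close> by \<open>m\<close> makes the smallness condition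
  uniform.\<close>

lemma eigenvalue_transfer:
  assumes "0 \<le> R" "0 < \<delta>"
  obtains \<eta> b where "0 < \<eta>"
    "\<And>(S :: ('a, 'h) spectral_triple) (T :: ('b, 'k) spectral_triple) G F.
      is_spectral_triple S \<Longrightarrow> is_spectral_triple T \<Longrightarrow> correlated S T G \<eta> b \<Longrightarrow>
      F \<subseteq> below T R \<Longrightarrow> card F \<le> m \<Longrightarrow>
      card F \<le> card {f \<in> basis S. \<exists>e\<in>F. \<bar>eigval S f - eigval T e\<bar> < \<delta>}"
proof -
  define C where "C = (1 / (2 * (1 + R)))\<^sup>2"
  have C: "0 < C" using assms by (simp add: C_def)
  \<comment> \<open>Keeps the Chebyshev term m / (Q - R)^2 at most C/4.\<close>
  define Q where "Q = R + sqrt (4 * (real m + 1) / C)"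
  have RQ: "R < Q" using C by (simp add: Q_def)
  have QR: "1 / (Q - R)\<^sup>2 = C / (4 * (real m + 1))" using C by (simp add: Q_def)
  have "0 < Q" using RQ assms by simp
  then obtain J :: nat where J:
    "\<And>y. \<delta> \<le> \<bar>y\<bar> \<Longrightarrow> \<bar>y\<bar> \<le> Q \<Longrightarrow> \<exists>j\<le>J. 1 \<le> (cmod (cis (2 ^ j / Q * y) - 1))\<^sup>2"
    using cis_escape[OF assms(2)] by blast
  \<comment> \<open>The total coefficient of \<open>\<eta>\<close> in the smallness condition for
    size \<open>m\<close>. The choice of \<open>\<eta>\<close> makes that part at most C/2, so at
    most 3C/4 is spent.\<close>
  define K where "K = real m + real m * (real (Suc J) * 4) + (real m)\<^sup>2"
  have K: "0 \<le> K" by (simp add: K_def)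
  define \<eta> where "\<eta> = C / (2 * (K + 1))"
  have \<eta>: "0 < \<eta>" using C K by (simp add: \<eta>_def)
  have "card F \<le> card {f \<in> basis S. \<exists>e\<in>F. \<bar>eigval S f - eigval T e\<bar> < \<delta>}"
    if "is_spectral_triple S" "is_spectral_triple T" "correlated S T G \<eta> (2 ^ J / Q)"
      "F \<subseteq> below T R" and m: "card F \<le> m"
    for S :: "('a, 'h) spectral_triple" and T :: "('b, 'k) spectral_triple" and G F
  proof (rule eigenvalue_transfer_aux[OF that(1-4) assms(1) RQ assms(2) _ J])
    have "card F * (\<eta> + (real (Suc J) * (4 * \<eta>) + 1 / (Q - R)\<^sup>2)) + (card F)\<^sup>2 * \<eta>
        \<le> real m * (\<eta> + (real (Suc J) * (4 * \<eta>) + 1 / (Q - R)\<^sup>2)) + (real m)\<^sup>2 * \<eta>"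
      using m \<eta> by (intro add_mono mult_right_mono) (auto intro!: power_mono add_nonneg_nonneg)
    also have "\<dots> = K * \<eta> + real m * (C / (4 * (real m + 1)))"
      by (simp only: QR K_def) (simp add: algebra_simps)
    also have "K * \<eta> \<le> C / 2"
    proof -
      have "C * K \<le> C * (K + 1)" using C by (intro mult_left_mono) auto
      then show ?thesis using K by (simp add: \<eta>_def field_simps)
    qed
    also have "real m * (C / (4 * (real m + 1))) \<le> C / 4"
      using C by (simp add: field_simps)
    finally show "card F * (\<eta> + (real (Suc J) * (4 * \<eta>) + 1 / (Q - R)\<^sup>2)) + (card F)\<^sup>2 * \<eta>
      < (1 / (2 * (1 + R)))\<^sup>2" using C unfolding C_def[symmetric] by linarith
  qed (use \<eta> in auto)
  then show thesis using that[OF \<eta>] by blast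
qed

section \<open>Tunnels\<close>

lemma metCor_simps [simp]:
  "hmod (metCor T) = st_hilb T" "dndom (metCor T) = st_dom T" "dn (metCor T) = DN T"
  "alg (rq (metCor T)) = complex_cstar"
  by (auto simp: metCor_def DN_def fun_eq_iff)

text \<open>Linearity and normalisation leave only the identity. The states pulled back along a
  right tunnel map therefore reduce to one character.\<close>

lemma states_complex:
  assumes "\<phi> \<in> states complex_cstar"
  shows "\<phi> z = z"
proof -
  have "\<phi> (a * b) = a * \<phi> b" "\<phi> 1 = 1" for a b using assms unfolding states_def by auto
  then show ?thesis by (metis mult.right_neutral)
qed

context
  fixes P :: "('d, 'e, 'm) metcor" and S :: "('a, 'h) spectral_triple" and \<Phi> \<pi> \<rho>
  assumes P: "metrical_cstar_correspondence P"
    and iso: "metrical_quantum_isometry P (metCor S) \<Phi> \<pi> \<rho>"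
begin

lemma isometry_dn_ball:
  assumes "\<omega> \<in> dn_ball P"
  shows "\<Phi> \<omega> \<in> st_dom S" "DN S (\<Phi> \<omega>) \<le> 1"
proof -
  have \<omega>: "\<omega> \<in> dndom P" "dn P \<omega> \<le> 1" using assms by (auto simp: dn_ball_def)
  have im: "\<Phi> ` dndom P = st_dom S"
    using iso by (simp add: metrical_quantum_isometry_def)
  then show X: "\<Phi> \<omega> \<in> st_dom S" using \<omega> by blast
  have "DN S (\<Phi> \<omega>) = Inf (dn P ` {\<eta> \<in> dndom P. \<Phi> \<eta> = \<Phi> \<omega>})"
    using iso X by (simp add: metrical_quantum_isometry_def)
  also have "\<dots> \<le> dn P \<omega>"
  proof (rule cInf_lower)
    have "0 \<le> dn P \<eta>" if "\<eta> \<in> dndom P" for \<eta>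
      using P that by (simp add: metrical_cstar_correspondence_def Let_def)
    then show "bdd_below (dn P ` {\<eta> \<in> dndom P. \<Phi> \<eta> = \<Phi> \<omega>})" by (intro bdd_belowI[of _ 0]) auto
  qed (use \<omega> in auto)
  finally show "DN S (\<Phi> \<omega>) \<le> 1" using \<omega> by simp
qed

lemma isometry_dn_ball_surj:
  assumes "x \<in> st_dom S" "DN S x < 1"
  obtains \<omega> where "\<omega> \<in> dn_ball P" "\<Phi> \<omega> = x"
proof -
  have im: "\<Phi> ` dndom P = st_dom S"
    using iso by (simp add: metrical_quantum_isometry_def)
  have "Inf (dn P ` {\<eta> \<in> dndom P. \<Phi> \<eta> = x}) < 1"
    using iso assms by (simp add: metrical_quantum_isometry_def)
  \<comment> \<open>Nonemptiness of the fibre matters: the real infimum of the empty set is a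
    default value unrelated to the norm.\<close>
  moreover have "x \<in> \<Phi> ` dndom P" using im assms(1) by simp
  then have "dn P ` {\<eta> \<in> dndom P. \<Phi> \<eta> = x} \<noteq> {}" by auto
  ultimately obtain \<omega> where "\<omega> \<in> dndom P" "\<Phi> \<omega> = x" "dn P \<omega> < 1"
    using cInf_lessD[of "dn P ` {\<eta> \<in> dndom P. \<Phi> \<eta> = x}" 1] by auto
  then show thesis using that[of \<omega>] by (simp add: dn_ball_def)
qed

lemma dn_ball_carrier: "\<omega> \<in> dn_ball P \<Longrightarrow> \<omega> \<in> carrier (hmod P)"
  using P submodule.subset unfolding metrical_cstar_correspondence_def dn_ball_def Let_def by blast

lemma isometry_ip:
  "\<omega> \<in> dn_ball P \<Longrightarrow> \<zeta> \<in> dn_ball P \<Longrightarrow>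
    ip (st_hilb S) (\<Phi> \<omega>) (\<Phi> \<zeta>) = \<rho> (ip (hmod P) \<omega> \<zeta>)"
  using iso dn_ball_carrier
  by (simp add: metrical_quantum_isometry_def correspondence_morphism_def Let_def)

lemma isometry_right_hom: "unital_star_hom (alg (rq P)) complex_cstar \<rho>"
  using iso by (simp add: metrical_quantum_isometry_def correspondence_morphism_def Let_def)

end

section \<open>Characters of the right algebra as states\<close>

context
  fixes B :: "'e cstar" and \<rho> :: "'e \<Rightarrow> complex"
  assumes B: "cstar_algebra B" and \<rho>: "unital_star_hom B complex_cstar \<rho>"
begin

interpretation B: cstar_algebra B by (rule B)

lemma character_simps:
  "x \<in> carrier B \<Longrightarrow> y \<in> carrier B \<Longrightarrow> \<rho> (x \<oplus>\<^bsub>B\<^esub> y) = \<rho> x + \<rho> y"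
  "x \<in> carrier B \<Longrightarrow> \<rho> (z \<odot>\<^bsub>B\<^esub> x) = z * \<rho> x"
  "x \<in> carrier B \<Longrightarrow> y \<in> carrier B \<Longrightarrow> \<rho> (x \<otimes>\<^bsub>B\<^esub> y) = \<rho> x * \<rho> y"
  "x \<in> carrier B \<Longrightarrow> \<rho> (star B x) = cnj (\<rho> x)"
  "\<rho> \<one>\<^bsub>B\<^esub> = 1"
  using \<rho> by (auto simp: unital_star_hom_def star_hom_def)

lemma smult_closed_cstar: "x \<in> carrier B \<Longrightarrow> z \<odot>\<^bsub>B\<^esub> x \<in> carrier B"
  by (rule B.scalar.smult_closed) auto

lemma character_diff:
  assumes "x \<in> carrier B" "y \<in> carrier B"
  shows "\<rho> (x \<ominus>\<^bsub>B\<^esub> y) = \<rho> x - \<rho> y"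
proof -
  have "\<rho> (x \<ominus>\<^bsub>B\<^esub> y \<oplus>\<^bsub>B\<^esub> y) = \<rho> (x \<ominus>\<^bsub>B\<^esub> y) + \<rho> y"
    using assms by (intro character_simps) auto
  moreover have "x \<ominus>\<^bsub>B\<^esub> y \<oplus>\<^bsub>B\<^esub> y = x"
    using assms by (simp add: a_minus_def B.a_assoc B.l_neg)
  ultimately show ?thesis by simp
qed

lemma character_Re_Im:
  assumes "x \<in> carrier B"
  shows "\<rho> (Re_part B x) = of_real (Re (\<rho> x))" "\<rho> (Im_part B x) = of_real (Im (\<rho> x))"
  using assms B.star_closed[OF assms]
  by (simp_all add: Re_part_def Im_part_def character_simps character_diff complex_eq_iff)

lemma character_state: "restrict \<rho> (carrier B) \<in> states B"
proof -
  have "\<rho> x \<in> \<real>\<^sub>\<ge>\<^sub>0 \<and> x \<in> carrier B" if "x \<in> positive_elements B" for x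
  proof -
    obtain b where b: "b \<in> carrier B" "x = star B b \<otimes>\<^bsub>B\<^esub> b"
      using \<open>x \<in> positive_elements B\<close> by (auto simp: positive_elements_def)
    then have "\<rho> x = of_real ((cmod (\<rho> b))\<^sup>2)"
      using B.star_closed[of b] by (simp add: character_simps cnj_mult_self)
    then show ?thesis using b B.star_closed[of b] by (simp add: complex_nonneg_Reals_iff)
  qed
  then show ?thesis
    by (auto simp: states_def character_simps smult_closed_cstar)
qed

end

text \<open>\<open>\<sigma>\<close> gives a state, and over \<complex> the only pulled-back state is
  the one given by \<open>\<rho>\<close>. The Hausdorff bound is therefore a bound on the
  \<open>mk\<close> distance of the two characters.\<close>

lemma characters_close:
  assumes E: "quantum_compact_metric_space E"
    and \<rho>: "unital_star_hom (alg E) complex_cstar \<rho>" and \<sigma>: "unital_star_hom (alg E) complex_cstar \<sigma>"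
    and A: "alg A = complex_cstar"
    and ext: "hausdorff (mk E) (states (alg E)) (pullback_states E A \<rho>) < ennreal \<epsilon>"
    and a: "a \<in> ldom E" "lip E a \<le> 1"
  shows "cmod (\<sigma> a - \<rho> a) \<le> \<epsilon>"
proof -
  let ?s = "restrict \<sigma> (carrier (alg E))"
  have B: "cstar_algebra (alg E)" and "ldom E \<subseteq> sa (alg E)"
    using E by (simp_all add: quantum_compact_metric_space_def Let_def)
  then have aC: "a \<in> carrier (alg E)" using a by (auto simp: sa_def)
  have "(INF \<psi>\<in>pullback_states E A \<rho>. mk E ?s \<psi>)
      \<le> (SUP \<phi>\<in>states (alg E). INF \<psi>\<in>pullback_states E A \<rho>. mk E \<phi> \<psi>)"
    by (rule SUP_upper) (rule character_state[OF B \<sigma>])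
  also have "\<dots> < ennreal \<epsilon>" using ext by (simp add: hausdorff_def)
  finally obtain \<psi> where \<psi>: "\<psi> \<in> pullback_states E A \<rho>" "mk E ?s \<psi> < ennreal \<epsilon>"
    by (auto simp: INF_less_iff)
  then obtain \<phi> where "\<phi> \<in> states complex_cstar" "\<psi> = compose (carrier (alg E)) \<phi> \<rho>"
    using A by (auto simp: pullback_states_def)
  then have "\<psi> a = \<rho> a" using aC states_complex by (simp add: compose_def)
  have "ennreal (cmod (?s a - \<psi> a)) \<le> mk E ?s \<psi>"
    unfolding mk_def by (rule SUP_upper) (use a in auto)
  then have "ennreal (cmod (\<sigma> a - \<rho> a)) < ennreal \<epsilon>"
    using \<psi>(2) \<open>\<psi> a = \<rho> a\<close> aC by simp
  then show ?thesis by (simp add: ennreal_less_iff)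
qed

text \<open>Both inner products are images of one element of the right algebra under the two
  characters. By the inner Leibniz inequality its real and imaginary parts have seminorm at most 2,
  so each contributes 2 \<epsilon>.\<close>

lemma tunnel_ip_close:
  assumes \<tau>: "metrical_tunnel (metCor S) (metCor T) \<tau>"
    and ext: "mtunnel_extent (metCor S) (metCor T) \<tau> < ennreal \<epsilon>"
    and \<omega>: "\<omega> \<in> dn_ball (tun \<tau>)" and \<zeta>: "\<zeta> \<in> dn_ball (tun \<tau>)"
  shows "cmod (ip (st_hilb S) (mod1 \<tau> \<omega>) (mod1 \<tau> \<zeta>) - ip (st_hilb T) (mod2 \<tau> \<omega>) (mod2 \<tau> \<zeta>))
    \<le> 4 * \<epsilon>"
proof -
  define P where "P = tun \<tau>"
  define E where "E = rq P"
  define x where "x = ip (hmod P) \<omega> \<zeta>"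
  have P: "metrical_cstar_correspondence P"
    and i1: "metrical_quantum_isometry P (metCor S) (mod1 \<tau>) (left1 \<tau>) (right1 \<tau>)"
    and i2: "metrical_quantum_isometry P (metCor T) (mod2 \<tau>) (left2 \<tau>) (right2 \<tau>)"
    using \<tau> by (auto simp: metrical_tunnel_def P_def)
  note h1 = isometry_right_hom[OF P i1, folded E_def]
    and h2 = isometry_right_hom[OF P i2, folded E_def]
  have E: "quantum_compact_metric_space E" and hm: "hilbert_module (alg E) (hmod P)"
    using P by (auto simp: metrical_cstar_correspondence_def cstar_correspondence_def Let_def E_def)
  have B: "cstar_algebra (alg E)" and sa: "ldom E \<subseteq> sa (alg E)"
    and smult: "\<And>r a. a \<in> ldom E \<Longrightarrow> complex_of_real r \<odot>\<^bsub>alg E\<^esub> a \<in> ldom E"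
      "\<And>r a. a \<in> ldom E \<Longrightarrow> lip E (complex_of_real r \<odot>\<^bsub>alg E\<^esub> a) = \<bar>r\<bar> * lip E a"
    using E by (simp_all add: quantum_compact_metric_space_def Let_def)
  have wz: "\<omega> \<in> dndom P" "\<zeta> \<in> dndom P" "dn P \<omega> \<le> 1" "dn P \<zeta> \<le> 1"
    using \<omega> \<zeta> by (auto simp: dn_ball_def P_def)
  have wz0: "0 \<le> dn P \<omega>" "0 \<le> dn P \<zeta>"
    using P wz by (auto simp: metrical_cstar_correspondence_def Let_def)
  have xC: "x \<in> carrier (alg E)"
    unfolding x_def using dn_ball_carrier[OF P i1] \<omega> \<zeta>
    by (intro hilbert_module.ip_closed[OF hm]) (auto simp: P_def)
  have "Re_part (alg E) x \<in> ldom E \<and> Im_part (alg E) x \<in> ldom E \<and>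
      max (lip E (Re_part (alg E) x)) (lip E (Im_part (alg E) x)) \<le> 2 * dn P \<omega> * dn P \<zeta>"
    using P wz unfolding metrical_cstar_correspondence_def Let_def x_def E_def by blast
  moreover have "2 * dn P \<omega> * dn P \<zeta> \<le> 2"
    using mult_mono[OF wz(3,4)] wz0 by simp
  ultimately have parts: "Re_part (alg E) x \<in> ldom E" "Im_part (alg E) x \<in> ldom E"
      "lip E (Re_part (alg E) x) \<le> 2" "lip E (Im_part (alg E) x) \<le> 2"
    by auto
  have "tunnel_extent E (rq (metCor S)) (rq (metCor T)) (right1 \<tau>) (right2 \<tau>) < ennreal \<epsilon>"
    using ext by (simp add: mtunnel_extent_def E_def P_def)
  then have ext1: "hausdorff (mk E) (states (alg E)) (pullback_states E (rq (metCor S)) (right1 \<tau>))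
      < ennreal \<epsilon>"
    by (simp add: tunnel_extent_def)
  \<comment> \<open>\<open>characters_close\<close> takes seminorm at most 1, so elements are halved
    and the error doubled.\<close>
  have half: "cmod (right2 \<tau> a - right1 \<tau> a) \<le> 2 * \<epsilon>" if a: "a \<in> ldom E" "lip E a \<le> 2" for a
  proof -
    have aC: "a \<in> carrier (alg E)" using a sa by (auto simp: sa_def)
    have "cmod (right2 \<tau> (complex_of_real (1/2) \<odot>\<^bsub>alg E\<^esub> a)
        - right1 \<tau> (complex_of_real (1/2) \<odot>\<^bsub>alg E\<^esub> a)) \<le> \<epsilon>"
      by (rule characters_close[OF E h1 h2 _ ext1]) (use a smult[OF a(1), of "1/2"] in auto)
    moreover have "right2 \<tau> (complex_of_real (1/2) \<odot>\<^bsub>alg E\<^esub> a)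
        - right1 \<tau> (complex_of_real (1/2) \<odot>\<^bsub>alg E\<^esub> a) = (right2 \<tau> a - right1 \<tau> a) / 2"
      using character_simps(2)[OF B h1 aC] character_simps(2)[OF B h2 aC] by (simp add: field_simps)
    ultimately have "cmod ((right2 \<tau> a - right1 \<tau> a) / 2) \<le> \<epsilon>" by (simp only:)
    then show ?thesis by (simp add: norm_divide)
  qed
  let ?d = "right1 \<tau> x - right2 \<tau> x"
  have "\<bar>Re ?d\<bar> \<le> 2 * \<epsilon>"
    using half[OF parts(1,3)] character_Re_Im(1)[OF B h1 xC] character_Re_Im(1)[OF B h2 xC]
    by (simp add: abs_minus_commute flip: of_real_diff)
  moreover have "\<bar>Im ?d\<bar> \<le> 2 * \<epsilon>"
    using half[OF parts(2,4)] character_Re_Im(2)[OF B h1 xC] character_Re_Im(2)[OF B h2 xC]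
    by (simp add: abs_minus_commute flip: of_real_diff)
  ultimately have "cmod ?d \<le> 4 * \<epsilon>" using cmod_le[of ?d] by linarith
  then show ?thesis
    using isometry_ip[OF P i1] isometry_ip[OF P i2] \<omega> \<zeta> by (simp add: P_def x_def)
qed

lemma (in spectral_op) expD_diff:
  "x \<in> carrier H \<Longrightarrow> y \<in> carrier H \<Longrightarrow> expD t (x \<ominus>\<^bsub>H\<^esub> y) = expD t x \<ominus>\<^bsub>H\<^esub> expD t y"
  by (rule eigenbasis_eqI) (auto simp: ip_expD algebra_simps)

lemma (in spectral_op) nrm_expD: "x \<in> carrier H \<Longrightarrow> nrm (expD t x) = nrm x"
  using ip_expD_expD[of x x t] by (simp add: hnorm_def)

text \<open>The relation pairs the two images of the same \<open>\<omega>\<close>, but separation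
  follows the orbit of some other partner. The two images in \<open>T\<close> are compared by
  testing their difference against itself at time 0, and unitarity carries the estimate to all
  times.\<close>

lemma tunnel_correlated:
  fixes S :: "('a, 'h) spectral_triple" and T :: "('b, 'k) spectral_triple"
    and \<tau> :: "('a, 'h, 'b, 'k) triple_tunnel"
  assumes S: "is_spectral_triple S" and T: "is_spectral_triple T"
    and \<tau>: "metrical_tunnel (metCor S) (metCor T) \<tau>" and \<epsilon>: "0 < \<epsilon>"
    and ext: "mtunnel_extent (metCor S) (metCor T) \<tau> < ennreal \<epsilon>"
    and sep: "sep S T \<tau> \<epsilon> < ennreal \<epsilon>"
  shows "correlated S T ((\<lambda>\<omega>. (mod1 \<tau> \<omega>, mod2 \<tau> \<omega>)) ` dn_ball (tun \<tau>)) (\<epsilon> + sqrt (20 * \<epsilon>)) (1 / \<epsilon>)"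
proof -
  interpret S: spectral_op "st_hilb S" "st_dom S" "st_op S" by (rule spectral_op_triple[OF S])
  interpret T: spectral_op "st_hilb T" "st_dom T" "st_op T" by (rule spectral_op_triple[OF T])
  define P where "P = tun \<tau>"
  have P: "metrical_cstar_correspondence P"
    and i1: "metrical_quantum_isometry P (metCor S) (mod1 \<tau>) (left1 \<tau>) (right1 \<tau>)"
    and i2: "metrical_quantum_isometry P (metCor T) (mod2 \<tau>) (left2 \<tau>) (right2 \<tau>)"
    using \<tau> by (auto simp: metrical_tunnel_def P_def)
  note b1 = isometry_dn_ball[OF P i1] and b2 = isometry_dn_ball[OF P i2]
  have orbit: "cmod (ip (st_hilb S) (S.expD t (mod1 \<tau> \<omega>)) (mod1 \<tau> \<zeta>)
      - ip (st_hilb T) (T.expD t (mod2 \<tau> \<omega>)) (mod2 \<tau> \<zeta>)) \<le> \<epsilon> + sqrt (20 * \<epsilon>)"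
    if \<omega>: "\<omega> \<in> dn_ball P" and \<zeta>: "\<zeta> \<in> dn_ball P" and t: "0 \<le> t" "t \<le> 1 / \<epsilon>" for \<omega> \<zeta> t
  proof -
    have "(INF \<omega>'\<in>dn_ball P. orbit_distance S T \<tau> \<epsilon> \<omega> \<omega>')
        \<le> (SUP \<omega>\<in>dn_ball P. INF \<omega>'\<in>dn_ball P. orbit_distance S T \<tau> \<epsilon> \<omega> \<omega>')"
      by (rule SUP_upper[OF \<omega>])
    also have "\<dots> < ennreal \<epsilon>" using sep by (simp add: sep_def Let_def P_def)
    finally obtain \<omega>' where \<omega>': "\<omega>' \<in> dn_ball P" "orbit_distance S T \<tau> \<epsilon> \<omega> \<omega>' < ennreal \<epsilon>"
      by (auto simp: INF_less_iff)
    define y where "y = mod2 \<tau> \<omega>"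
    define y' where "y' = mod2 \<tau> \<omega>'"
    have X: "mod1 \<tau> \<omega> \<in> st_dom S" "y \<in> st_dom T" "y' \<in> st_dom T"
      and DN: "DN T y \<le> 1" "DN T y' \<le> 1"
      using b1(1)[OF \<omega>] b2[OF \<omega>] b2[OF \<omega>'(1)] by (simp_all add: y_def y'_def)
    have close: "cmod (ip (st_hilb S) (S.expD s (mod1 \<tau> \<omega>)) (mod1 \<tau> \<xi>)
        - ip (st_hilb T) (T.expD s y') (mod2 \<tau> \<xi>)) \<le> \<epsilon>"
      if s: "0 \<le> s" "s \<le> 1 / \<epsilon>" and \<xi>: "\<xi> \<in> dn_ball P" for s \<xi>
    proof -
      have "ennreal (cmod (ip (st_hilb S) (triple_exp S s (mod1 \<tau> \<omega>)) (mod1 \<tau> \<xi>)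
          - ip (st_hilb T) (triple_exp T s y') (mod2 \<tau> \<xi>))) \<le> orbit_distance S T \<tau> \<epsilon> \<omega> \<omega>'"
        unfolding orbit_distance_def y'_def
        by (rule SUP_upper2[of s], use s in simp, rule SUP_upper2[OF \<xi>[unfolded P_def]], rule order_refl)
      then have "ennreal (cmod (ip (st_hilb S) (triple_exp S s (mod1 \<tau> \<omega>)) (mod1 \<tau> \<xi>)
          - ip (st_hilb T) (triple_exp T s y') (mod2 \<tau> \<xi>))) < ennreal \<epsilon>"
        using \<omega>'(2) by (rule order_le_less_trans)
      then show ?thesis
        using X by (simp add: triple_exp_def S.exp_i_eq_expD T.exp_i_eq_expD ennreal_less_iff)
    qed
    define v where "v = y' \<ominus>\<^bsub>st_hilb T\<^esub> y"
    \<comment> \<open>A quarter of the difference of two vectors of the \<open>DN\<close> ball has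
      \<open>DN\<close> at most 1/2, so \<open>u\<close> lifts to a test vector in the
      tunnel.\<close>
    define u where "u = complex_of_real (1/4) \<odot>\<^bsub>st_hilb T\<^esub> v"
    have vX: "v \<in> st_dom T" "u \<in> st_dom T" using X by (simp_all add: v_def u_def)
    have "DN T u < 1"
    proof -
      have tri: "T.nrm (a \<ominus>\<^bsub>st_hilb T\<^esub> b) \<le> T.nrm a + T.nrm b"
        if "a \<in> carrier (st_hilb T)" "b \<in> carrier (st_hilb T)" for a b
        using that T.nrm_triangle[of a "(-1) \<odot>\<^bsub>st_hilb T\<^esub> b"] by (simp add: T.diff_eq)
      have "DN T u = (1/4) * (T.nrm v + T.nrm (st_op T v))"
        using vX by (simp add: DN_def u_def algebra_simps)
      also have "T.nrm v + T.nrm (st_op T v) \<le> DN T y' + DN T y"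
        using tri[of y' y] tri[of "st_op T y'" "st_op T y"] X by (simp add: v_def DN_def)
      finally show ?thesis using DN by simp
    qed
    then obtain \<xi> where \<xi>: "\<xi> \<in> dn_ball P" "mod2 \<tau> \<xi> = u"
      using isometry_dn_ball_surj[OF P i2 vX(2)] by blast
    have "cmod (ip (st_hilb S) (mod1 \<tau> \<omega>) (mod1 \<tau> \<xi>) - ip (st_hilb T) y' u) \<le> \<epsilon>"
      using close[OF _ _ \<xi>(1), of 0] \<epsilon> X \<xi>(2) by (simp add: S.expD_0 T.expD_0)
    moreover have "cmod (ip (st_hilb S) (mod1 \<tau> \<omega>) (mod1 \<tau> \<xi>) - ip (st_hilb T) y u) \<le> 4 * \<epsilon>"
      using tunnel_ip_close[OF \<tau> ext, of \<omega> \<xi>] \<omega> \<xi> by (simp add: P_def y_def)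
    \<comment> \<open>Separation contributes \<epsilon> and the extent 4 \<epsilon>. As
      \<open>u\<close> is a quarter of \<open>v\<close>, the squared norm of \<open>v\<close> is at
      most 20 \<epsilon>.\<close>
    ultimately have "cmod (ip (st_hilb T) y' u - ip (st_hilb T) y u) \<le> 5 * \<epsilon>"
      using norm_triangle_ineq4[of "ip (st_hilb S) (mod1 \<tau> \<omega>) (mod1 \<tau> \<xi>) - ip (st_hilb T) y u"
          "ip (st_hilb S) (mod1 \<tau> \<omega>) (mod1 \<tau> \<xi>) - ip (st_hilb T) y' u"] by simp
    moreover have "ip (st_hilb T) y' u - ip (st_hilb T) y u = ip (st_hilb T) v u"
      using X vX by (simp add: v_def)
    moreover have "cmod (ip (st_hilb T) v u) = (T.nrm v)\<^sup>2 / 4"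
      using vX by (simp add: u_def T.ip_self norm_mult norm_power norm_divide)
    ultimately have "(T.nrm v)\<^sup>2 \<le> 20 * \<epsilon>" by simp
    then have nv: "T.nrm v \<le> sqrt (20 * \<epsilon>)" by (rule real_le_rsqrt)
    define z where "z = mod2 \<tau> \<zeta>"
    have z: "z \<in> st_dom T" "T.nrm z \<le> 1"
    proof -
      show "z \<in> st_dom T" using b2[OF \<zeta>] by (simp add: z_def)
      then show "T.nrm z \<le> 1"
        using b2(2)[OF \<zeta>] T.nrm_nonneg[of "st_op T z"] unfolding DN_def z_def by linarith
    qed
    have "cmod (ip (st_hilb T) (T.expD t y') z - ip (st_hilb T) (T.expD t y) z)
        = cmod (ip (st_hilb T) (T.expD t v) z)"
      using X z by (simp add: v_def T.expD_diff)
    also have "\<dots> \<le> T.nrm v * T.nrm z"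
      using T.Cauchy_Schwarz[of "T.expD t v" z] vX z by (simp add: T.nrm_expD)
    also have "\<dots> \<le> sqrt (20 * \<epsilon>) * 1"
      using nv z \<epsilon> by (intro mult_mono) auto
    finally have "cmod (ip (st_hilb T) (T.expD t y') z - ip (st_hilb T) (T.expD t y) z)
        \<le> sqrt (20 * \<epsilon>)" by simp
    then show ?thesis
      using close[OF t \<zeta>] norm_triangle_ineq[of "ip (st_hilb S) (S.expD t (mod1 \<tau> \<omega>)) (mod1 \<tau> \<zeta>)
          - ip (st_hilb T) (T.expD t y') z" "ip (st_hilb T) (T.expD t y') z - ip (st_hilb T) (T.expD t y) z"]
      unfolding z_def[symmetric] y_def[symmetric] by simp
  qed
  let ?G = "(\<lambda>\<omega>. (mod1 \<tau> \<omega>, mod2 \<tau> \<omega>)) ` dn_ball P"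
  have "correlated S T ?G (\<epsilon> + sqrt (20 * \<epsilon>)) (1 / \<epsilon>)"
    unfolding correlated_def
  proof (intro conjI allI impI ballI)
    fix x assume "x \<in> st_dom S" "DN S x < 1"
    then obtain \<omega> where "\<omega> \<in> dn_ball P" "mod1 \<tau> \<omega> = x" by (rule isometry_dn_ball_surj[OF P i1])
    then show "\<exists>y. (x, y) \<in> ?G" by blast
  next
    fix y assume "y \<in> st_dom T" "DN T y < 1"
    then obtain \<omega> where "\<omega> \<in> dn_ball P" "mod2 \<tau> \<omega> = y" by (rule isometry_dn_ball_surj[OF P i2])
    then show "\<exists>x. (x, y) \<in> ?G" by blast
  next
    fix x y x' y' and t :: real
    assume xy: "(x, y) \<in> ?G" "(x', y') \<in> ?G" and t: "0 \<le> t" "t \<le> 1 / \<epsilon>"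
    then obtain \<omega> \<zeta> where w: "\<omega> \<in> dn_ball P" "\<zeta> \<in> dn_ball P"
        "x = mod1 \<tau> \<omega>" "y = mod2 \<tau> \<omega>" "x' = mod1 \<tau> \<zeta>" "y' = mod2 \<tau> \<zeta>" by blast
    then show "cmod (ip (st_hilb S) (triple_exp S t x) x' - ip (st_hilb T) (triple_exp T t y) y')
        \<le> \<epsilon> + sqrt (20 * \<epsilon>)"
      using orbit[OF w(1,2) t] b1(1)[OF w(1)] b2(1)[OF w(1)]
      by (simp add: triple_exp_def S.exp_i_eq_expD T.exp_i_eq_expD)
  qed (use b1 b2 in blast)+
  then show ?thesis by (simp add: P_def)
qed

lemma propinquity_correlated:
  fixes S :: "('a, 'h) spectral_triple" and T :: "('b, 'k) spectral_triple"
  assumes S: "is_spectral_triple S" and T: "is_spectral_triple T"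
    and less: "spectral_propinquity S T < ennreal (min (min (\<eta> / 2) (\<eta>\<^sup>2 / 80)) (1 / (\<bar>b\<bar> + 1)))"
    and \<eta>: "0 < \<eta>"
  obtains G where "correlated S T G \<eta> b"
proof -
  obtain \<epsilon> and \<tau> :: "('a, 'h, 'b, 'k) triple_tunnel" where \<epsilon>: "0 < \<epsilon>"
      "ennreal \<epsilon> < ennreal (min (min (\<eta> / 2) (\<eta>\<^sup>2 / 80)) (1 / (\<bar>b\<bar> + 1)))"
    and \<tau>: "metrical_tunnel (metCor S) (metCor T) \<tau>"
      "max (mtunnel_extent (metCor S) (metCor T) \<tau>) (sep S T \<tau> \<epsilon>) < ennreal \<epsilon>"
    using less unfolding spectral_propinquity_def Inf_less_iff by blast
  \<comment> \<open>The three bounds yield, in order, \<epsilon> \<le> \<eta>/2, sqrt (20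
    \<epsilon>) \<le> \<eta>/2 and b \<le> 1/\<epsilon>.\<close>
  have le: "\<epsilon> \<le> \<eta> / 2" "\<epsilon> \<le> \<eta>\<^sup>2 / 80" "\<epsilon> \<le> 1 / (\<bar>b\<bar> + 1)"
    using \<epsilon> by (simp_all add: ennreal_less_iff)
  have "sqrt (20 * \<epsilon>) \<le> \<eta> / 2"
    using le(2) \<eta> by (intro real_le_lsqrt) (auto simp: power2_eq_square)
  then have 1: "\<epsilon> + sqrt (20 * \<epsilon>) \<le> \<eta>" using le(1) by linarith
  have "\<bar>b\<bar> + 1 \<le> 1 / \<epsilon>" using le(3) \<epsilon>(1) by (simp add: field_simps)
  then have 2: "b \<le> 1 / \<epsilon>" by linarith
  have "mtunnel_extent (metCor S) (metCor T) \<tau> < ennreal \<epsilon>" "sep S T \<tau> \<epsilon> < ennreal \<epsilon>"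
    using \<tau>(2) by simp_all
  then show thesis
    using correlated_mono[OF tunnel_correlated[OF S T \<tau>(1) \<epsilon>(1)] 1 2] that by blast
qed

text \<open>The spectrum is discrete and misses both endpoints, so a collar around each contains no
  eigenvalue. The conclusion leads directly from the window widened by \<delta> to the one shrunk by
  \<delta>, the form used in both directions of the comparison.\<close>

lemma spectral_gap:
  assumes T: "is_spectral_triple T" and "complex_of_real \<Lambda> \<notin> Sp T" "complex_of_real (- \<Lambda>) \<notin> Sp T"
  obtains d where "0 < d"
    "\<And>e \<delta>. e \<in> basis T \<Longrightarrow> \<delta> < d \<Longrightarrow> \<bar>eigval T e\<bar> \<le> \<Lambda> + \<delta> \<Longrightarrow> \<bar>eigval T e\<bar> \<le> \<Lambda> - \<delta>"
proof -
  define A where "A = (\<lambda>e. \<bar>\<bar>eigval T e\<bar> - \<Lambda>\<bar>) ` below T (\<Lambda> + 1)"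
  \<comment> \<open>Inserting 1 keeps the set nonempty and confines the relevant eigenvalues to the
    finite set \<open>below T (\<Lambda> + 1)\<close>.\<close>
  define d where "d = Min (insert 1 A)"
  have fin: "finite A" using finite_below[OF T] by (simp add: A_def)
  have "\<bar>eigval T e\<bar> \<noteq> \<Lambda>" if e: "e \<in> basis T" for e
  proof
    assume "\<bar>eigval T e\<bar> = \<Lambda>"
    then have "eigval T e = \<Lambda> \<or> eigval T e = - \<Lambda>" by linarith
    moreover have "complex_of_real (eigval T e) \<in> Sp T" using e unfolding Sp_eq[OF T] by blast
    ultimately show False using assms(2,3) by metis
  qed
  then have "0 < d" using fin unfolding d_def by (subst Min_gr_iff) (auto simp: A_def below_def)
  moreover have "\<bar>eigval T e\<bar> \<le> \<Lambda> - \<delta>"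
    if e: "e \<in> basis T" "\<delta> < d" "\<bar>eigval T e\<bar> \<le> \<Lambda> + \<delta>" for e \<delta>
  proof -
    have "d \<le> 1" unfolding d_def using fin by (intro Min_le) auto
    then have "e \<in> below T (\<Lambda> + 1)" using e by (simp add: below_def)
    then have "d \<le> \<bar>\<bar>eigval T e\<bar> - \<Lambda>\<bar>" unfolding d_def using fin by (intro Min_le) (auto simp: A_def)
    then show ?thesis using e(2,3) by linarith
  qed
  ultimately show thesis by (rule that)
qed

lemma hausdorff_leI:
  assumes "\<And>x. x \<in> X \<Longrightarrow> \<exists>y\<in>Y. d x y \<le> r" "\<And>y. y \<in> Y \<Longrightarrow> \<exists>x\<in>X. d x y \<le> r"
  shows "hausdorff d X Y \<le> r"
  unfolding hausdorff_def
proof (intro max.boundedI SUP_least)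
  show "(INF y\<in>Y. d x y) \<le> r" if "x \<in> X" for x
    using assms(1)[OF that] by (auto intro: INF_lower2)
  show "(INF x\<in>X. d x y) \<le> r" if "y \<in> Y" for y
    using assms(2)[OF that] by (auto intro: INF_lower2)
qed

section \<open>Convergence of spectra\<close>

text \<open>The gap of \<open>T\<close> alone serves both directions. An eigenvalue of
  \<open>T\<close> in the window lies \<delta> inside it, so its neighbours from \<open>S\<close>
  stay in the window; a neighbour from \<open>T\<close> of an eigenvalue of \<open>S\<close> is
  within \<Lambda> + \<delta>, hence inside as well.\<close>

lemma close_spectra:
  fixes S :: "('a, 'h) spectral_triple" and T :: "('b, 'k) spectral_triple"
  assumes S: "is_spectral_triple S" and T: "is_spectral_triple T"
    and gap: "\<And>e. e \<in> basis T \<Longrightarrow> \<bar>eigval T e\<bar> \<le> \<Lambda> + \<delta> \<Longrightarrow> \<bar>eigval T e\<bar> \<le> \<Lambda> - \<delta>"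
    and ST: "\<And>F. F \<subseteq> below T \<Lambda> \<Longrightarrow> card F \<le> Suc (card (below T \<Lambda>)) \<Longrightarrow>
      card F \<le> card {f \<in> basis S. \<exists>e\<in>F. \<bar>eigval S f - eigval T e\<bar> < \<delta>}"
    and TS: "\<And>F. F \<subseteq> below S \<Lambda> \<Longrightarrow> card F \<le> Suc (card (below T \<Lambda>)) \<Longrightarrow>
      card F \<le> card {f \<in> basis T. \<exists>e\<in>F. \<bar>eigval T f - eigval S e\<bar> < \<delta>}"
    and \<delta>: "0 < \<delta>"
  shows "card (below S \<Lambda>) = card (below T \<Lambda>)"
    and "hausdorff (\<lambda>z w. ennreal (dist z w)) (Sp_in S \<Lambda>) (Sp_in T \<Lambda>) \<le> ennreal \<delta>"
proof -
  have nearS: "{f \<in> basis S. \<exists>e\<in>F. \<bar>eigval S f - eigval T e\<bar> < \<delta>} \<subseteq> below S \<Lambda>"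
    if F: "F \<subseteq> below T \<Lambda>" for F
  proof
    fix f assume "f \<in> {f \<in> basis S. \<exists>e\<in>F. \<bar>eigval S f - eigval T e\<bar> < \<delta>}"
    then obtain e where e: "f \<in> basis S" "e \<in> F" "\<bar>eigval S f - eigval T e\<bar> < \<delta>" by blast
    then have "\<bar>eigval T e\<bar> \<le> \<Lambda> - \<delta>" using F \<delta> by (intro gap) (auto simp: below_def)
    then show "f \<in> below S \<Lambda>" using e by (simp add: below_def)
  qed
  have nearT: "{f \<in> basis T. \<exists>e\<in>F. \<bar>eigval T f - eigval S e\<bar> < \<delta>} \<subseteq> below T \<Lambda>"
    if F: "F \<subseteq> below S \<Lambda>" for F
  proof
    fix f assume "f \<in> {f \<in> basis T. \<exists>e\<in>F. \<bar>eigval T f - eigval S e\<bar> < \<delta>}"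
    then obtain e where e: "f \<in> basis T" "e \<in> F" "\<bar>eigval T f - eigval S e\<bar> < \<delta>" by blast
    then have "\<bar>eigval S e\<bar> \<le> \<Lambda>" using F by (auto simp: below_def)
    then have "\<bar>eigval T f\<bar> \<le> \<Lambda> - \<delta>" using e by (intro gap) auto
    then show "f \<in> below T \<Lambda>" using e \<delta> by (simp add: below_def)
  qed
  have "card (below T \<Lambda>) \<le> card (below S \<Lambda>)"
    using ST[OF order_refl] card_mono[OF finite_below[OF S] nearS[OF order_refl]] by simp
  moreover have "card (below S \<Lambda>) \<le> card (below T \<Lambda>)"
  proof (rule ccontr)
    assume "\<not> ?thesis"
    then have "Suc (card (below T \<Lambda>)) \<le> card (below S \<Lambda>)" by simp
    \<comment> \<open>The transfer from \<open>S\<close> to \<open>T\<close> is available only for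
      bounded families, so a subfamily with one member more than \<open>below T \<Lambda>\<close> is
      used; it already contradicts the count.\<close>
    then obtain F where F: "F \<subseteq> below S \<Lambda>" "card F = Suc (card (below T \<Lambda>))"
      using obtain_subset_with_card_n by metis
    then show False using TS[of F] card_mono[OF finite_below[OF T] nearT[OF F(1)]] by simp
  qed
  ultimately show "card (below S \<Lambda>) = card (below T \<Lambda>)" by simp
  show "hausdorff (\<lambda>z w. ennreal (dist z w)) (Sp_in S \<Lambda>) (Sp_in T \<Lambda>) \<le> ennreal \<delta>"
  proof (rule hausdorff_leI)
    fix z assume "z \<in> Sp_in S \<Lambda>"
    then obtain e where e: "e \<in> below S \<Lambda>" "z = complex_of_real (eigval S e)"
      using Sp_in_eq[OF S] by auto
    \<comment> \<open>A singleton family turns counting into existence of a nearby eigenvalue. The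
      \<open>Suc\<close> in the size bound admits it even if \<open>below T \<Lambda>\<close> is
      empty.\<close>
    have "card {f \<in> basis T. \<exists>e\<in>{e}. \<bar>eigval T f - eigval S e\<bar> < \<delta>} \<noteq> 0"
      using TS[of "{e}"] e(1) by simp
    then have "{f \<in> basis T. \<exists>e\<in>{e}. \<bar>eigval T f - eigval S e\<bar> < \<delta>} \<noteq> {}"
      by (metis card.empty)
    then obtain f where f: "f \<in> basis T" "\<bar>eigval T f - eigval S e\<bar> < \<delta>" by blast
    then have "f \<in> below T \<Lambda>" using nearT[of "{e}"] e by auto
    then show "\<exists>w\<in>Sp_in T \<Lambda>. ennreal (dist z w) \<le> ennreal \<delta>"
      using e f unfolding Sp_in_eq[OF T]
      by (intro bexI[of _ "complex_of_real (eigval T f)"])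
        (auto simp: dist_real_def abs_minus_commute intro!: ennreal_leI)
  next
    fix w assume "w \<in> Sp_in T \<Lambda>"
    then obtain e where e: "e \<in> below T \<Lambda>" "w = complex_of_real (eigval T e)"
      using Sp_in_eq[OF T] by auto
    have "card {f \<in> basis S. \<exists>e\<in>{e}. \<bar>eigval S f - eigval T e\<bar> < \<delta>} \<noteq> 0"
      using ST[of "{e}"] e(1) by simp
    then have "{f \<in> basis S. \<exists>e\<in>{e}. \<bar>eigval S f - eigval T e\<bar> < \<delta>} \<noteq> {}"
      by (metis card.empty)
    then obtain f where f: "f \<in> basis S" "\<bar>eigval S f - eigval T e\<bar> < \<delta>" by blast
    then have "f \<in> below S \<Lambda>" using nearS[of "{e}"] e by auto
    then show "\<exists>z\<in>Sp_in S \<Lambda>. ennreal (dist z w) \<le> ennreal \<delta>"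
      using e f unfolding Sp_in_eq[OF S]
      by (intro bexI[of _ "complex_of_real (eigval S f)"]) (auto simp: dist_real_def intro!: ennreal_leI)
  qed
qed

theorem theorem2p2:
  fixes T :: "nat \<Rightarrow> ('a, 'h) spectral_triple"
    and T_inf :: "('b, 'k) spectral_triple"
    and \<Lambda> :: real
  assumes "\<And>n. metric_spectral_triple (T n)"
    and "metric_spectral_triple T_inf"
    and "(\<lambda>n. spectral_propinquity (T n) T_inf) \<longlonglongrightarrow> 0"
    and "0 < \<Lambda>"
    and "complex_of_real \<Lambda> \<notin> Sp T_inf"
    and "complex_of_real (- \<Lambda>) \<notin> Sp T_inf"
  shows "(\<exists>N. \<forall>n\<ge>N.
            (\<Sum>\<^sub>\<infinity>z\<in>Sp_in (T n) \<Lambda>. eig_multiplicity z (T n))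
              = (\<Sum>\<^sub>\<infinity>z\<in>Sp_in T_inf \<Lambda>. eig_multiplicity z T_inf) \<and>
            (\<Sum>\<^sub>\<infinity>z\<in>Sp_in T_inf \<Lambda>. eig_multiplicity z T_inf) < \<infinity>) \<and>
         (\<lambda>n. hausdorff (\<lambda>z w. ennreal (dist z w)) (Sp_in (T n) \<Lambda>) (Sp_in T_inf \<Lambda>)) \<longlonglongrightarrow> 0"
proof -
  have Tn: "is_spectral_triple (T n)" for n using assms(1) by (simp add: metric_spectral_triple_def)
  have Ti: "is_spectral_triple T_inf" using assms(2) by (simp add: metric_spectral_triple_def)
  obtain d where d: "0 < d"
    "\<And>e \<delta>. e \<in> basis T_inf \<Longrightarrow> \<delta> < d \<Longrightarrow> \<bar>eigval T_inf e\<bar> \<le> \<Lambda> + \<delta> \<Longrightarrow> \<bar>eigval T_inf e\<bar> \<le> \<Lambda> - \<delta>"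
    using spectral_gap[OF Ti assms(5,6)] by blast
  let ?H = "\<lambda>n. hausdorff (\<lambda>z w. ennreal (dist z w)) (Sp_in (T n) \<Lambda>) (Sp_in T_inf \<Lambda>)"
  \<comment> \<open>The largest family that \<open>close_spectra\<close> tests.\<close>
  define m where "m = Suc (card (below T_inf \<Lambda>))"
  have main: "\<forall>\<^sub>F n in sequentially. card (below (T n) \<Lambda>) = card (below T_inf \<Lambda>) \<and> ?H n \<le> ennreal \<delta>"
    if \<delta>: "0 < \<delta>" "\<delta> < d" for \<delta>
  proof -
    obtain \<eta>1 b1 where 1: "0 < \<eta>1"
      "\<And>(S :: ('a, 'h) spectral_triple) (T :: ('b, 'k) spectral_triple) G F.
        is_spectral_triple S \<Longrightarrow> is_spectral_triple T \<Longrightarrow> correlated S T G \<eta>1 b1 \<Longrightarrow>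
        F \<subseteq> below T \<Lambda> \<Longrightarrow> card F \<le> m \<Longrightarrow>
        card F \<le> card {f \<in> basis S. \<exists>e\<in>F. \<bar>eigval S f - eigval T e\<bar> < \<delta>}"
      by (rule eigenvalue_transfer[OF less_imp_le[OF assms(4)] \<delta>(1)]) blast
    \<comment> \<open>The reverse direction exchanges the types of the two triples, so it is a
      separate instance with its own constants.\<close>
    obtain \<eta>2 b2 where 2: "0 < \<eta>2"
      "\<And>(S :: ('b, 'k) spectral_triple) (T :: ('a, 'h) spectral_triple) G F.
        is_spectral_triple S \<Longrightarrow> is_spectral_triple T \<Longrightarrow> correlated S T G \<eta>2 b2 \<Longrightarrow>
        F \<subseteq> below T \<Lambda> \<Longrightarrow> card F \<le> m \<Longrightarrow>
        card F \<le> card {f \<in> basis S. \<exists>e\<in>F. \<bar>eigval S f - eigval T e\<bar> < \<delta>}"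
      by (rule eigenvalue_transfer[OF less_imp_le[OF assms(4)] \<delta>(1)]) blast
    define \<eta> where "\<eta> = min \<eta>1 \<eta>2"
    define b where "b = max b1 b2"
    have \<eta>: "0 < \<eta>" using 1(1) 2(1) by (simp add: \<eta>_def)
    have "0 < min (min (\<eta> / 2) (\<eta>\<^sup>2 / 80)) (1 / (\<bar>b\<bar> + 1))" using \<eta> by simp
    then have "\<forall>\<^sub>F n in sequentially. spectral_propinquity (T n) T_inf
        < ennreal (min (min (\<eta> / 2) (\<eta>\<^sup>2 / 80)) (1 / (\<bar>b\<bar> + 1)))"
      by (intro order_tendstoD(2)[OF assms(3)]) (simp only: ennreal_less_zero_iff)
    then show ?thesis
    proof eventually_elim
      case (elim n)
      obtain G where G: "correlated (T n) T_inf G \<eta> b"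
        using propinquity_correlated[OF Tn Ti elim \<eta>] by blast
      have G1: "correlated (T n) T_inf G \<eta>1 b1"
        using correlated_mono[OF G] by (simp add: \<eta>_def b_def)
      have G2: "correlated T_inf (T n) (G\<inverse>) \<eta>2 b2"
        using correlated_mono[OF correlated_converse[OF G]] by (simp add: \<eta>_def b_def)
      show ?case
        using close_spectra[OF Tn Ti d(2)[OF _ \<delta>(2)] 1(2)[OF Tn Ti G1, unfolded m_def]
            2(2)[OF Ti Tn G2, unfolded m_def] \<delta>(1)]
        by blast
    qed
  qed
  have "\<forall>\<^sub>F n in sequentially. card (below (T n) \<Lambda>) = card (below T_inf \<Lambda>)"
    using main[of "d / 2"] d(1) by (auto elim: eventually_mono)
  then obtain N where N: "\<And>n. N \<le> n \<Longrightarrow> card (below (T n) \<Lambda>) = card (below T_inf \<Lambda>)"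
    by (auto simp: eventually_sequentially)
  have "?H \<longlonglongrightarrow> 0"
  proof (rule order_tendstoI)
    fix a :: ennreal assume "0 < a"
    then obtain r where r: "0 < r" "r < a" using dense by blast
    \<comment> \<open>\<open>a\<close> may be infinite; the intermediate \<open>r\<close> is finite
      and supplies a real radius.\<close>
    then obtain r' where r': "r = ennreal r'" by (cases r) auto
    define \<delta> where "\<delta> = min (d / 2) r'"
    have \<delta>: "0 < \<delta>" "\<delta> < d" using d(1) r(1) r' by (auto simp: \<delta>_def)
    have "ennreal \<delta> \<le> r" unfolding r' by (intro ennreal_leI) (simp add: \<delta>_def)
    then have "ennreal \<delta> < a" using r(2) by simp
    then show "\<forall>\<^sub>F n in sequentially. ?H n < a"
      using main[OF \<delta>] by (auto elim!: eventually_mono)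
  qed simp
  moreover have "\<forall>n\<ge>N.
      (\<Sum>\<^sub>\<infinity>z\<in>Sp_in (T n) \<Lambda>. eig_multiplicity z (T n))
        = (\<Sum>\<^sub>\<infinity>z\<in>Sp_in T_inf \<Lambda>. eig_multiplicity z T_inf) \<and>
      (\<Sum>\<^sub>\<infinity>z\<in>Sp_in T_inf \<Lambda>. eig_multiplicity z T_inf) < \<infinity>"
    using N by (simp add: sum_multiplicity_eq[OF Tn] sum_multiplicity_eq[OF Ti])
  ultimately show ?thesis by blast
qed

end
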